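(* Let $R>0$ and let $k\in\mathbb{N}$ satisfy $k\ge 2$. Define the critical angular velocity $$\Omega_k=\frac{\sqrt{k^2-1}}{R^2}.$$ Then there exist $\varepsilon_k>0$ and a smooth mapping $$(-\varepsilon_k,\varepsilon_k)\ni\lambda\mapsto(\Omega^\lambda,\boldsymbol{y}^\lambda,c^\lambda,V^\lambda)\in\mathbb{R}\times H^4(\mathbb{T})^3\times\mathbb{R}\times\mathbb{R}$$ with $$(\Omega^0,\boldsymbol{y}^0,c^0,V^0)=(\Omega_k,\boldsymbol{x}^R_0,-R\Omega_k,1/R)$$ such that, for each $\lambda\in(-\varepsilon_k,\varepsilon_k)$, $(\Omega^\lambda,\boldsymbol{y}^\lambda,c^\lambda,V^\lambda)$ defines an axial screw motion $$\boldsymbol{x}^{(\lambda)}(s,t)=Q^{\Omega^\lambda t}_z\boldsymbol{y}^\lambda(s+c^\lambda t)+V^\lambda t\,\boldsymbol{e}_3,\qquad (s,t)\in\mathbb{T}\times[0,\infty).$$ Moreover, the family $\{\boldsymbol{x}^{(\lambda)}\}_{\lambda\in(-\varepsilon_k,\varepsilon_k)}$ satisfies the following properties. (1) There exists $C>0$ such that, for any $\lambda\in(-\varepsilon_k,\varepsilon_k)$, $$\operatorname{dist}(\boldsymbol{x}^{(\lambda)}(t),\Sigma)\le C|\lambda|,\qquad t\ge 0.$$ (2) For any $\lambda\in(-\varepsilon_k,\varepsilon_k)$ with $\lambda\ne 0$, there exist $\gamma,t_0>0$ such that $$|\boldsymbol{x}^{(\lambda)}(s,t)-\boldsymbol{x}^R(s,t)|\ge\gamma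 t,\qquad (s,t)\in\mathbb{T}\times[t_0,\infty).$$ This drift is caused by the difference in velocity along the axis of symmetry: $\boldsymbol{x}^{(\lambda)}$ moves strictly more slowly along the axis of symmetry than $\boldsymbol{x}^R$ (that is, $V^\lambda<1/R$ for $\lambda\neq 0$). More precisely, when $\lambda\to0$, $$V^\lambda=\frac1R-\left(\frac{k^2(k^2-1)}{2R^3}\right)\lambda^2+o(\lambda^2).$$
   Context: Fix $R>0$, $L=2\pi R$, $\mathbb{T}=\mathbb{R}/L\mathbb{Z}$, and let $\{\boldsymbol{e}_1,\boldsymbol{e}_2,\boldsymbol{e}_3\}$ be the canonical basis of $\mathbb{R}^3$. $H^m(\mathbb{T})$ is the usual Sobolev space of real-valued functions on $\mathbb{T}$, with norm $\|\cdot\|_{H^m(\mathbb{T})}$. Subscripts $s,t$ denote partial derivatives and $\times$ the cross product in $\mathbb{R}^3$. The Localized Induction Equation (LIE) is $$\boldsymbol{x}_t=\boldsymbol{x}_s\times\boldsymbol{x}_{ss}\quad\text{in }\mathbb{T}\times(0,\infty)$$ for $\boldsymbol{x}=\boldsymbol{x}(s,t)\in\mathbb{R}^3$. The circular profile and the circular filament (a solution of (LIE)) are $$\boldsymbol{x}^R_0(s)=R\cos(s/R)\,\boldsymbol{e}_1+R\sin(s/R)\,\boldsymbol{e}_2,\qquad \boldsymbol{x}^R(s,t)=\boldsymbol{x}^R_0(s)+\frac tR\boldsymbol{e}_3.$$ $Q^\alpha_z$ denotes the rotation matrix around the $\boldsymbol{e}_3$-axis through angle $\alpha$. $\Sigma=\{Q^\alpha_z\boldsymbol{x}^R_0(\cdot)+\tau\mid\alpha\in\mathbb{R},\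 \tau\in\mathbb{R}^3\}\subset H^2(\mathbb{T})^3$, and the distance is $$\operatorname{dist}(\boldsymbol{x}(t),\Sigma)=\inf_{\alpha\in\mathbb{R},\,\tau\in\mathbb{R}^3}\|\boldsymbol{x}(t)-(Q^\alpha_z\boldsymbol{x}^R_0+\tau)\|_{H^2(\mathbb{T})}.$$ Axial screw motion: a solution $\boldsymbol{x}$ of (LIE) is called an axial screw motion if there exist $\Omega\in\mathbb{R}$ (angular velocity), $\boldsymbol{y}\in H^4(\mathbb{T})^3$ with $|\boldsymbol{y}_s|=1$ on $\mathbb{T}$, and $c,V\in\mathbb{R}$ such that $\boldsymbol{x}(s,t)=Q^{\Omega t}_z\boldsymbol{y}(s+ct)+Vt\,\boldsymbol{e}_3$ for $(s,t)\in\mathbb{T}\times[0,\infty)$. Saying that $(\Omega,\boldsymbol{y},c,V)$ defines an axial screw motion means that $|\boldsymbol{y}_s|=1$ on $\mathbb{T}$ and the function given by this formula solves (LIE). *)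

theory Defs
  imports "HOL-Analysis.Analysis" "HOL-Library.Landau_Symbols"
begin

section \<open>Sobolev spaces on the torus\<close>

text \<open>
  Functions on the torus of length \<open>L\<close> are represented by \<open>L\<close>-periodic functions on the real line;
  elements of \<open>L2_torus\<close> and of the Sobolev spaces are thus representatives of classes modulo
  equality almost everywhere, and \<open>hnorm\<close>, \<open>hnorm3\<close> are seminorms on them.
\<close>

definition L2_torus :: "real \<Rightarrow> (real \<Rightarrow> real) set" where
  "L2_torus L = {f. (\<forall>s. f (s + L) = f s) \<and> f \<in> borel_measurable lebesgue \<and>
                    set_integrable lebesgue {0..L} (\<lambda>s. (f s)\<^sup>2)}"

definition smooth_torus :: "real \<Rightarrow> (real \<Rightarrow> real) set" where
  "smooth_torus L = {\<phi>. (\<forall>s. \<phi> (s + L) = \<phi> s) \<and>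
                         (\<forall>n s. (deriv ^^ n) \<phi> field_differentiable (at s))}"

text \<open>No boundary terms occur below because the test functions are periodic.\<close>

definition is_weak_deriv :: "real \<Rightarrow> nat \<Rightarrow> (real \<Rightarrow> real) \<Rightarrow> (real \<Rightarrow> real) \<Rightarrow> bool" where
  "is_weak_deriv L j f g \<longleftrightarrow> g \<in> L2_torus L \<and>
     (\<forall>\<phi>\<in>smooth_torus L.
        (LINT s:{0..L}|lebesgue. f s * (deriv ^^ j) \<phi> s) =
        (-1) ^ j * (LINT s:{0..L}|lebesgue. g s * \<phi> s))"

definition sobolev :: "real \<Rightarrow> nat \<Rightarrow> (real \<Rightarrow> real) set" where
  "sobolev L m = {f \<in> L2_torus L. \<forall>j\<le>m. \<exists>g. is_weak_deriv L j f g}"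

text \<open>Weak derivatives are unique up to null sets, so the choice does not affect the norms.\<close>

definition weak_deriv :: "real \<Rightarrow> nat \<Rightarrow> (real \<Rightarrow> real) \<Rightarrow> real \<Rightarrow> real" where
  "weak_deriv L j f = (SOME g. is_weak_deriv L j f g)"

definition hnorm :: "real \<Rightarrow> nat \<Rightarrow> (real \<Rightarrow> real) \<Rightarrow> real" where
  "hnorm L m f = sqrt (\<Sum>j\<le>m. LINT s:{0..L}|lebesgue. (weak_deriv L j f s)\<^sup>2)"

definition sobolev3 :: "real \<Rightarrow> nat \<Rightarrow> (real \<Rightarrow> real^3) set" where
  "sobolev3 L m = {y. \<forall>i. (\<lambda>s. y s $ i) \<in> sobolev L m}"

definition hnorm3 :: "real \<Rightarrow> nat \<Rightarrow> (real \<Rightarrow> real^3) \<Rightarrow> real" where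
  "hnorm3 L m y = sqrt (\<Sum>i\<in>UNIV. (hnorm L m (\<lambda>s. y s $ i))\<^sup>2)"


section \<open>The Localized Induction Equation and axial screw motions\<close>

abbreviation torus_length :: "real \<Rightarrow> real" where
  "torus_length R \<equiv> 2 * pi * R"

definition solves_LIE :: "real \<Rightarrow> (real \<Rightarrow> real \<Rightarrow> real^3) \<Rightarrow> bool" where
  "solves_LIE L x \<longleftrightarrow>
     (\<forall>s. \<forall>t\<ge>0. x (s + L) t = x s t) \<and>
     (\<exists>xs xss xt. \<forall>s. \<forall>t>0.
        ((\<lambda>\<sigma>. x \<sigma> t) has_vector_derivative xs s t) (at s) \<and>
        ((\<lambda>\<sigma>. xs \<sigma> t) has_vector_derivative xss s t) (at s) \<and>
        ((\<lambda>\<tau>. x s \<tau>) has_vector_derivative xt s t) (at t) \<and>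
        xt s t = cross3 (xs s t) (xss s t))"

definition rot_z :: "real \<Rightarrow> real^3^3" where
  "rot_z \<alpha> = vector [vector [cos \<alpha>, - sin \<alpha>, 0],
                     vector [sin \<alpha>,   cos \<alpha>, 0],
                     vector [0,       0,     1]]"

definition circle_profile :: "real \<Rightarrow> real \<Rightarrow> real^3" where
  "circle_profile R s = (R * cos (s / R)) *\<^sub>R axis 1 1 + (R * sin (s / R)) *\<^sub>R axis 2 1"

definition circle_filament :: "real \<Rightarrow> real \<Rightarrow> real \<Rightarrow> real^3" where
  "circle_filament R s t = circle_profile R s + (t / R) *\<^sub>R axis 3 1"

definition circle_orbit :: "real \<Rightarrow> (real \<Rightarrow> real^3) set" where
  "circle_orbit R = {\<lambda>s. rot_z \<alpha> *v circle_profile R s + \<tau> | \<alpha> \<tau>. True}"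

definition dist_H2 :: "real \<Rightarrow> (real \<Rightarrow> real^3) \<Rightarrow> (real \<Rightarrow> real^3) set \<Rightarrow> real" where
  "dist_H2 L f A = (INF g\<in>A. hnorm3 L 2 (\<lambda>s. f s - g s))"

type_synonym screw_param = "real \<times> (real \<Rightarrow> real^3) \<times> real \<times> real"

fun screw_motion :: "screw_param \<Rightarrow> real \<Rightarrow> real \<Rightarrow> real^3" where
  "screw_motion (\<Omega>, y, c, V) s t = rot_z (\<Omega> * t) *v y (s + c * t) + (V * t) *\<^sub>R axis 3 1"

text \<open>Differentiability everywhere forces \<open>y\<close> to be the continuous representative of its class.\<close>

fun defines_axial_screw_motion :: "real \<Rightarrow> screw_param \<Rightarrow> bool" where
  "defines_axial_screw_motion L (\<Omega>, y, c, V) \<longleftrightarrow>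
     y \<in> sobolev3 L 4 \<and>
     (\<forall>s. y differentiable (at s) \<and> norm (vector_derivative y (at s)) = 1) \<and>
     solves_LIE L (screw_motion (\<Omega>, y, c, V))"


section \<open>Smooth curves in the parameter space\<close>

text \<open>
  The parameter space is the product of the reals, the vector-valued fourth-order Sobolev space,
  the reals and the reals, with the product norm.  Smoothness of a curve is infinite
  (strong) differentiability in this norm.
\<close>

definition screw_param_space :: "real \<Rightarrow> screw_param set" where
  "screw_param_space L = {(\<Omega>, y, c, V) |\<Omega> y c V. y \<in> sobolev3 L 4}"

fun screw_param_norm :: "real \<Rightarrow> screw_param \<Rightarrow> real" where
  "screw_param_norm L (\<Omega>, y, c, V) = sqrt (\<Omega>\<^sup>2 + (hnorm3 L 4 y)\<^sup>2 + c\<^sup>2 + V\<^sup>2)"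

fun screw_param_scale :: "real \<Rightarrow> screw_param \<Rightarrow> screw_param" where
  "screw_param_scale r (\<Omega>, y, c, V) = (r * \<Omega>, (\<lambda>s. r *\<^sub>R y s), r * c, r * V)"

definition has_curve_derivative ::
  "real \<Rightarrow> (real \<Rightarrow> screw_param) \<Rightarrow> screw_param \<Rightarrow> real \<Rightarrow> bool" where
  "has_curve_derivative L f d l \<longleftrightarrow>
     ((\<lambda>h. screw_param_norm L (screw_param_scale (1 / h) (f (l + h) - f l) - d)) \<longlongrightarrow> 0) (at 0)"

definition smooth_curve_on :: "real \<Rightarrow> real set \<Rightarrow> (real \<Rightarrow> screw_param) \<Rightarrow> bool" where
  "smooth_curve_on L I f \<longleftrightarrow>
     (\<exists>D :: nat \<Rightarrow> real \<Rightarrow> screw_param.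
        (\<forall>l\<in>I. D 0 l = f l) \<and>
        (\<forall>n. \<forall>l\<in>I. D n l \<in> screw_param_space L \<and> has_curve_derivative L (D n) (D (Suc n) l) l))"

definition critical_velocity :: "real \<Rightarrow> nat \<Rightarrow> real" where
  "critical_velocity R k = sqrt ((real k)\<^sup>2 - 1) / R\<^sup>2"

end

theory Submission
  imports Defs "HOL-Complex_Analysis.Complex_Analysis"
begin

text \<open>
  A curve \<open>y\<close> parametrised by arclength is carried along by a screw motion solving the equation exactly
  when \<open>\<Omega> e3 \<times> y + c y' + V e3 = y' \<times> y''\<close>.  Crossing with \<open>y'\<close> gives \<open>y'' = (V e3 + \<Omega> e3 \<times> y) \<times> y'\<close>,
  the motion of a charged particle in an axially symmetric field, so momentum along and about the
  axis are conserved.  Everything is therefore determined by the axial slope \<open>p = y3'\<close>: in cylindrical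
  coordinates \<open>r^2 = 2 (A - p) / \<Omega>\<close> and \<open>\<theta>' = - (c + V p) / (2 (A - p))\<close>, while unit speed becomes the
  equation \<open>p'^2 = 2 \<Omega> (A - p) (1 - p^2) - (c + V p)^2\<close> of a particle in a cubic potential.  Conversely,
  every such \<open>p\<close> generates a screw motion (\<open>screw_motion_from_axial_profile\<close>).  The curve closes up with
  \<open>k\<close>-fold symmetry if \<open>p\<close> has period \<open>L / k\<close> and mean zero, and \<open>\<theta>\<close> gains \<open>2 \<pi> / k\<close> over a period.

  Oscillations in a cubic potential are \<open>p = a (C - M)\<close> with \<open>C = cos \<Psi>\<close> and
  \<open>\<Psi>' = N sqrt (1 - x cos \<Psi>)\<close>, where the modulus \<open>x\<close> measures the amplitude, \<open>N\<close> normalises the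
  period and \<open>M\<close> is the mean of \<open>C\<close> (\<open>pendulum_profile_exists\<close>).  Matching the coefficients of the two
  cubics expresses \<open>a, A, c, V\<close> explicitly by \<open>x\<close> and one further unknown.  This unknown is fixed by the
  angle condition, a scalar equation which at \<open>x = 0\<close> merely says that the unknown equals \<open>1\<close>, so
  a contraction solves it for small \<open>x\<close> (\<open>screw_data_exists\<close>).  The bifurcation parameter is a
  multiple of \<open>x\<close>.

  Both the inversion that produces \<open>\<Psi>\<close> and the angle equation are solved by the same holomorphic fixed
  point lemma, so the family is holomorphic in the parameter and in the arclength on a complex strip.
  Cauchy's estimates then bound all arclength derivatives by suprema over the strip; this gives
  smoothness of the curve of parameters in the Sobolev norm (\<open>smooth_curve_on_holo2\<close>) as well as
  the Lipschitz bound behind orbital stability.  The Sobolev norms involve an arbitrary choice of weak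
  derivatives, which is harmless because weak derivatives are unique almost everywhere
  (\<open>is_weak_deriv_unique_norm\<close>).

  The velocity expansion needs no second derivatives: the closing conditions combine to an exact formula
  for \<open>(1 - R V) / a^2\<close> in terms of functions that are continuous at \<open>x = 0\<close>
  (\<open>velocity_defect_identity\<close>).  The sign of the defect makes the axial velocity smaller than that of the
  circle, and the drift follows because the third component of \<open>y\<close> is bounded.
\<close>

section \<open>Holomorphic functions of two variables\<close>

text \<open>
  Separate holomorphy together with joint continuity.  Local boundedness would be equivalent; joint
  continuity is the form in which the Leibniz rule and compactness arguments use it.
\<close>
definition holo2 :: "complex set \<Rightarrow> complex set \<Rightarrow> (complex \<Rightarrow> complex \<Rightarrow> complex) \<Rightarrow> bool" where
  "holo2 A B f \<longleftrightarrow> continuous_on (A \<times> B) (\<lambda>z. f (fst z) (snd z)) \<and>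
     (\<forall>x\<in>A. f x holomorphic_on B) \<and> (\<forall>y\<in>B. (\<lambda>x. f x y) holomorphic_on A)"

lemma holo2I:
  assumes "continuous_on (A \<times> B) (\<lambda>z. f (fst z) (snd z))"
    and "\<And>x. x \<in> A \<Longrightarrow> f x holomorphic_on B" and "\<And>y. y \<in> B \<Longrightarrow> (\<lambda>x. f x y) holomorphic_on A"
  shows "holo2 A B f"
  using assms by (auto simp: holo2_def)

lemma holo2D:
  assumes "holo2 A B f"
  shows "continuous_on (A \<times> B) (\<lambda>z. f (fst z) (snd z))"
    and "\<And>x. x \<in> A \<Longrightarrow> f x holomorphic_on B" and "\<And>y. y \<in> B \<Longrightarrow> (\<lambda>x. f x y) holomorphic_on A"
  using assms by (auto simp: holo2_def)

lemma holo2_subset: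
  assumes "holo2 A B f" "A' \<subseteq> A" "B' \<subseteq> B"
  shows "holo2 A' B' f"
proof (rule holo2I)
  show "continuous_on (A' \<times> B') (\<lambda>z. f (fst z) (snd z))"
    by (rule continuous_on_subset[OF holo2D(1)[OF assms(1)]]) (use assms in auto)
  show "f x holomorphic_on B'" if "x \<in> A'" for x
    using holo2D(2)[OF assms(1)] assms that by (meson holomorphic_on_subset in_mono)
  show "(\<lambda>x. f x y) holomorphic_on A'" if "y \<in> B'" for y
    using holo2D(3)[OF assms(1)] assms that by (meson holomorphic_on_subset in_mono)
qed

lemma holo2_swap: "holo2 A B f \<Longrightarrow> holo2 B A (\<lambda>y x. f x y)"
proof (rule holo2I)
  assume f: "holo2 A B f"
  have "continuous_on (B \<times> A) (\<lambda>z. (\<lambda>w. f (fst w) (snd w)) (snd z, fst z))"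
    by (rule continuous_on_compose2[OF holo2D(1)[OF f]]) (auto intro!: continuous_intros)
  then show "continuous_on (B \<times> A) (\<lambda>z. f (snd z) (fst z))" by simp
qed (auto dest: holo2D)

lemma holo2_fst: "u holomorphic_on A \<Longrightarrow> holo2 A B (\<lambda>x y. u x)"
proof (rule holo2I)
  assume u: "u holomorphic_on A"
  show "continuous_on (A \<times> B) (\<lambda>z. u (fst z))"
    by (rule continuous_on_compose2[OF holomorphic_on_imp_continuous_on[OF u]]) (auto intro!: continuous_intros)
qed auto

lemma holo2_snd: "u holomorphic_on B \<Longrightarrow> holo2 A B (\<lambda>x y. u y)"
  using holo2_swap[OF holo2_fst] by blast

lemma holo2_const: "holo2 A B (\<lambda>x y. c)"
  by (rule holo2_fst) auto

lemma holo2_add: "holo2 A B f \<Longrightarrow> holo2 A B g \<Longrightarrow> holo2 A B (\<lambda>x y. f x y + g x y)"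
  unfolding holo2_def by (auto intro!: continuous_intros holomorphic_intros)

lemma holo2_diff: "holo2 A B f \<Longrightarrow> holo2 A B g \<Longrightarrow> holo2 A B (\<lambda>x y. f x y - g x y)"
  unfolding holo2_def by (auto intro!: continuous_intros holomorphic_intros)

lemma holo2_uminus: "holo2 A B f \<Longrightarrow> holo2 A B (\<lambda>x y. - f x y)"
  unfolding holo2_def by (auto intro!: continuous_intros holomorphic_intros)

lemma holo2_mult: "holo2 A B f \<Longrightarrow> holo2 A B g \<Longrightarrow> holo2 A B (\<lambda>x y. f x y * g x y)"
  unfolding holo2_def by (auto intro!: continuous_intros holomorphic_intros)

lemma holo2_power: "holo2 A B f \<Longrightarrow> holo2 A B (\<lambda>x y. f x y ^ n)"
  unfolding holo2_def by (auto intro!: continuous_intros holomorphic_intros)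

lemma holo2_divide: "holo2 A B f \<Longrightarrow> holo2 A B g \<Longrightarrow> (\<And>x y. x \<in> A \<Longrightarrow> y \<in> B \<Longrightarrow> g x y \<noteq> 0) \<Longrightarrow>
    holo2 A B (\<lambda>x y. f x y / g x y)"
  unfolding holo2_def by (auto intro!: continuous_intros holomorphic_intros)

lemma holo2_compose:
  assumes f: "holo2 A B f" and g: "g holomorphic_on S" and S: "\<And>x y. x \<in> A \<Longrightarrow> y \<in> B \<Longrightarrow> f x y \<in> S"
  shows "holo2 A B (\<lambda>x y. g (f x y))"
proof (rule holo2I)
  show "continuous_on (A \<times> B) (\<lambda>z. g (f (fst z) (snd z)))"
    by (rule continuous_on_compose2[OF holomorphic_on_imp_continuous_on[OF g] holo2D(1)[OF f]]) (use S in auto)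
  show "(\<lambda>y. g (f x y)) holomorphic_on B" if "x \<in> A" for x
    using holomorphic_on_compose_gen[OF holo2D(2)[OF f that] g] S that by (auto simp: o_def)
  show "(\<lambda>x. g (f x y)) holomorphic_on A" if "y \<in> B" for y
    using holomorphic_on_compose_gen[OF holo2D(3)[OF f that] g] S that by (auto simp: o_def)
qed

lemma holo2_subst:
  assumes f: "holo2 A B f" and u: "u holomorphic_on A'" "u ` A' \<subseteq> A" and v: "v holomorphic_on B'" "v ` B' \<subseteq> B"
  shows "holo2 A' B' (\<lambda>x y. f (u x) (v y))"
proof (rule holo2I)
  have "continuous_on (A' \<times> B') (\<lambda>z. (\<lambda>w. f (fst w) (snd w)) (u (fst z), v (snd z)))"
    by (rule continuous_on_compose2[OF holo2D(1)[OF f]])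
       (use u v in \<open>auto intro!: continuous_intros holomorphic_on_imp_continuous_on
           continuous_on_compose2[of A' u] continuous_on_compose2[of B' v]\<close>)
  then show "continuous_on (A' \<times> B') (\<lambda>z. f (u (fst z)) (v (snd z)))" by simp
  show "(\<lambda>y. f (u x) (v y)) holomorphic_on B'" if "x \<in> A'" for x
    using holomorphic_on_compose_gen[OF v(1) holo2D(2)[OF f, of "u x"] v(2)] u that by (auto simp: o_def)
  show "(\<lambda>x. f (u x) (v y)) holomorphic_on A'" if "y \<in> B'" for y
    using holomorphic_on_compose_gen[OF u(1) holo2D(3)[OF f, of "v y"] u(2)] v that by (auto simp: o_def)
qed

lemmas holo2_intros = holo2_const holo2_add holo2_diff holo2_uminus holo2_mult holo2_power holo2_divide

lemma norm_deriv_le_Cauchy: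
  assumes "f holomorphic_on S" "cball z d \<subseteq> S" "d > 0" "\<And>w. w \<in> cball z d \<Longrightarrow> norm (f w) \<le> M"
  shows "norm ((deriv ^^ n) f z) \<le> fact n * M / d ^ n"
proof (rule Cauchy_inequality)
  show "f holomorphic_on ball z d" using assms(1,2) by (meson ball_subset_cball holomorphic_on_subset)
  show "continuous_on (cball z d) f"
    using assms(1,2) by (meson holomorphic_on_imp_continuous_on holomorphic_on_subset)
qed (use assms in \<open>auto simp: dist_norm\<close>)

lemma norm_diff_le_Cauchy:
  assumes hol: "f holomorphic_on S" and S: "open S" "cball z (2*d) \<subseteq> S" and d: "d > 0"
    and M: "\<And>w. w \<in> cball z (2*d) \<Longrightarrow> norm (f w) \<le> M" and xy: "x \<in> cball z d" "y \<in> cball z d"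
  shows "norm (f x - f y) \<le> M / d * norm (x - y)"
proof (rule field_differentiable_bound[OF convex_cball _ _ xy])
  fix w assume w: "w \<in> cball z d"
  have "w \<in> S" using w S d by (intro subsetD[OF S(2)]) auto
  then show "(f has_field_derivative deriv f w) (at w within cball z d)"
    using hol S(1) holomorphic_derivI has_field_derivative_at_within by blast
  have sub: "cball w d \<subseteq> cball z (2*d)"
  proof
    fix u assume "u \<in> cball w d"
    then show "u \<in> cball z (2*d)" using w dist_triangle[of z u w] by auto
  qed
  have "norm ((deriv ^^ 1) f w) \<le> fact 1 * M / d ^ 1"
    by (rule norm_deriv_le_Cauchy[OF hol _ d]) (use sub S M in auto)
  then show "norm (deriv f w) \<le> M / d" by simp
qed

text \<open>The remainder in the difference quotient is controlled by the supremum.\<close>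
text \<open>
  The error of the difference quotient is controlled by the supremum of the function alone.  Applied
  uniformly in a second variable, this turns pointwise into uniform differentiability.
\<close>
lemma difference_quotient_le:
  assumes hol: "f holomorphic_on S" and S: "open S" "cball z (2*d) \<subseteq> S" and d: "d > 0"
    and M: "\<And>w. w \<in> cball z (2*d) \<Longrightarrow> norm (f w) \<le> M" and h: "norm h \<le> d" "h \<noteq> 0"
  shows "norm ((f (z + h) - f z) / h - deriv f z) \<le> 2 * M / d\<^sup>2 * norm h"
proof -
  have "norm ((deriv^^0) f (z+h) - (\<Sum>i\<le>1. (deriv^^i) f z * (z + h - z) ^ i / fact i)) \<le> 2 * M / d\<^sup>2 * norm (z + h - z) ^ (Suc 1) / fact 1"
  proof (rule complex_Taylor[of "cball z d" 1 "\<lambda>i. (deriv^^i) f", OF convex_cball])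
    fix i x assume x: "x \<in> cball z d"
    have "x \<in> S" using x S d by (intro subsetD[OF S(2)]) auto
    have "(deriv ^^ i) f holomorphic_on S" by (simp add: hol S(1) holomorphic_higher_deriv)
    then show "((deriv ^^ i) f has_field_derivative (deriv ^^ (Suc i)) f x) (at x within cball z d)"
      using \<open>x \<in> S\<close> S(1) holomorphic_derivI has_field_derivative_at_within by fastforce
  next
    fix x assume x: "x \<in> cball z d"
    have sub: "cball x d \<subseteq> cball z (2*d)"
  proof
    fix u assume "u \<in> cball x d"
    then show "u \<in> cball z (2*d)" using x dist_triangle[of z u x] by auto
  qed
    have "norm ((deriv ^^ (Suc 1)) f x) \<le> fact (Suc 1) * M / d ^ (Suc 1)"
      by (rule norm_deriv_le_Cauchy[OF hol _ d]) (use sub S M in auto)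
    then show "norm ((deriv ^^ (Suc 1)) f x) \<le> 2 * M / d\<^sup>2" by (simp add: power2_eq_square)
  qed (use h d in \<open>auto simp: dist_norm\<close>)
  then have "norm (f (z+h) - f z - deriv f z * h) \<le> 2 * M / d\<^sup>2 * norm h ^ 2"
    by (simp add: algebra_simps numeral_2_eq_2)
  then have "norm (f (z+h) - f z - deriv f z * h) / norm h \<le> 2 * M / d\<^sup>2 * norm h"
    using h by (simp add: field_simps power2_eq_square)
  moreover have "(f (z+h) - f z - deriv f z * h) / h = (f (z + h) - f z) / h - deriv f z"
    using h by (simp add: field_simps)
  ultimately show ?thesis by (metis norm_divide)
qed

text \<open>
  Boundedness makes the function Lipschitz in the first variable, uniformly in the second.
\<close>
lemma separately_holomorphic_continuous:
  assumes A: "open A" and B: "open B"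
    and f1: "\<And>x. x \<in> A \<Longrightarrow> f x holomorphic_on B" and f2: "\<And>y. y \<in> B \<Longrightarrow> (\<lambda>x. f x y) holomorphic_on A"
    and M: "\<And>x y. x \<in> A \<Longrightarrow> y \<in> B \<Longrightarrow> norm (f x y) \<le> M"
  shows "continuous_on (A \<times> B) (\<lambda>z. f (fst z) (snd z))"
  unfolding continuous_on_eq_continuous_at[OF open_Times[OF A B]]
proof (intro ballI)
  fix z assume "z \<in> A \<times> B"
  then obtain a b where z: "z = (a,b)" "a \<in> A" "b \<in> B" by auto
  obtain e where e: "e > 0" "cball a e \<subseteq> A" using A z open_contains_cball by blast
  define d where "d = e/2"
  have d: "d > 0" "cball a (2*d) \<subseteq> A" using e by (auto simp: d_def)
  have lim1: "((\<lambda>w. M / d * norm (fst w - a)) \<longlongrightarrow> M / d * norm (fst (a,b) - a)) (at (a,b))"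
    by (intro tendsto_intros)
  have ev: "eventually (\<lambda>w. w \<in> ball a d \<times> B) (at (a,b))"
    by (rule eventually_at_in_open') (use B z d in \<open>auto intro: open_Times\<close>)
  have 1: "((\<lambda>w. f (fst w) (snd w) - f a (snd w)) \<longlongrightarrow> 0) (at (a,b))"
  proof (rule Lim_null_comparison)
    show "eventually (\<lambda>w. norm (f (fst w) (snd w) - f a (snd w)) \<le> M / d * norm (fst w - a)) (at (a,b))"
      using ev
    proof eventually_elim
      case (elim w)
      then have w: "fst w \<in> ball a d" "snd w \<in> B" by auto
      show ?case
        by (rule norm_diff_le_Cauchy[OF f2[OF w(2)] A d(2) d(1)]) (use M d w in auto)
    qed
    show "((\<lambda>w. M / d * norm (fst w - a)) \<longlongrightarrow> 0) (at (a,b))" using lim1 by simp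
  qed
  have "isCont (f a) b"
    using holomorphic_on_imp_continuous_on[OF f1[OF z(2)]] B z(3) by (simp add: continuous_on_eq_continuous_at)
  then have 2: "((\<lambda>w. f a (snd w)) \<longlongrightarrow> f a b) (at (a,b))"
    by (rule isCont_tendsto_compose) (auto intro!: tendsto_eq_intros)
  have "((\<lambda>w. f (fst w) (snd w)) \<longlongrightarrow> f a b) (at (a,b))"
    using tendsto_add[OF 1 2] by simp
  then show "isCont (\<lambda>z. f (fst z) (snd z)) z" unfolding z by (simp add: isCont_def)
qed

lemma holo2_local_bound:
  assumes f: "holo2 A B f" and A: "open A" and B: "open B" and ab: "a \<in> A" "b \<in> B"
  obtains d M where "d > 0" "cball a d \<subseteq> A" "cball b d \<subseteq> B"
    "\<And>x y. x \<in> cball a d \<Longrightarrow> y \<in> cball b d \<Longrightarrow> norm (f x y) \<le> M"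
proof -
  obtain d1 d2 where d: "d1 > 0" "cball a d1 \<subseteq> A" "d2 > 0" "cball b d2 \<subseteq> B"
    using A B ab open_contains_cball by metis
  let ?d = "min d1 d2"
  have sub: "cball a ?d \<subseteq> A" "cball b ?d \<subseteq> B"
    using d by (meson cball_min_Int inf.boundedE min.cobounded1 min.cobounded2 subset_cball subset_trans)+
  have "compact ((\<lambda>z. f (fst z) (snd z)) ` (cball a ?d \<times> cball b ?d))"
    by (intro compact_continuous_image compact_Times compact_cball continuous_on_subset[OF holo2D(1)[OF f]])
       (use sub in auto)
  then obtain M where "\<And>z. z \<in> cball a ?d \<times> cball b ?d \<Longrightarrow> norm (f (fst z) (snd z)) \<le> M"
    using bounded_iff compact_imp_bounded by (metis (no_types, lifting) image_eqI)
  then show ?thesis using that[of ?d M] d sub by force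
qed

text \<open>
  In the second variable, the partial derivative is a locally uniform limit of difference quotients,
  hence holomorphic; joint continuity follows from the local bound given by Cauchy's estimate.
\<close>
lemma holo2_deriv_fst:
  assumes f: "holo2 A B f" and A: "open A" and B: "open B"
  shows "holo2 A B (\<lambda>x y. deriv (\<lambda>x. f x y) x)"
proof -
  have h2: "(\<lambda>x. deriv (\<lambda>x. f x y) x) holomorphic_on A" if "y \<in> B" for y
    using holo2D(3)[OF f that] A by (simp add: holomorphic_deriv)
  have loc: "\<exists>d>0. cball a d \<subseteq> A \<and> cball b d \<subseteq> B \<and> (\<exists>M. \<forall>x\<in>cball a d. \<forall>y\<in>cball b d. norm (deriv (\<lambda>x. f x y) x) \<le> M)
     \<and> (\<forall>x\<in>cball a d. (\<lambda>y. deriv (\<lambda>x. f x y) x) holomorphic_on ball b d)"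
    if ab: "a \<in> A" "b \<in> B" for a b
  proof -
    obtain e M where e: "e > 0" "cball a e \<subseteq> A" "cball b e \<subseteq> B"
       and M: "\<And>x y. x \<in> cball a e \<Longrightarrow> y \<in> cball b e \<Longrightarrow> norm (f x y) \<le> M"
      using holo2_local_bound[OF f A B ab] by metis
    define d where "d = e/3"
    have d: "d > 0" using e by (simp add: d_def)
    have cb: "cball x (2*d) \<subseteq> cball a e" if "x \<in> cball a d" for x
    proof
      fix w assume "w \<in> cball x (2*d)"
      then show "w \<in> cball a e" using that dist_triangle[of a w x] by (auto simp: d_def)
    qed
    have de: "cball a d \<subseteq> cball a e" "cball b d \<subseteq> cball b e" using e by (auto simp: d_def)
    have bd: "norm (deriv (\<lambda>x. f x y) x) \<le> M / d" if xy: "x \<in> cball a d" "y \<in> cball b d" for x y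
    proof -
      have "cball x d \<subseteq> cball x (2*d)" using d by auto
      then have "norm ((deriv ^^ 1) (\<lambda>x. f x y) x) \<le> fact 1 * M / d ^ 1"
        by (intro norm_deriv_le_Cauchy[OF holo2D(3)[OF f]] M) (use xy cb[OF xy(1)] de e d in blast)+
      then show ?thesis by simp
    qed
    have hol: "(\<lambda>y. deriv (\<lambda>x. f x y) x) holomorphic_on ball b d" if x: "x \<in> cball a d" for x
    proof (rule holomorphic_uniform_sequence)
      fix n :: nat
      let ?h = "of_real (d / Suc n) :: complex"
      have xh: "x + ?h \<in> A" "x \<in> A"
      proof -
        have "norm ?h \<le> d" using d by (simp add: norm_divide divide_simps del: of_nat_Suc)
        then have "x + ?h \<in> cball x (2*d)" using d by (simp add: dist_norm)
        then show "x + ?h \<in> A" using cb[OF x] e by blast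
        show "x \<in> A" using x de e by blast
      qed
      show "(\<lambda>y. (f (x + ?h) y - f x y) / ?h) holomorphic_on ball b d"
      proof -
        have "ball b d \<subseteq> B" using de e ball_subset_cball by blast
        then have "f (x + ?h) holomorphic_on ball b d" "f x holomorphic_on ball b d"
          using holo2D(2)[OF f xh(1)] holo2D(2)[OF f xh(2)] by (meson holomorphic_on_subset)+
        moreover have "?h \<noteq> 0" using d by (subst of_real_eq_0_iff) (simp del: of_nat_Suc)
        ultimately show ?thesis by (intro holomorphic_intros) auto
      qed
    next
      fix y assume y: "y \<in> ball b d"
      obtain r where r: "r > 0" "cball y r \<subseteq> ball b d" using y open_contains_cball open_ball by blast
      have "uniform_limit (cball y r) (\<lambda>n y. (f (x + of_real (d / Suc n)) y - f x y) / of_real (d / Suc n))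
              (\<lambda>y. deriv (\<lambda>x. f x y) x) sequentially"
      proof (rule uniform_limitI)
        fix \<epsilon> :: real assume eps: "\<epsilon> > 0"
        have "((\<lambda>n. 2 * M / d\<^sup>2 * (d / Suc n)) \<longlongrightarrow> 0) sequentially"
          using tendsto_mult[OF tendsto_const[of "2*M/d\<^sup>2 * d"] LIMSEQ_inverse_real_of_nat] by (simp add: field_simps)
        then have "eventually (\<lambda>n. 2 * M / d\<^sup>2 * (d / Suc n) < \<epsilon>) sequentially"
          using eps order_tendstoD(2) by blast
        then show "\<forall>\<^sub>F n in sequentially. \<forall>y\<in>cball y r. dist ((f (x + of_real (d / Suc n)) y - f x y) / of_real (d / Suc n)) (deriv (\<lambda>x. f x y) x) < \<epsilon>"
        proof eventually_elim
          case (elim n)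
          show ?case
          proof
            fix w assume "w \<in> cball y r"
            then have w: "w \<in> cball b d" using r by auto
            have "norm ((f (x + of_real (d / Suc n)) w - f x w) / of_real (d / Suc n) - deriv (\<lambda>x. f x w) x)
               \<le> 2 * M / d\<^sup>2 * norm (of_real (d / Suc n) :: complex)"
            proof (rule difference_quotient_le[OF holo2D(3)[OF f] A])
              show "w \<in> B" "cball x (2*d) \<subseteq> A" using w de e cb[OF x] by blast+
              show "norm (f u w) \<le> M" if "u \<in> cball x (2*d)" for u
                using M that cb[OF x] w de by blast
              show "norm (of_real (d / Suc n) :: complex) \<le> d" using d by (simp add: norm_divide divide_simps del: of_nat_Suc)
            next
              show "of_real (d / Suc n) \<noteq> (0::complex)" using d by (subst of_real_eq_0_iff) (simp del: of_nat_Suc)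
            qed (rule d)
            also have "norm (of_real (d / Suc n) :: complex) = d / Suc n" using d by (subst norm_of_real) (simp del: of_nat_Suc)
            finally show "dist ((f (x + of_real (d / Suc n)) w - f x w) / of_real (d / Suc n)) (deriv (\<lambda>x. f x w) x) < \<epsilon>"
              using elim by (simp add: dist_norm)
          qed
        qed
      qed
      then show "\<exists>da>0. cball y da \<subseteq> ball b d \<and> uniform_limit (cball y da) (\<lambda>n y. (f (x + of_real (d / Suc n)) y - f x y) / of_real (d / Suc n))
              (\<lambda>y. deriv (\<lambda>x. f x y) x) sequentially"
        using r by blast
    qed auto
    show ?thesis
    proof (rule exI[of _ d], intro conjI)
      show "cball a d \<subseteq> A" "cball b d \<subseteq> B" using de e by auto
      show "\<exists>M. \<forall>x\<in>cball a d. \<forall>y\<in>cball b d. norm (deriv (\<lambda>x. f x y) x) \<le> M" using bd by blast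
      show "\<forall>x\<in>cball a d. (\<lambda>y. deriv (\<lambda>x. f x y) x) holomorphic_on ball b d" using hol by blast
    qed (rule d)
  qed
  show ?thesis
  proof (rule holo2I)
    show "continuous_on (A \<times> B) (\<lambda>z. deriv (\<lambda>x. f x (snd z)) (fst z))"
      unfolding continuous_on_eq_continuous_at[OF open_Times[OF A B]]
    proof
      fix z assume "z \<in> A \<times> B"
      then obtain a b where z: "z = (a,b)" "a \<in> A" "b \<in> B" by auto
      obtain d M where d: "d > 0" "cball a d \<subseteq> A" "cball b d \<subseteq> B"
         and M: "\<forall>x\<in>cball a d. \<forall>y\<in>cball b d. norm (deriv (\<lambda>x. f x y) x) \<le> M"
         and hol: "\<forall>x\<in>cball a d. (\<lambda>y. deriv (\<lambda>x. f x y) x) holomorphic_on ball b d"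
        using loc[OF z(2,3)] by auto
      have "continuous_on (ball a d \<times> ball b d) (\<lambda>z. deriv (\<lambda>x. f x (snd z)) (fst z))"
      proof (rule separately_holomorphic_continuous[of _ _ "\<lambda>x y. deriv (\<lambda>x. f x y) x" M])
        show "(\<lambda>x. deriv (\<lambda>x. f x y) x) holomorphic_on ball a d" if "y \<in> ball b d" for y
          by (rule holomorphic_on_subset[OF h2]) (use d that in auto)
      qed (use M hol in auto)
      then show "isCont (\<lambda>z. deriv (\<lambda>x. f x (snd z)) (fst z)) z"
        using d z by (auto simp: continuous_on_eq_continuous_at[OF open_Times[OF open_ball open_ball]])
    qed
    show "(\<lambda>y. deriv (\<lambda>x. f x y) x) holomorphic_on B" if x: "x \<in> A" for x
      unfolding holomorphic_on_open[OF B]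
    proof
      fix b assume b: "b \<in> B"
      obtain d where "d > 0" "(\<lambda>y. deriv (\<lambda>x. f x y) x) holomorphic_on ball b d"
        using loc[OF x b] by (meson centre_in_cball less_imp_le)
      then show "\<exists>f'. ((\<lambda>y. deriv (\<lambda>x. f x y) x) has_field_derivative f') (at b)"
        by (metis centre_in_ball holomorphic_on_open open_ball)
    qed
  qed (use h2 in auto)
qed

text \<open>
  Continuity of one partial derivative makes \<open>f\<close> totally differentiable, so the chain rule applies.
\<close>
lemma holo2_compose_holomorphic:
  assumes f: "holo2 A B f" and A: "open A" and B: "open B" and u: "u holomorphic_on A" "u ` A \<subseteq> B"
  shows "(\<lambda>x. f x (u x)) holomorphic_on A"
  unfolding holomorphic_on_open[OF A]
proof
  fix a assume a: "a \<in> A"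
  have ua: "u a \<in> B" using u a by auto
  obtain e where e: "e > 0" "ball (u a) e \<subseteq> B" using B ua open_contains_ball by blast
  define fy where "fy = (\<lambda>x y. deriv (f x) y)"
  have fy: "holo2 B A (\<lambda>y x. fy x y)"
    unfolding fy_def using holo2_deriv_fst[OF holo2_swap[OF f] B A] .
  have "((\<lambda>(x, y). f x y) has_derivative
      (\<lambda>(tx, ty). deriv (\<lambda>x. f x (u a)) a * tx + blinfun_apply (blinfun_mult_right (fy a (u a))) ty)) (at (a, u a) within A \<times> ball (u a) e)"
  proof (rule has_derivative_partialsI)
    have "((\<lambda>x. f x (u a)) has_field_derivative deriv (\<lambda>x. f x (u a)) a) (at a)"
      by (rule holomorphic_derivI[OF holo2D(3)[OF f ua] A a])
    then show "((\<lambda>x. f x (u a)) has_derivative (\<lambda>tx. deriv (\<lambda>x. f x (u a)) a * tx)) (at a within A)"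
      by (meson has_field_derivative_imp_has_derivative has_derivative_at_withinI)
    show "(f x has_derivative blinfun_apply (blinfun_mult_right (fy x y))) (at y within ball (u a) e)"
      if "x \<in> A" "y \<in> ball (u a) e" for x y
    proof -
      have "(f x has_field_derivative fy x y) (at y)"
        unfolding fy_def by (rule holomorphic_derivI[OF holo2D(2)[OF f that(1)] B]) (use that e in auto)
      then have "(f x has_derivative (\<lambda>t. fy x y * t)) (at y within ball (u a) e)"
        by (meson has_field_derivative_imp_has_derivative has_derivative_at_withinI)
      then show ?thesis by (simp add: blinfun_mult_right.rep_eq)
    qed
    have "continuous (at (u a, a)) (\<lambda>z. fy (snd z) (fst z))"
      using holo2D(1)[OF fy] ua a A B by (simp add: continuous_on_eq_continuous_at open_Times)
    then have "continuous (at (a, u a)) (\<lambda>z. fy (fst z) (snd z))"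
      using isCont_o2[of "(a, u a)" "\<lambda>z. (snd z, fst z)" "\<lambda>z. fy (snd z) (fst z)"] by (simp add: continuous_intros)
    then have "continuous (at (a, u a) within A \<times> ball (u a) e) (\<lambda>z. fy (fst z) (snd z))"
      by (rule continuous_at_imp_continuous_at_within)
    then have "continuous (at (a, u a) within A \<times> ball (u a) e) (\<lambda>z. blinfun_mult_right (fy (fst z) (snd z)))"
      by (intro continuous_intros)
    then show "continuous (at (a, u a) within A \<times> ball (u a) e) (\<lambda>(x, y). blinfun_mult_right (fy x y))"
      by (simp only: case_prod_unfold)
  qed (use e in auto)
  then have D: "((\<lambda>(x, y). f x y) has_derivative
      (\<lambda>(tx, ty). deriv (\<lambda>x. f x (u a)) a * tx + fy a (u a) * ty)) (at (a, u a))"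
    using at_within_open[OF _ open_Times[OF A open_ball], of "(a, u a)" "u a" e] a e
    by (simp add: blinfun_mult_right.rep_eq)
  have du: "(u has_derivative (\<lambda>t. deriv u a * t)) (at a)"
    using holomorphic_derivI[OF u(1) A a] by (rule has_field_derivative_imp_has_derivative)
  have "((\<lambda>x. (\<lambda>(x, y). f x y) (x, u x)) has_derivative
        (\<lambda>t. (\<lambda>(tx, ty). deriv (\<lambda>x. f x (u a)) a * tx + fy a (u a) * ty) (t, deriv u a * t))) (at a)"
    by (rule has_derivative_compose[OF has_derivative_Pair[OF has_derivative_ident du] D])
  then have "((\<lambda>x. f x (u x)) has_derivative (\<lambda>t. (deriv (\<lambda>x. f x (u a)) a + fy a (u a) * deriv u a) * t)) (at a)"
    by (simp add: algebra_simps)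
  then show "\<exists>f'. ((\<lambda>x. f x (u x)) has_field_derivative f') (at a)"
    unfolding has_field_derivative_def by blast
qed

text \<open>
  A holomorphic implicit function theorem in fixed point form.  By Cauchy's estimate, a map of a disc of
  radius \<open>2 r\<close> that is bounded by \<open>r / 4\<close> contracts the disc of radius \<open>r\<close> by the factor \<open>1 / 2\<close>; the
  iterates are holomorphic in the parameter and converge uniformly, and they stay real when the
  map is real.
\<close>
lemma holomorphic_fixed_point:
  assumes A: "open A" and r: "r > 0" and T: "holo2 A (ball 0 (2*r)) T"
    and bd: "\<And>x w. x \<in> A \<Longrightarrow> w \<in> ball 0 (2*r) \<Longrightarrow> norm (T x w) \<le> r / 4"
  obtains u where "u holomorphic_on A" "\<And>x. x \<in> A \<Longrightarrow> norm (u x) \<le> r / 4" "\<And>x. x \<in> A \<Longrightarrow> T x (u x) = u x"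
    "\<And>x w. x \<in> A \<Longrightarrow> norm w \<le> r \<Longrightarrow> T x w = w \<Longrightarrow> w = u x"
    "\<And>x. x \<in> A \<Longrightarrow> (\<And>w. w \<in> \<real> \<Longrightarrow> norm w \<le> r \<Longrightarrow> T x w \<in> \<real>) \<Longrightarrow> u x \<in> \<real>"
proof -
  have lip: "dist (T x v) (T x w) \<le> 1/2 * dist v w" if x: "x \<in> A" and vw: "v \<in> cball 0 r" "w \<in> cball 0 r" for x v w
    unfolding dist_norm
  proof (rule field_differentiable_bound[OF convex_cball _ _ vw])
    fix z :: complex assume z: "z \<in> cball 0 r"
    have "(T x has_field_derivative deriv (T x) z) (at z)"
      by (rule holomorphic_derivI[OF holo2D(2)[OF T x] open_ball]) (use z r in auto)
    then show "(T x has_field_derivative deriv (T x) z) (at z within cball 0 r)"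
      by (rule has_field_derivative_at_within)
    have sub: "cball z (r/2) \<subseteq> ball 0 (2*r)"
    proof
      fix w assume "w \<in> cball z (r/2)"
      then show "w \<in> ball 0 (2*r)" using z r dist_triangle[of 0 w z] by auto
    qed
    have "norm ((deriv ^^ 1) (T x) z) \<le> fact 1 * (r/4) / (r/2) ^ 1"
      by (rule norm_deriv_le_Cauchy[OF holo2D(2)[OF T x] sub]) (use r sub bd[OF x] in auto)
    then show "norm (deriv (T x) z) \<le> 1/2" using r by simp
  qed
  have maps: "T x w \<in> cball 0 r" if "x \<in> A" "w \<in> cball 0 r" for x w
    using bd[OF that(1), of w] that r by (auto intro: order_trans)
  have ex1: "\<exists>!w\<in>cball 0 r. T x w = w" if x: "x \<in> A" for x
    by (rule Banach_fix[of "cball 0 r" "1/2"])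
       (use r maps[OF x] lip[OF x] in \<open>auto simp: complete_eq_closed\<close>)
  define u where "u = (\<lambda>x. THE w. w \<in> cball 0 r \<and> T x w = w)"
  have u: "u x \<in> cball 0 r" "T x (u x) = u x" if "x \<in> A" for x
    using theI'[OF ex1[OF that]] by (auto simp: u_def)
  have uniq: "w = u x" if "x \<in> A" "norm w \<le> r" "T x w = w" for x w
    using ex1[OF that(1)] u[OF that(1)] that(2,3) by auto
  define U where "U = (\<lambda>n x. (T x ^^ n) 0)"
  have U_Suc: "U (Suc n) x = T x (U n x)" for n x by (simp add: U_def)
  have U_ball: "norm (U n x) \<le> r" if "x \<in> A" for n x
    by (induction n) (use maps[OF that] r in \<open>auto simp: U_Suc\<close>, simp add: U_def)
  have U_hol: "U n holomorphic_on A" for n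
  proof (induction n)
    case 0
    then show ?case by (simp add: U_def)
  next
    case (Suc n)
    have "(\<lambda>x. T x (U n x)) holomorphic_on A"
      by (rule holo2_compose_holomorphic[OF T A open_ball Suc]) (use r le_less_trans[OF U_ball, of _ "2*r"] in \<open>auto simp: image_subset_iff\<close>)
    then show ?case by (simp add: U_Suc[abs_def])
  qed
  have conv: "dist (U n x) (u x) \<le> (1/2)^n * r" if x: "x \<in> A" for n x
  proof (induction n)
    case 0
    then show ?case using u[OF x] by (simp add: U_def)
  next
    case (Suc n)
    have "dist (U (Suc n) x) (u x) = dist (T x (U n x)) (T x (u x))" using u(2)[OF x] by (simp add: U_Suc)
    also have "\<dots> \<le> 1/2 * dist (U n x) (u x)" by (rule lip[OF x]) (use U_ball[OF x] u[OF x] in auto)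
    finally show ?case using Suc by simp
  qed
  have lim: "(\<lambda>n. (1/2)^n * r) \<longlonglongrightarrow> 0"
    by (rule tendsto_mult_left_zero) (rule LIMSEQ_power_zero, simp)
  have uhol: "u holomorphic_on A"
  proof (rule holomorphic_uniform_sequence[OF A U_hol])
    fix x assume "x \<in> A"
    then obtain d where d: "d > 0" "cball x d \<subseteq> A" using A open_contains_cball by blast
    have "uniform_limit (cball x d) U u sequentially"
    proof (rule uniform_limitI)
      fix e :: real assume "e > 0"
      then have "eventually (\<lambda>n. (1/2)^n * r < e) sequentially" using lim order_tendstoD(2) by blast
      then show "\<forall>\<^sub>F n in sequentially. \<forall>x\<in>cball x d. dist (U n x) (u x) < e"
        by eventually_elim (use conv d in \<open>meson in_mono le_less_trans\<close>)
    qed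
    then show "\<exists>d>0. cball x d \<subseteq> A \<and> uniform_limit (cball x d) U u sequentially" using d by blast
  qed
  show ?thesis
  proof (rule that[of u])
    show "u holomorphic_on A" by (rule uhol)
    show "T x (u x) = u x" if "x \<in> A" for x by (rule u(2)[OF that])
    show "w = u x" if "x \<in> A" "norm w \<le> r" "T x w = w" for x w by (rule uniq[OF that])
    show "norm (u x) \<le> r/4" if "x \<in> A" for x
      using bd[OF that, of "u x"] u[OF that] r by auto
    show "u x \<in> \<real>" if x: "x \<in> A" and re: "\<And>w. w \<in> \<real> \<Longrightarrow> norm w \<le> r \<Longrightarrow> T x w \<in> \<real>" for x
    proof (rule closed_sequentially[OF closed_complex_Reals])
      show "U n x \<in> \<real>" for n
        by (induction n) (use re U_ball[OF x] in \<open>auto simp: U_Suc\<close>, simp add: U_def)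
      have "(\<lambda>n. dist (U n x) (u x)) \<longlonglongrightarrow> 0"
        by (rule Lim_null_comparison[OF _ lim]) (use conv[OF x] in auto)
      then show "(\<lambda>n. U n x) \<longlonglongrightarrow> u x" using tendsto_dist_iff by blast
    qed
  qed
qed

text \<open>
  This is what makes the bound in the fixed point lemma available for small parameters: there it suffices
  that the map vanishes identically at parameter zero.
\<close>
lemma uniformly_small_near_zero:
  fixes h :: "'a::real_normed_vector \<Rightarrow> 'b::metric_space \<Rightarrow> complex"
  assumes r: "r > 0" and cont: "continuous_on (ball 0 r \<times> K) (\<lambda>z. h (fst z) (snd z))" and K: "compact K"
    and zero: "\<And>w. w \<in> K \<Longrightarrow> h 0 w = 0" and e: "e > 0"
  obtains d where "d > 0" "d \<le> r" "\<And>x w. norm x < d \<Longrightarrow> w \<in> K \<Longrightarrow> norm (h x w) \<le> e"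
proof -
  have "\<exists>d>0. \<forall>x. norm x < d \<longrightarrow> (\<forall>w\<in>K. norm (h x w) \<le> e)"
  proof (rule ccontr)
    assume "\<not> ?thesis"
    then have "\<forall>n::nat. \<exists>x w. norm x < min r (1 / Suc n) \<and> w \<in> K \<and> norm (h x w) > e"
      by (smt (verit, ccfv_SIG) r divide_pos_pos of_nat_0_less_iff zero_less_Suc zero_less_one not_le)
    then obtain X W where XW: "\<And>n::nat. norm (X n) < min r (1 / Suc n)" "\<And>n. W n \<in> K" "\<And>n. norm (h (X n) (W n)) > e"
      by metis
    obtain w s where w: "w \<in> K" "strict_mono s" "(W \<circ> s) \<longlonglongrightarrow> w"
      using K XW(2) unfolding compact_def by metis
    have "X \<longlonglongrightarrow> 0"
    proof (rule Lim_null_comparison)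
      show "\<forall>\<^sub>F n in sequentially. norm (X n) \<le> 1 / Suc n" using XW(1) by (auto intro!: always_eventually less_imp_le)
      show "(\<lambda>n. 1 / real (Suc n)) \<longlonglongrightarrow> 0" using LIMSEQ_inverse_real_of_nat by (simp add: inverse_eq_divide)
    qed
    then have X: "(X \<circ> s) \<longlonglongrightarrow> 0" using w(2) LIMSEQ_subseq_LIMSEQ by blast
    have "(\<lambda>n. (\<lambda>z. h (fst z) (snd z)) ((X \<circ> s) n, (W \<circ> s) n)) \<longlonglongrightarrow> (\<lambda>z. h (fst z) (snd z)) (0, w)"
    proof (rule continuous_on_tendsto_compose[OF cont tendsto_Pair[OF X w(3)]])
      have "norm (X n) < r" for n using XW(1)[of n] by simp
      then show "\<forall>\<^sub>F n in sequentially. ((X \<circ> s) n, (W \<circ> s) n) \<in> ball 0 r \<times> K"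
        using XW(2) by (intro always_eventually) (simp del: mem_ball add: mem_ball_0)
    qed (use r w in simp)
    then have "(\<lambda>n. norm (h (X (s n)) (W (s n)))) \<longlonglongrightarrow> norm (h 0 w)"
      by (intro tendsto_norm) simp
    then have "norm (h 0 w) \<ge> e"
      by (rule tendsto_lowerbound) (use XW(3) in \<open>auto intro!: always_eventually less_imp_le\<close>)
    then show False using zero[OF w(1)] e by simp
  qed
  then obtain d where "d > 0" "\<forall>x. norm x < d \<longrightarrow> (\<forall>w\<in>K. norm (h x w) \<le> e)" by blast
  then show ?thesis using that[of "min d r"] r by auto
qed

section \<open>Primitives of holomorphic families\<close>

text \<open>
  The primitive that vanishes at the origin, written over the fixed interval \<open>{0..1}\<close> so that it depends
  on parameters by the Leibniz rule.  Mean values over a period are expressed through it.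
\<close>
definition prim :: "(complex \<Rightarrow> complex) \<Rightarrow> complex \<Rightarrow> complex" where
  "prim f y = y * integral {0..1} (\<lambda>t. f (of_real t * y))"

lemma has_field_derivative_prim:
  assumes B: "open B" "convex B" "0 \<in> B" and f: "f holomorphic_on B" and y: "y \<in> B"
  shows "(prim f has_field_derivative f y) (at y)"
proof -
  obtain g where g: "\<And>x. x \<in> B \<Longrightarrow> (g has_field_derivative f x) (at x within B)"
    using holomorphic_convex_primitive'[OF B(2,1) f] by metis
  have prim: "prim f x = g x - g 0" if x: "x \<in> B" for x
  proof -
    have sub: "of_real t * x \<in> B" if "t \<in> {0..1}" for t
      using convexD_alt[OF B(2,3) x, of t] that by (simp add: scaleR_conv_of_real)
    have "((\<lambda>t. f (of_real t * x) * x) has_integral (g (of_real 1 * x) - g (of_real 0 * x))) {0..1}"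
    proof (rule fundamental_theorem_of_calculus)
      fix t :: real assume t: "t \<in> {0..1}"
      have "(g has_field_derivative f (of_real t * x)) (at (of_real t * x))"
        using g[OF sub[OF t]] at_within_open[OF sub[OF t] B(1)] by simp
      then have "((\<lambda>z. g (z * x)) has_field_derivative f (of_real t * x) * x) (at (of_real t))"
        by (intro DERIV_chain2[of g]) (auto intro!: derivative_eq_intros)
      then have "((\<lambda>t. g (of_real t * x)) has_vector_derivative f (of_real t * x) * x) (at t)"
        by (rule has_vector_derivative_real_field)
      then show "((\<lambda>t. g (of_real t * x)) has_vector_derivative f (of_real t * x) * x) (at t within {0..1})"
        by (rule has_vector_derivative_at_within)
    qed auto
    then have "integral {0..1} (\<lambda>t. f (of_real t * x) * x) = g (of_real 1 * x) - g (of_real 0 * x)"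
      by (rule integral_unique)
    then show ?thesis by (simp add: prim_def mult.commute)
  qed
  have "((\<lambda>x. g x - g 0) has_field_derivative f y) (at y)"
    using g[OF y] at_within_open[OF y B(1)] by (auto intro!: derivative_eq_intros)
  then show ?thesis
    by (rule has_field_derivative_transform_within_open[OF _ B(1) y]) (simp add: prim)
qed

lemma prim_0 [simp]: "prim f 0 = 0" by (simp add: prim_def)

lemma prim_eqI:
  assumes B: "open B" "convex B" "0 \<in> B" and f: "f holomorphic_on B" and y: "y \<in> B"
    and g: "\<And>z. z \<in> B \<Longrightarrow> (g has_field_derivative f z) (at z)" 
  shows "prim f y = g y - g 0"
proof -
  have "(\<lambda>z. prim f z - g z) constant_on B"
  proof (rule has_field_derivative_0_imp_constant_on[OF _ convex_connected[OF B(2)] B(1)])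
    show "((\<lambda>z. prim f z - g z) has_field_derivative 0) (at z)" if "z \<in> B" for z
      using has_field_derivative_prim[OF B f that] g[OF that] by (auto intro!: derivative_eq_intros)
  qed
  then have "prim f y - g y = prim f 0 - g 0" using y B(3) unfolding constant_on_def by metis
  then show ?thesis by (simp add: algebra_simps)
qed

lemma prim_Reals:
  assumes "\<And>x. x \<in> \<real> \<Longrightarrow> f x \<in> \<real>" "y \<in> \<real>" "continuous_on \<real> f"
  shows "prim f y \<in> \<real>"
proof -
  have "integral {0..1} (\<lambda>t. f (of_real t * y)) = integral {0..1} (\<lambda>t. of_real (Re (f (of_real t * y))))"
    by (rule integral_cong) (use assms in simp)
  also have "\<dots> = of_real (integral {0..1} (\<lambda>t. Re (f (of_real t * y))))"
  proof (rule integral_linear[OF _ bounded_linear_of_real, unfolded o_def])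
    have "continuous_on {0..1} (\<lambda>t. f (of_real t * y))"
      by (rule continuous_on_compose2[OF assms(3)]) (use assms(2) in \<open>auto intro!: continuous_intros\<close>)
    then show "(\<lambda>t. Re (f (of_real t * y))) integrable_on {0..1}"
      by (intro integrable_continuous_real continuous_intros)
  qed
  finally show ?thesis using assms(2) by (simp add: prim_def)
qed

text \<open>
  Both sides have the same derivative and agree at \<open>y = 0\<close>.
\<close>
lemma prim_periodic:
  assumes B: "open B" "convex B" "0 \<in> B" and f: "f holomorphic_on B" and y: "y \<in> B"
    and p: "\<And>z. z \<in> B \<Longrightarrow> z + p \<in> B" "\<And>z. z \<in> B \<Longrightarrow> f (z + p) = f z"
  shows "prim f (y + p) = prim f y + prim f p"
proof -
  have "prim f y = prim f (y + p) - prim f (0 + p)"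
  proof (rule prim_eqI[OF B f y])
    fix z assume z: "z \<in> B"
    have "(prim f has_field_derivative f (z + p)) (at (z + p))"
      using has_field_derivative_prim[OF B f p(1)[OF z]] .
    then show "((\<lambda>z. prim f (z + p)) has_field_derivative f z) (at z)"
      using p(2)[OF z] by (simp add: DERIV_shift)
  qed
  then show ?thesis by simp
qed

lemma holo2_prim:
  assumes f: "holo2 A B f" and A: "open A" and B: "open B" "convex B" "0 \<in> B"
  shows "holo2 A B (\<lambda>x. prim (f x))"
proof (rule holo2I)
  have sub: "of_real t * x \<in> B" if "t \<in> cbox 0 1" "x \<in> B" for t x
    using convexD_alt[OF B(2,3) that(2), of t] that by (simp add: scaleR_conv_of_real)
  have "continuous_on (A \<times> B) (\<lambda>z. integral (cbox 0 1) (\<lambda>t. f (fst z) (of_real t * snd z)))"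
  proof (rule integral_continuous_on_param)
    have "continuous_on ((A \<times> B) \<times> cbox 0 1) (\<lambda>w. (\<lambda>z. f (fst z) (snd z)) (fst (fst w), of_real (snd w) * snd (fst w)))"
      by (rule continuous_on_compose2[OF holo2D(1)[OF f]]) (auto intro!: continuous_intros sub)
    then show "continuous_on ((A \<times> B) \<times> cbox 0 1) (\<lambda>(z, t). f (fst z) (of_real t * snd z))"
      by (simp add: case_prod_beta)
  qed
  then show "continuous_on (A \<times> B) (\<lambda>z. prim (f (fst z)) (snd z))"
    unfolding prim_def by (intro continuous_intros) simp
  show "prim (f x) holomorphic_on B" if "x \<in> A" for x
    using has_field_derivative_prim[OF B holo2D(2)[OF f that]] B(1) holomorphic_on_open by blast
  show "(\<lambda>x. prim (f x) y) holomorphic_on A" if y: "y \<in> B" for y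
    unfolding holomorphic_on_open[OF A]
  proof
    fix a assume "a \<in> A"
    then obtain e where e: "e > 0" "ball a e \<subseteq> A" using A open_contains_ball by blast
    have "(\<lambda>x. integral (cbox 0 1) (\<lambda>t. f x (of_real t * y))) holomorphic_on ball a e"
    proof (rule leibniz_rule_holomorphic)
      show "((\<lambda>x. f x (of_real t * y)) has_field_derivative deriv (\<lambda>x. f x (of_real t * y)) x) (at x within ball a e)"
        if "x \<in> ball a e" "t \<in> cbox 0 1" for x t
        by (rule has_field_derivative_at_within, rule holomorphic_derivI[OF holo2D(3)[OF f sub[OF that(2) y]] A])
           (use that e in auto)
      show "(\<lambda>t. f x (of_real t * y)) integrable_on cbox 0 1" if "x \<in> ball a e" for x
        by (rule integrable_continuous, rule continuous_on_compose2[OF holomorphic_on_imp_continuous_on[OF holo2D(2)[OF f, of x]]])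
           (use that e sub[OF _ y] in \<open>auto intro!: continuous_intros\<close>)
      have "continuous_on (ball a e \<times> cbox 0 1) (\<lambda>w. (\<lambda>z. deriv (\<lambda>x. f x (snd z)) (fst z)) (fst w, of_real (snd w) * y))"
        by (rule continuous_on_compose2[OF holo2D(1)[OF holo2_deriv_fst[OF f A B(1)]]])
           (use e sub[OF _ y] in \<open>auto intro!: continuous_intros\<close>)
      then show "continuous_on (ball a e \<times> cbox 0 1) (\<lambda>(x, t). deriv (\<lambda>x. f x (of_real t * y)) x)"
        by (simp add: case_prod_beta)
    qed auto
    then have "(\<lambda>x. prim (f x) y) holomorphic_on ball a e"
      unfolding prim_def by (intro holomorphic_intros) simp
    then show "\<exists>f'. ((\<lambda>x. prim (f x) y) has_field_derivative f') (at a)"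
      using e(1) by (metis centre_in_ball holomorphic_on_open open_ball)
  qed
qed

section \<open>Pendulum profiles\<close>

definition strip :: "real \<Rightarrow> complex set" where
  "strip b = {z. \<bar>Im z\<bar> < b}"

lemma open_strip: "open (strip b)"
  unfolding strip_def by (intro open_Collect_less continuous_intros)

lemma convex_strip: "convex (strip b)"
proof -
  have "strip b = {z. Im z < b} \<inter> {z. Im z > -b}" by (auto simp: strip_def abs_less_iff)
  then show ?thesis by (simp add: convex_Int convex_halfspace_Im_lt convex_halfspace_Im_gt)
qed

lemma strip_plus_of_real: "z \<in> strip b \<Longrightarrow> z + of_real p \<in> strip b"
  by (simp add: strip_def)

lemma of_real_in_strip: "b > 0 \<Longrightarrow> of_real x \<in> strip b" by (simp add: strip_def)

lemma zero_in_strip: "b > 0 \<Longrightarrow> 0 \<in> strip b" by (simp add: strip_def)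

lemma strip_mono: "b \<le> c \<Longrightarrow> strip b \<subseteq> strip c" by (auto simp: strip_def)

lemma strip_plus: "z \<in> strip b \<Longrightarrow> norm w \<le> c \<Longrightarrow> z + w \<in> strip (b + c)"
  using abs_Im_le_cmod[of w] by (auto simp: strip_def)

lemma norm_cos_le_exp: "cmod (cos z) \<le> exp \<bar>Im z\<bar>"
  using cmod_cos_le_exp[of 1 z] by simp

lemma periodic_strip_int:
  assumes per: "\<And>z. z \<in> strip b \<Longrightarrow> f (z + of_real p) = (f z :: complex)" and z: "z \<in> strip b"
  shows "f (z + of_real (of_int n * p)) = f z"
proof (induction n rule: int_induct[of _ 0])
  case (step1 i)
  have "z + of_real (of_int (i+1) * p) = (z + of_real (of_int i * p)) + of_real p" by (simp add: algebra_simps)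
  then show ?case using per[OF strip_plus_of_real[OF z, of "of_int i * p"]] step1 by (simp only:)
next
  case (step2 i)
  have "z + of_real (of_int i * p) = (z + of_real (of_int (i-1) * p)) + of_real p" by (simp add: algebra_simps)
  then show ?case using per[OF strip_plus_of_real[OF z, of "of_int (i-1) * p"]] step2 by (simp only:)
qed simp

lemma reduce_mod_period:
  assumes "p > (0::real)"
  obtains n :: int where "0 \<le> Re z + of_int n * p" "Re z + of_int n * p \<le> p"
proof -
  have "of_int \<lfloor>Re z / p\<rfloor> \<le> Re z / p" "Re z / p \<le> of_int \<lfloor>Re z / p\<rfloor> + 1" by linarith+
  then have "of_int \<lfloor>Re z / p\<rfloor> * p \<le> Re z" "Re z \<le> (of_int \<lfloor>Re z / p\<rfloor> + 1) * p"
    using assms by (simp_all only: pos_le_divide_eq pos_divide_le_eq)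
  then show ?thesis
    by (intro that[of "- \<lfloor>Re z / p\<rfloor>"]) (simp_all add: algebra_simps)
qed

lemma csqrt_holo2:
  assumes "holo2 A B f" "\<And>x y. x \<in> A \<Longrightarrow> y \<in> B \<Longrightarrow> Re (f x y) > 0"
  shows "holo2 A B (\<lambda>x y. csqrt (f x y))"
  by (rule holo2_compose[OF assms(1) holomorphic_on_csqrt]) (use assms(2) in \<open>force simp: complex_nonpos_Reals_iff\<close>)

text \<open>
  The profile \<open>C = cos \<Psi>\<close> of a solution of \<open>\<Psi>' = N sqrt (1 - x cos \<Psi>)\<close>.  The function \<open>\<Psi> x\<close> inverts
  \<open>S / N\<close>, where \<open>S\<close> is the primitive of \<open>1 / sqrt (1 - x cos)\<close> and \<open>N\<close> normalises the period to
  \<open>2 \<pi>\<close>.  Writing \<open>\<Psi> = s + \<chi>\<close>, the equation \<open>S \<Psi> = N s\<close> is the fixed point equation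
  \<open>\<chi> = - D (s + \<chi>)\<close> with \<open>D w = S w / N - w\<close> periodic and small.  The width of the strip shrinks from \<open>3\<close> to \<open>1\<close> on
  the way; the bound \<open>27\<close> only has to exist and comes from \<open>exp 3 \<le> 27\<close>.
\<close>
lemma pendulum_profile_exists:
  obtains r :: real and C C' :: "complex \<Rightarrow> complex \<Rightarrow> complex" and N :: "complex \<Rightarrow> complex" where
    "r > 0" "holo2 (ball 0 r) (strip 1) C" "N holomorphic_on ball 0 r"
    "\<And>x. x \<in> ball 0 r \<Longrightarrow> N x \<noteq> 0" "N 0 = 1"
    "\<And>x s. x \<in> ball 0 r \<Longrightarrow> s \<in> strip 1 \<Longrightarrow> norm (C x s) \<le> 27"
    "\<And>x s. x \<in> ball 0 r \<Longrightarrow> s \<in> strip 1 \<Longrightarrow> (C x has_field_derivative C' x s) (at s)"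
    "\<And>x s. x \<in> ball 0 r \<Longrightarrow> s \<in> strip 1 \<Longrightarrow>
       (C' x has_field_derivative (N x)\<^sup>2 * (- C x s - x / 2 + 3 / 2 * x * (C x s)\<^sup>2)) (at s)"
    "\<And>x s. x \<in> ball 0 r \<Longrightarrow> s \<in> strip 1 \<Longrightarrow> (C' x s)\<^sup>2 = (N x)\<^sup>2 * (1 - (C x s)\<^sup>2) * (1 - x * C x s)"
    "\<And>x s. x \<in> ball 0 r \<Longrightarrow> s \<in> strip 1 \<Longrightarrow> C x (s + of_real (2 * pi)) = C x s"
    "\<And>s. s \<in> strip 1 \<Longrightarrow> C 0 s = cos s"
    "\<And>x s. x \<in> ball 0 r \<Longrightarrow> x \<in> \<real> \<Longrightarrow> s \<in> \<real> \<Longrightarrow> C x s \<in> \<real>"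
    "\<And>x. x \<in> ball 0 r \<Longrightarrow> x \<in> \<real> \<Longrightarrow> N x \<in> \<real>"
proof -
  define r0 :: real where "r0 = 1/60"
  have exp3: "exp (3::real) \<le> 27"
  proof -
    have "exp (3::real) = exp 1 ^ 3" by (simp add: exp_of_nat_mult[symmetric] flip: exp_of_nat_mult) 
    also have "\<dots> \<le> 3 ^ 3" by (rule power_mono[OF exp_le]) simp
    finally show ?thesis by simp
  qed
  have cosb: "norm (cos w) \<le> 27" if "w \<in> strip 3" for w
  proof -
    have "exp \<bar>Im w\<bar> \<le> exp 3" using that by (simp add: strip_def)
    then show ?thesis using norm_cos_le_exp[of w] exp3 by linarith
  qed
  have Repos: "Re (1 - x * cos w) > 0" if "x \<in> ball 0 r0" "w \<in> strip 3" for x w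
  proof -
    have "norm (x * cos w) \<le> 1/60 * 27"
      unfolding norm_mult by (rule mult_mono) (use that cosb in \<open>auto simp: r0_def\<close>)
    then show ?thesis using abs_Re_le_cmod[of "x * cos w"] by simp
  qed
  define q where "q = (\<lambda>x w. csqrt (1 - x * cos w))"
  define g where "g = (\<lambda>x w. 1 / q x w)"
  have q0: "q x w \<noteq> 0" if "x \<in> ball 0 r0" "w \<in> strip 3" for x w
  proof -
    have "1 - x * cos w \<noteq> 0" using Repos[OF that] by (metis less_irrefl zero_complex.simps(1))
    then show ?thesis by (simp add: q_def del: right_minus_eq)
  qed
  have qh: "holo2 (ball 0 r0) (strip 3) q"
    unfolding q_def by (rule csqrt_holo2, intro holo2_intros holo2_fst holo2_snd) (use Repos in \<open>auto intro!: holomorphic_intros\<close>)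
  have gh: "holo2 (ball 0 r0) (strip 3) g"
    unfolding g_def by (intro holo2_divide holo2_const qh q0)
  define S where "S = (\<lambda>x. prim (g x))"
  have s3: "open (strip 3)" "convex (strip 3)" "0 \<in> strip 3"
    by (simp_all add: open_strip convex_strip zero_in_strip)
  have Sh: "holo2 (ball 0 r0) (strip 3) S"
    unfolding S_def by (rule holo2_prim[OF gh open_ball s3])
  have dS: "(S x has_field_derivative g x w) (at w)" if "x \<in> ball 0 r0" "w \<in> strip 3" for x w
    unfolding S_def by (rule has_field_derivative_prim[OF s3 holo2D(2)[OF gh that(1)] that(2)])
  define p :: complex where "p = of_real (2 * pi)"
  define N where "N = (\<lambda>x. S x p / p)"
  have p3: "p \<in> strip 3" "p \<noteq> 0" by (auto simp: p_def strip_def)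
  have N0: "N 0 = 1"
  proof -
    have "S 0 p = p - 0"
      unfolding S_def
      by (rule prim_eqI[OF s3 holo2D(2)[OF gh] p3(1), of _ "\<lambda>z. z"]) (auto simp: r0_def g_def q_def)
    then show ?thesis using p3 by (simp add: N_def)
  qed
  have Nhol: "N holomorphic_on ball 0 r0"
    unfolding N_def using holo2D(3)[OF Sh p3(1)] p3(2) by (intro holomorphic_intros) auto
  obtain r1 where r1: "r1 > 0" "r1 \<le> r0" "\<And>x. x \<in> ball 0 r1 \<Longrightarrow> N x \<noteq> 0"
  proof -
    have "isCont N 0"
      using holomorphic_on_imp_continuous_on[OF Nhol] continuous_on_eq_continuous_at[OF open_ball] by (force simp: r0_def)
    then obtain d where "d > 0" "\<And>x. dist 0 x < d \<Longrightarrow> N x \<noteq> 0"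
      using continuous_at_avoid[of 0 N 0] N0 by auto
    then show ?thesis using that[of "min d r0"] by (auto simp: r0_def dist_commute)
  qed
  define D where "D = (\<lambda>x w. S x w / N x - w)"
  have Dh: "holo2 (ball 0 r1) (strip 3) D"
    unfolding D_def using r1 holomorphic_on_subset[OF Nhol subset_ball[OF r1(2)]]
    by (intro holo2_diff holo2_divide holo2_fst[of N] holo2_snd holo2_subset[OF Sh]) auto
  have Sper: "S x (w + p) = S x w + S x p" if "x \<in> ball 0 r0" "w \<in> strip 3" for x w
    unfolding S_def
    by (rule prim_periodic[OF s3 holo2D(2)[OF gh that(1)] that(2)])
       (auto simp: p_def strip_def g_def q_def cos_add cos_of_real sin_of_real)
  have Dper: "D x (w + of_real (2 * pi)) = D x w" if "x \<in> ball 0 r1" "w \<in> strip 3" for x w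
  proof -
    have x0: "x \<in> ball 0 r0" using that r1 by auto
    show ?thesis
      using Sper[OF x0 that(2)] r1(3)[OF that(1)] p3(2) unfolding p_def[symmetric]
      by (simp add: D_def add_divide_distrib) (simp add: N_def)
  qed
  have D0: "D 0 w = 0" if "w \<in> strip 3" for w
  proof -
    have "S 0 w = w - 0"
      unfolding S_def
      by (rule prim_eqI[OF s3 holo2D(2)[OF gh] that, of _ "\<lambda>z. z"]) (auto simp: r0_def g_def q_def)
    then show ?thesis by (simp add: D_def N0)
  qed
  let ?K = "cbox (Complex 0 (-2)) (Complex (2*pi) 2)"
  have K3: "?K \<subseteq> strip 3" by (auto simp: strip_def in_cbox_complex_iff)
  obtain r2 where r2: "r2 > 0" "r2 \<le> r1" "\<And>x w. norm x < r2 \<Longrightarrow> w \<in> ?K \<Longrightarrow> norm (D x w) \<le> 1/8"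
  proof (rule uniformly_small_near_zero[OF r1(1), of ?K D "1/8"])
    show "continuous_on (ball 0 r1 \<times> ?K) (\<lambda>z. D (fst z) (snd z))"
      by (rule continuous_on_subset[OF holo2D(1)[OF Dh]]) (use K3 in auto)
  qed (use D0 K3 in auto)
  have Dsmall: "norm (D x w) \<le> 1/8" if x: "x \<in> ball 0 r2" and w: "w \<in> strip 2" for x w
  proof -
    obtain n :: int where n: "0 \<le> Re w + of_int n * (2*pi)" "Re w + of_int n * (2*pi) \<le> 2*pi"
      using reduce_mod_period[of "2*pi" w] by auto
    have "D x (w + of_real (of_int n * (2*pi))) = D x w"
      by (rule periodic_strip_int[of 3]) (use Dper x r2 w strip_mono[of 2 3] in auto)
    moreover have "w + of_real (of_int n * (2*pi)) \<in> ?K"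
      using n w by (auto simp: in_cbox_complex_iff strip_def)
    ultimately show ?thesis using r2(3)[of x "w + of_real (of_int n * (2*pi))"] x by simp
  qed
  have s12: "s + w \<in> strip 2" if "s \<in> strip 1" "norm w \<le> 1" for s w
    using strip_plus[OF that] by simp
  have s23: "strip 2 \<subseteq> strip 3" by (simp add: strip_mono)
  define ch where "ch = (\<lambda>x s. SOME w. norm w \<le> 1/8 \<and> - D x (s + w) = w)"
  have fix1: "\<exists>u. u holomorphic_on ball 0 r2 \<and> (\<forall>x\<in>ball 0 r2. norm (u x) \<le> 1/8 \<and> - D x (s + u x) = u x
       \<and> (\<forall>w. norm w \<le> 1/2 \<longrightarrow> - D x (s + w) = w \<longrightarrow> w = u x)
       \<and> ((\<forall>w. w \<in> \<real> \<longrightarrow> norm w \<le> 1/2 \<longrightarrow> - D x (s + w) \<in> \<real>) \<longrightarrow> u x \<in> \<real>))" if s: "s \<in> strip 1" for s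
  proof (rule holomorphic_fixed_point[of "ball 0 r2" "1/2" "\<lambda>x w. - D x (s + w)"])
    show "holo2 (ball 0 r2) (ball 0 (2 * (1/2))) (\<lambda>x w. - D x (s + w))"
    proof (rule holo2_uminus, rule holo2_subst[OF Dh])
      show "(\<lambda>w. s + w) ` ball 0 (2 * (1/2)) \<subseteq> strip 3"
      proof (intro image_subsetI)
        fix w :: complex assume "w \<in> ball 0 (2 * (1/2))"
        then have "s + w \<in> strip 2" by (intro s12[OF s]) simp
        then show "s + w \<in> strip 3" using s23 by blast
      qed
      show "(\<lambda>x. x) ` ball 0 r2 \<subseteq> ball 0 r1" using subset_ball[OF r2(2)] by simp
    qed (auto intro!: holomorphic_intros)
    show "norm (- D x (s + w)) \<le> 1/2/4" if "x \<in> ball 0 r2" "w \<in> ball 0 (2 * (1/2))" for x w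
      using Dsmall[OF that(1) s12[OF s, of w]] that by simp
  next
    fix u assume u: "u holomorphic_on ball 0 r2" "\<And>x. x \<in> ball 0 r2 \<Longrightarrow> norm (u x) \<le> 1/2/4"
      "\<And>x. x \<in> ball 0 r2 \<Longrightarrow> - D x (s + u x) = u x"
      "\<And>x w. x \<in> ball 0 r2 \<Longrightarrow> norm w \<le> 1/2 \<Longrightarrow> - D x (s + w) = w \<Longrightarrow> w = u x"
      "\<And>x. x \<in> ball 0 r2 \<Longrightarrow> (\<And>w. w \<in> \<real> \<Longrightarrow> norm w \<le> 1/2 \<Longrightarrow> - D x (s + w) \<in> \<real>) \<Longrightarrow> u x \<in> \<real>"
    show ?thesis
    proof (intro exI[of _ u] conjI ballI allI impI)
      show "norm (u x) \<le> 1/8" if "x \<in> ball 0 r2" for x using u(2)[OF that] by simp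
      show "- D x (s + u x) = u x" if "x \<in> ball 0 r2" for x by (rule u(3)[OF that])
      show "w = u x" if "x \<in> ball 0 r2" "norm w \<le> 1/2" "- D x (s + w) = w" for x w by (rule u(4)[OF that])
      show "u x \<in> \<real>" if "x \<in> ball 0 r2" "\<forall>w. w \<in> \<real> \<longrightarrow> norm w \<le> 1/2 \<longrightarrow> - D x (s + w) \<in> \<real>" for x
        by (rule u(5)[OF that(1)]) (use that(2) in blast)
    qed (rule u(1))
  qed simp_all
  have chi_eq: "ch x s = v" if x: "x \<in> ball 0 r2" and s: "s \<in> strip 1" and v: "norm v \<le> 1/8" "- D x (s + v) = v" for x s v
  proof -
    obtain u where u: "\<And>w. norm w \<le> 1/2 \<Longrightarrow> - D x (s + w) = w \<Longrightarrow> w = u x"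
      using fix1[OF s] x by blast
    have "norm (ch x s) \<le> 1/8 \<and> - D x (s + ch x s) = ch x s"
      unfolding ch_def by (rule someI[of _ v]) (use v in auto)
    then show ?thesis using u[of v] u[of "ch x s"] v by simp
  qed
  have chi: "norm (ch x s) \<le> 1/8" "- D x (s + ch x s) = ch x s" if x: "x \<in> ball 0 r2" and s: "s \<in> strip 1" for x s
  proof -
    obtain v where "norm v \<le> 1/8" "- D x (s + v) = v"
      using fix1[OF s] x by blast
    then show "norm (ch x s) \<le> 1/8" "- D x (s + ch x s) = ch x s" using chi_eq[OF x s] by auto
  qed
  have chi_hol1: "(\<lambda>x. ch x s) holomorphic_on ball 0 r2" if s: "s \<in> strip 1" for s
  proof -
    obtain u where u: "u holomorphic_on ball 0 r2" "\<forall>x\<in>ball 0 r2. norm (u x) \<le> 1/8 \<and> - D x (s + u x) = u x"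
      using fix1[OF s] by blast
    have "u x = ch x s" if x: "x \<in> ball 0 r2" for x
      using chi_eq[OF x s, of "u x"] u(2) x by metis
    then show ?thesis by (rule holomorphic_transform[OF u(1)])
  qed
  have SR: "S x w \<in> \<real>" if x: "x \<in> ball 0 r2" "x \<in> \<real>" and w: "w \<in> \<real>" for x w
  proof -
    have x0: "x \<in> ball 0 r0" using x r1 r2 by auto
    have Rs: "\<real> \<subseteq> strip 3" by (auto simp: strip_def complex_is_Real_iff)
    have gR: "g x w \<in> \<real>" if "w \<in> \<real>" for w
    proof -
      have "x * cos w \<in> \<real>" using x that by (auto simp: cos_of_real elim!: Reals_cases)
      then have "1 - x * cos w \<in> \<real>" by simp
      then obtain t where t: "1 - x * cos w = of_real t" by (auto elim: Reals_cases)
      have "t > 0" using Repos[OF x0, of w] that Rs t by auto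
      then have "csqrt (of_real t) \<in> \<real>" by (simp add: csqrt_of_real_nonneg)
      then show ?thesis unfolding g_def q_def t by (intro Reals_divide) auto
    qed
    show ?thesis
      unfolding S_def
      by (rule prim_Reals[OF gR w]) (use continuous_on_subset[OF holomorphic_on_imp_continuous_on[OF holo2D(2)[OF gh x0]] Rs] in auto)
  qed
  have NR: "N x \<in> \<real>" if x: "x \<in> ball 0 r2" "x \<in> \<real>" for x
    unfolding N_def using SR[OF x, of p] by (auto simp: p_def intro!: Reals_divide)
  have chi_real: "ch x s \<in> \<real>" if x: "x \<in> ball 0 r2" "x \<in> \<real>" and s: "s \<in> \<real>" for x s
  proof -
    have s1: "s \<in> strip 1" using s by (auto simp: strip_def complex_is_Real_iff)
    obtain u where u: "norm (u x) \<le> 1/8" "- D x (s + u x) = u x"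
      "(\<forall>w. w \<in> \<real> \<longrightarrow> norm w \<le> 1/2 \<longrightarrow> - D x (s + w) \<in> \<real>) \<longrightarrow> u x \<in> \<real>"
      using fix1[OF s1] x by blast
    have "D x w \<in> \<real>" if "w \<in> \<real>" for w
      unfolding D_def using that SR[OF x that] NR[OF x] by (intro Reals_diff Reals_divide)
    then have "u x \<in> \<real>" using u(3) s by (simp add: Reals_minus_iff)
    then show ?thesis using chi_eq[OF x(1) s1 u(1,2)] by simp
  qed
  have chi_hol2: "ch x holomorphic_on strip 1" if x: "x \<in> ball 0 r2" for x
  proof (rule holomorphic_fixed_point[of "strip 1" "1/2" "\<lambda>s w. - D x (s + w)"])
    have x1: "x \<in> ball 0 r1" using x r2 by auto
    have "holo2 (strip 1) (ball 0 (2 * (1/2))) (\<lambda>s w. D x (s + w))"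
    proof (rule holo2_compose[OF _ holo2D(2)[OF Dh x1], where f = "\<lambda>s w. s + w"])
      show "holo2 (strip 1) (ball 0 (2 * (1/2))) (\<lambda>s w. s + w)"
        by (intro holo2_add holo2_fst holo2_snd) auto
      show "s + w \<in> strip 3" if "s \<in> strip 1" "w \<in> ball 0 (2 * (1/2))" for s w
        using s12[OF that(1), of w] that(2) s23 by (simp add: subset_iff)
    qed
    then show "holo2 (strip 1) (ball 0 (2 * (1/2))) (\<lambda>s w. - D x (s + w))" by (rule holo2_uminus)
    show "norm (- D x (s + w)) \<le> 1/2/4" if "s \<in> strip 1" "w \<in> ball 0 (2 * (1/2))" for s w
      using Dsmall[OF x s12[OF that(1), of w]] that by simp
  next
    fix u assume u: "u holomorphic_on strip 1" "\<And>s. s \<in> strip 1 \<Longrightarrow> norm (u s) \<le> 1/2/4"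
      "\<And>s. s \<in> strip 1 \<Longrightarrow> - D x (s + u s) = u s"
    have "u s = ch x s" if s: "s \<in> strip 1" for s
      using chi_eq[OF x s, of "u s"] u(2)[OF s] u(3)[OF s] by simp
    then show ?thesis by (rule holomorphic_transform[OF u(1)])
  qed (auto simp: open_strip)
  have chi_holo2: "holo2 (ball 0 r2) (strip 1) ch"
    by (rule holo2I[OF separately_holomorphic_continuous[of _ _ _ "1/8"]])
       (use chi_hol1 chi_hol2 chi in \<open>auto simp: open_strip\<close>)
  define \<Psi> where "\<Psi> = (\<lambda>x s. s + ch x s)"
  have Psih: "holo2 (ball 0 r2) (strip 1) \<Psi>"
    unfolding \<Psi>_def by (intro holo2_add chi_holo2 holo2_snd) (auto intro!: holomorphic_intros)
  have Psi2: "\<Psi> x s \<in> strip 3" if "x \<in> ball 0 r2" "s \<in> strip 1" for x s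
    unfolding \<Psi>_def using s12[OF that(2), of "ch x s"] chi(1)[OF that] s23 by auto
  have inv: "S x (\<Psi> x s) = N x * s" if "x \<in> ball 0 r2" "s \<in> strip 1" for x s
    using chi(2)[OF that] r1(3)[of x] that r2 by (simp add: D_def \<Psi>_def field_simps)
  have dPsi: "(\<Psi> x has_field_derivative N x * q x (\<Psi> x s)) (at s)" if x: "x \<in> ball 0 r2" and s: "s \<in> strip 1" for x s
  proof -
    have x0: "x \<in> ball 0 r0" using x r1 r2 by auto
    have d: "(\<Psi> x has_field_derivative deriv (\<Psi> x) s) (at s)"
      by (rule holomorphic_derivI[OF holo2D(2)[OF Psih x] open_strip s])
    have "((\<lambda>s. S x (\<Psi> x s)) has_field_derivative g x (\<Psi> x s) * deriv (\<Psi> x) s) (at s)"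
      by (rule DERIV_chain2[OF dS[OF x0 Psi2[OF x s]] d])
    moreover have "((\<lambda>s. S x (\<Psi> x s)) has_field_derivative N x) (at s)"
      by (rule has_field_derivative_transform_within_open[OF _ open_strip s, of "\<lambda>s. N x * s"])
         (auto intro!: derivative_eq_intros simp: inv[OF x])
    ultimately have "g x (\<Psi> x s) * deriv (\<Psi> x) s = N x" by (rule DERIV_unique)
    then have "deriv (\<Psi> x) s = N x * q x (\<Psi> x s)"
      using q0[OF x0 Psi2[OF x s]] by (simp add: g_def field_simps)
    then show ?thesis using d by simp
  qed
  define C where "C = (\<lambda>x s. cos (\<Psi> x s))"
  define C' where "C' = (\<lambda>x s. - sin (\<Psi> x s) * (N x * q x (\<Psi> x s)))"
  have q2: "q x w ^ 2 = 1 - x * cos w" for x w by (simp add: q_def)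
  show ?thesis
  proof (rule that[of r2 C N C'])
    show "r2 > 0" by (rule r2)
    show "holo2 (ball 0 r2) (strip 1) C"
      unfolding C_def by (rule holo2_compose[OF Psih, of cos UNIV]) (auto intro!: holomorphic_intros)
    show "N holomorphic_on ball 0 r2" by (rule holomorphic_on_subset[OF Nhol]) (use r1 r2 in auto)
    show "N x \<noteq> 0" if "x \<in> ball 0 r2" for x using r1 r2 that by auto
    show "N 0 = 1" by (rule N0)
    show "norm (C x s) \<le> 27" if "x \<in> ball 0 r2" "s \<in> strip 1" for x s
      unfolding C_def by (rule cosb[OF Psi2[OF that]])
    show "(C x has_field_derivative C' x s) (at s)" if "x \<in> ball 0 r2" "s \<in> strip 1" for x s
      unfolding C_def C'_def by (rule derivative_eq_intros dPsi[OF that] refl)+ 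
    show "(C' x s)\<^sup>2 = (N x)\<^sup>2 * (1 - (C x s)\<^sup>2) * (1 - x * C x s)" for x s
      unfolding C_def C'_def q2[symmetric] by (simp add: power_mult_distrib sin_squared_eq)
    show "(C' x has_field_derivative (N x)\<^sup>2 * (- C x s - x / 2 + 3 / 2 * x * (C x s)\<^sup>2)) (at s)"
      if x: "x \<in> ball 0 r2" and s: "s \<in> strip 1" for x s
    proof -
      have x0: "x \<in> ball 0 r0" using x r1 r2 by auto
      have np: "1 - x * cos (\<Psi> x s) \<notin> \<real>\<^sub>\<le>\<^sub>0"
        using Repos[OF x0 Psi2[OF x s]] by (auto simp: complex_nonpos_Reals_iff)
      have dq: "((\<lambda>s. q x (\<Psi> x s)) has_field_derivative x * sin (\<Psi> x s) * (N x * q x (\<Psi> x s)) / (2 * q x (\<Psi> x s))) (at s)"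
        unfolding q_def
        by (rule derivative_eq_intros dPsi[OF x s, unfolded q_def] refl np)+ (simp add: field_simps)
      have "((\<lambda>s. - sin (\<Psi> x s) * (N x * q x (\<Psi> x s))) has_field_derivative
          - (cos (\<Psi> x s) * (N x * q x (\<Psi> x s))) * (N x * q x (\<Psi> x s)) +
          (N x * (x * sin (\<Psi> x s) * (N x * q x (\<Psi> x s)) / (2 * q x (\<Psi> x s)))) * - sin (\<Psi> x s)) (at s)"
        by (rule derivative_eq_intros dPsi[OF x s] dq refl)+ simp
      moreover have "- (cos (\<Psi> x s) * (N x * q x (\<Psi> x s))) * (N x * q x (\<Psi> x s)) +
          (N x * (x * sin (\<Psi> x s) * (N x * q x (\<Psi> x s)) / (2 * q x (\<Psi> x s)))) * - sin (\<Psi> x s)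
          = (N x)\<^sup>2 * (- cos (\<Psi> x s) * q x (\<Psi> x s) ^ 2 - x / 2 * sin (\<Psi> x s) ^ 2)"
        using q0[OF x0 Psi2[OF x s]] by (simp add: field_simps power2_eq_square)
      moreover have "\<dots> = (N x)\<^sup>2 * (- C x s - x / 2 + 3 / 2 * x * (C x s)\<^sup>2)"
        unfolding q2 sin_squared_eq C_def by (simp add: field_simps power2_eq_square)
      ultimately show ?thesis unfolding C'_def by (simp only:)
    qed
    show "C x (s + of_real (2 * pi)) = C x s" if x: "x \<in> ball 0 r2" and s: "s \<in> strip 1" for x s
    proof -
      have "ch x (s + of_real (2 * pi)) = ch x s"
      proof (rule chi_eq[OF x strip_plus_of_real[OF s] chi(1)[OF x s]])
        have "D x (s + ch x s + of_real (2*pi)) = D x (s + ch x s)"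
          by (rule Dper) (use x r2 Psi2[OF x s] in \<open>auto simp: \<Psi>_def\<close>)
        then show "- D x (s + of_real (2 * pi) + ch x s) = ch x s"
          using chi(2)[OF x s] by (simp add: algebra_simps)
      qed
      then have "\<Psi> x (s + of_real (2 * pi)) = \<Psi> x s + of_real (2 * pi)"
        by (simp add: \<Psi>_def)
      then show ?thesis
        unfolding C_def by (simp only: cos_add cos_of_real sin_of_real cos_two_pi sin_two_pi) simp
    qed
    show "C 0 s = cos s" if s: "s \<in> strip 1" for s
    proof -
      have "ch 0 s = 0" by (rule chi_eq) (use s r2 D0 strip_mono[of 1 3] in auto)
      then show ?thesis by (simp add: C_def \<Psi>_def)
    qed
    show "C x s \<in> \<real>" if "x \<in> ball 0 r2" "x \<in> \<real>" "s \<in> \<real>" for x s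
      using chi_real[OF that] that(3) by (auto simp: C_def \<Psi>_def cos_of_real elim!: Reals_cases simp flip: of_real_add)
    show "N x \<in> \<real>" if "x \<in> ball 0 r2" "x \<in> \<real>" for x by (rule NR[OF that])
  qed
qed

section \<open>Closing the curve\<close>

lemma csqrt_Reals: "z \<in> \<real> \<Longrightarrow> Re z > 0 \<Longrightarrow> csqrt z \<in> \<real>"
  by (auto elim!: Reals_cases simp: csqrt_of_real_nonneg)

lemma Re_gt_half: "norm (z - 1/2) < 1/4 \<Longrightarrow> norm w < 1/8 \<Longrightarrow> Re (z - w) > 0" for z w :: complex
  using abs_Re_le_cmod[of "z - 1/2"] abs_Re_le_cmod[of w] by simp

text \<open>
  The two ways of writing the cubic: on the left by its roots \<open>a (1 - M)\<close>, \<open>- a (1 + M)\<close>, \<open>q - a M\<close>, on the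
  right by the parameters of the screw motion.  Cubics with the same two leading coefficients agree once they
  agree at \<open>1\<close> and \<open>-1\<close>, where the right one is \<open>- (g + v)^2\<close> and \<open>- (g - v)^2\<close>; this is why \<open>E1\<close> and \<open>E2\<close>,
  the negated values of the left one there, determine \<open>g\<close> and \<open>v\<close>.
\<close>
lemma profile_energy_identity:
  fixes w q a M g v E1 E2 al p C x N2 :: complex
  assumes "2 * w * q = K2 * N2" "a = x * q"
    and "g\<^sup>2 + v\<^sup>2 = (E1 + E2) / 2" "4 * g * v = E1 - E2"
    and "E1 = 2 * w * (q - a * M - 1) * (1 - a * (1 - M)) * (1 + a * (1 + M))"
    and "E2 = 2 * w * (q - a * M + 1) * (1 + a * (1 - M)) * (1 - a * (1 + M))"
    and "2 * w * al = 2 * w * (q - 3 * a * M) - v\<^sup>2" and p: "p = a * (C - M)"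
  shows "K2 * N2 * a\<^sup>2 * ((1 - C\<^sup>2) * (1 - x * C)) = 2 * w * (al - p) * (1 - p\<^sup>2) - (g + v * p)\<^sup>2"
proof -
  have "2 * w * (al - p) * (1 - p\<^sup>2) - (g + v * p)\<^sup>2 =
     2 * w * al * (1 - p\<^sup>2) - 2 * w * p * (1 - p\<^sup>2) - (g\<^sup>2 + v\<^sup>2) + v\<^sup>2 * (1 - p\<^sup>2) - (4 * g * v) * p / 2"
    by (simp add: power2_eq_square field_simps)
  also have "\<dots> = 2 * w * (q - 3 * a * M) * (1 - p\<^sup>2) - 2 * w * p * (1 - p\<^sup>2) - (E1 + E2) / 2 - (E1 - E2) * p / 2"
    unfolding assms(3,4,7) by (simp add: algebra_simps)
  also have "\<dots> = 2 * w * a\<^sup>2 * (1 - C\<^sup>2) * (q - a * C)"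
    unfolding assms(5,6) p by (simp add: power2_eq_square field_simps)
  also have "\<dots> = (2 * w * q) * a\<^sup>2 * (1 - C\<^sup>2) * (1 - x * C)"
    unfolding assms(2) by (simp add: power2_eq_square algebra_simps)
  finally show ?thesis unfolding assms(1) by (simp add: algebra_simps)
qed

text \<open>
  The derivative of the energy identity.  It has to be proved separately because dividing
  by \<open>p'\<close> is impossible at the turning points.
\<close>
lemma profile_acceleration_identity:
  fixes w q a M g v E1 E2 al p C x N2 :: complex
  assumes "2 * w * q = K2 * N2" "a = x * q"
    and "4 * g * v = E1 - E2"
    and "E1 = 2 * w * (q - a * M - 1) * (1 - a * (1 - M)) * (1 + a * (1 + M))"
    and "E2 = 2 * w * (q - a * M + 1) * (1 + a * (1 - M)) * (1 - a * (1 + M))"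
    and "2 * w * al = 2 * w * (q - 3 * a * M) - v\<^sup>2" and p: "p = a * (C - M)"
  shows "K2 * (a * (N2 * (- C - x / 2 + 3 / 2 * x * C\<^sup>2))) = - w * (1 - p\<^sup>2) - 2 * w * p * (al - p) - v * (g + v * p)"
proof -
  have "- w * (1 - p\<^sup>2) - 2 * w * p * (al - p) - v * (g + v * p) =
     - w + 3 * w * p\<^sup>2 - (2 * w * al) * p - v\<^sup>2 * p - (4 * g * v) / 4"
    by (simp add: power2_eq_square field_simps)
  also have "\<dots> = - w + 3 * w * p\<^sup>2 - 2 * w * (q - 3 * a * M) * p - (E1 - E2) / 4"
    unfolding assms(3,6) by (simp add: algebra_simps)
  also have "\<dots> = 2 * w * a * (- q * C - a / 2 + 3 / 2 * a * C\<^sup>2)"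
    unfolding assms(4,5) p by (simp add: power2_eq_square field_simps)
  also have "\<dots> = (2 * w * q) * a * (- C - x / 2 + 3 / 2 * x * C\<^sup>2)"
    unfolding assms(2) by (simp add: power2_eq_square algebra_simps)
  also have "\<dots> = K2 * (a * (N2 * (- C - x / 2 + 3 / 2 * x * C\<^sup>2)))"
    unfolding assms(1) by (simp only: mult.assoc mult.left_commute)
  finally show ?thesis by (rule sym)
qed

text \<open>
  Three exact relations hold between the parameters: the linear and the constant coefficient of the cubic, and the
  closing condition \<open>E4\<close> for the angle.  Each of them says that a quantity vanishing for the
  circle is a multiple of \<open>a^2\<close>, and the defect \<open>1 - v\<close> is obtained by eliminating the other unknowns.
\<close>
lemma velocity_defect_identity:
  fixes w q a M g v E1 E2 al x b mu :: complex
  assumes "a = x * q"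
    and "g\<^sup>2 + v\<^sup>2 = (E1 + E2) / 2" "4 * g * v = E1 - E2"
    and "E1 = 2 * w * (q - a * M - 1) * (1 - a * (1 - M)) * (1 + a * (1 + M))"
    and "E2 = 2 * w * (q - a * M + 1) * (1 + a * (1 - M)) * (1 - a * (1 + M))"
    and "2 * w * al = 2 * w * (q - 3 * a * M) - v\<^sup>2"
    and E4: "g + 2 * al = - b * a\<^sup>2 * Q" and M: "M = x * mu"
    and B: "B4 = b * Q" "B3 = 2 * w * (1 - M\<^sup>2) * (q - a * M)" "B1 = 1 - 3 * M\<^sup>2 + 2 * mu"
  shows "g\<^sup>2 * (1 - v) = - a\<^sup>2 * (w * B4 + B3 + g * w * B1)"
proof -
  have "4 * (w + g * v) = 4 * w + (4 * g * v)" by (simp add: algebra_simps)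
  also have "\<dots> = 4 * (w * (a\<^sup>2 * (1 - 3 * M\<^sup>2) + 2 * (a * q * M)))"
    unfolding assms(3-5) by (simp add: power2_eq_square algebra_simps)
  also have "a * q * M = a\<^sup>2 * mu" unfolding M assms(1) by (simp add: power2_eq_square algebra_simps)
  also have "4 * (w * (a\<^sup>2 * (1 - 3 * M\<^sup>2) + 2 * (a\<^sup>2 * mu))) = 4 * (w * a\<^sup>2 * B1)"
    unfolding B by (simp add: algebra_simps)
  finally have "4 * (w + g * v) = 4 * (w * a\<^sup>2 * B1)" .
  then have e1: "w + g * v = w * a\<^sup>2 * B1" by (simp only: mult_cancel_left) simp
  have "2 * w * al - g\<^sup>2 = 2 * w * (q - 3 * a * M) - (g\<^sup>2 + v\<^sup>2)" unfolding assms(6) by (simp add: algebra_simps)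
  also have "\<dots> = a\<^sup>2 * B3" unfolding assms(2,4,5) B by (simp add: power2_eq_square field_simps)
  finally have e3: "2 * w * al - g\<^sup>2 = a\<^sup>2 * B3" .
  have e4: "2 * al = - g - a\<^sup>2 * B4" 
  proof -
    have "2 * al = (g + 2 * al) - g" by simp
    also have "\<dots> = - b * a\<^sup>2 * Q - g" unfolding E4 ..
    also have "\<dots> = - g - a\<^sup>2 * B4" unfolding B by (simp add: algebra_simps)
    finally show ?thesis .
  qed
  show ?thesis using e1 e3 e4 by algebra
qed

text \<open>
  The data of the family for \<open>R = 1\<close> in the angle variable of the \<open>k\<close>-fold symmetry, in which the period is
  \<open>2 \<pi>\<close>.  The letters \<open>om, v, g, al\<close> stand for the angular velocity, the axial velocity, the phase velocity \<open>c\<close>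
  and the constant \<open>A\<close>.  The unknown \<open>1 + u\<close> parametrises \<open>om = (1 + u) sqrt (k^2 - (1 + u)^2)\<close>; this choice
  makes the velocity \<open>v\<close> at modulus \<open>x = 0\<close> equal to \<open>1 + u\<close>, so that the angle condition
  at \<open>x = 0\<close> is linear and the fixed point map vanishes there.
\<close>
lemma screw_data_exists:
  fixes k :: nat
  assumes k: "k \<ge> 2"
  obtains d :: real and om v g al :: "complex \<Rightarrow> complex" and p p' :: "complex \<Rightarrow> complex \<Rightarrow> complex" where
    "d > 0" "om holomorphic_on ball 0 d" "v holomorphic_on ball 0 d" "g holomorphic_on ball 0 d" "al holomorphic_on ball 0 d"
    "holo2 (ball 0 d) (strip 1) p"
    "\<And>x s. x \<in> ball 0 d \<Longrightarrow> s \<in> strip 1 \<Longrightarrow> (p x has_field_derivative p' x s) (at s)"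
    "\<And>x s. x \<in> ball 0 d \<Longrightarrow> s \<in> strip 1 \<Longrightarrow> (p' x has_field_derivative
       (- om x * (1 - (p x s)\<^sup>2) - 2 * om x * p x s * (al x - p x s) - v x * (g x + v x * p x s)) / (of_nat k)\<^sup>2) (at s)"
    "\<And>x s. x \<in> ball 0 d \<Longrightarrow> s \<in> strip 1 \<Longrightarrow>
       (of_nat k)\<^sup>2 * (p' x s)\<^sup>2 = 2 * om x * (al x - p x s) * (1 - (p x s)\<^sup>2) - (g x + v x * p x s)\<^sup>2"
    "\<And>x s. x \<in> ball 0 d \<Longrightarrow> s \<in> strip 1 \<Longrightarrow> p x (s + of_real (2 * pi)) = p x s"
    "\<And>x. x \<in> ball 0 d \<Longrightarrow> prim (p x) (of_real (2 * pi)) = 0"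
    "\<And>x. x \<in> ball 0 d \<Longrightarrow> prim (\<lambda>s. (g x + v x * p x s) / (al x - p x s)) (of_real (2 * pi)) = - of_real (4 * pi)"
    "\<And>x s. x \<in> ball 0 d \<Longrightarrow> s \<in> strip 1 \<Longrightarrow> Re ((al x - p x s) / om x) > 0"
    "\<And>x. x \<in> ball 0 d \<Longrightarrow> Re (om x) > 0"
    "\<And>x. x \<in> ball 0 d \<Longrightarrow> x \<in> \<real> \<Longrightarrow> om x \<in> \<real> \<and> v x \<in> \<real> \<and> g x \<in> \<real> \<and> al x \<in> \<real>"
    "\<And>x s. x \<in> ball 0 d \<Longrightarrow> x \<in> \<real> \<Longrightarrow> s \<in> \<real> \<Longrightarrow> p x s \<in> \<real>"
    "om 0 = of_real (sqrt (real k ^ 2 - 1))" "v 0 = 1" "g 0 = - om 0" "al 0 = om 0 / 2" "\<And>s. p 0 s = 0"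
    "((\<lambda>x. (1 - v x) / x\<^sup>2) \<longlongrightarrow> of_real ((real k ^ 2 / (2 * sqrt (real k ^ 2 - 1)))\<^sup>2 / 2)) (at 0)"
proof -
  obtain r :: real and C C' :: "complex \<Rightarrow> complex \<Rightarrow> complex" and N :: "complex \<Rightarrow> complex" where
    r: "r > 0" and Ch: "holo2 (ball 0 r) (strip 1) C" and Nh: "N holomorphic_on ball 0 r"
    and Nnz: "\<And>x. x \<in> ball 0 r \<Longrightarrow> N x \<noteq> 0" and N0: "N 0 = 1"
    and Cb: "\<And>x s. x \<in> ball 0 r \<Longrightarrow> s \<in> strip 1 \<Longrightarrow> norm (C x s) \<le> 27"
    and dC: "\<And>x s. x \<in> ball 0 r \<Longrightarrow> s \<in> strip 1 \<Longrightarrow> (C x has_field_derivative C' x s) (at s)"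
    and dC': "\<And>x s. x \<in> ball 0 r \<Longrightarrow> s \<in> strip 1 \<Longrightarrow>
       (C' x has_field_derivative (N x)\<^sup>2 * (- C x s - x / 2 + 3 / 2 * x * (C x s)\<^sup>2)) (at s)"
    and C'2: "\<And>x s. x \<in> ball 0 r \<Longrightarrow> s \<in> strip 1 \<Longrightarrow> (C' x s)\<^sup>2 = (N x)\<^sup>2 * (1 - (C x s)\<^sup>2) * (1 - x * C x s)"
    and Cper: "\<And>x s. x \<in> ball 0 r \<Longrightarrow> s \<in> strip 1 \<Longrightarrow> C x (s + of_real (2 * pi)) = C x s"
    and C0: "\<And>s. s \<in> strip 1 \<Longrightarrow> C 0 s = cos s"
    and CR: "\<And>x s. x \<in> ball 0 r \<Longrightarrow> x \<in> \<real> \<Longrightarrow> s \<in> \<real> \<Longrightarrow> C x s \<in> \<real>"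
    and NR: "\<And>x. x \<in> ball 0 r \<Longrightarrow> x \<in> \<real> \<Longrightarrow> N x \<in> \<real>"
    by (rule pendulum_profile_exists, rule that)
  have S1: "open (strip 1)" "convex (strip 1)" "0 \<in> strip 1"
    by (simp_all add: open_strip convex_strip zero_in_strip)
  define L :: complex where "L = of_real (2 * pi)"
  have L: "L \<noteq> 0" "L \<in> strip 1" "L \<in> \<real>" by (auto simp: L_def strip_def)
  have RS: "\<real> \<subseteq> strip 1" by (auto simp: strip_def complex_is_Real_iff)
  define M where "M = (\<lambda>x. prim (C x) L / L)"
  define m2 where "m2 = (\<lambda>x. prim (\<lambda>s. (C x s)\<^sup>2) L / L)"
  have Mh: "M holomorphic_on ball 0 r"
    unfolding M_def using holo2D(3)[OF holo2_prim[OF Ch open_ball S1] L(2)] L(1) by (intro holomorphic_intros) auto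
  have m2h: "m2 holomorphic_on ball 0 r"
    unfolding m2_def using holo2D(3)[OF holo2_prim[OF holo2_power[OF Ch] open_ball S1] L(2)] L(1) by (intro holomorphic_intros) auto
  have x0: "0 \<in> ball (0::complex) r" using r by simp
  have M0: "M 0 = 0"
  proof -
    have "prim (C 0) L = sin L - sin 0"
      by (rule prim_eqI[OF S1 holo2D(2)[OF Ch x0] L(2)]) (auto intro!: derivative_eq_intros simp: C0)
    then show ?thesis by (simp add: M_def L_def sin_of_real)
  qed
  have m20: "m2 0 = 1/2"
  proof -
    have "prim (\<lambda>s. (C 0 s)\<^sup>2) L = (\<lambda>s. s/2 + sin s * cos s / 2) L - (\<lambda>s. s/2 + sin s * cos s / 2) 0"
    proof (rule prim_eqI[OF S1 holo2D(2)[OF holo2_power[OF Ch] x0] L(2)])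
      fix z :: complex assume z: "z \<in> strip 1"
      have "((\<lambda>s. s/2 + sin s * cos s / 2) has_field_derivative 1/2 + (cos z * cos z - sin z * sin z)/2) (at z)"
        by (rule derivative_eq_intros refl | simp)+
      moreover have "1/2 + (cos z * cos z - sin z * sin z)/2 = (C 0 z)\<^sup>2"
        using sin_cos_squared_add[of z] unfolding C0[OF z] by (simp add: power2_eq_square field_simps)
      ultimately show "((\<lambda>s. s/2 + sin s * cos s / 2) has_field_derivative (C 0 z)\<^sup>2) (at z)" by simp
    qed
    then show ?thesis using L(1) by (simp add: m2_def L_def sin_of_real)
  qed
  \<comment> \<open>The second derivative of \<open>C\<close> has mean zero, which relates the means of \<open>C\<close> and of its square.\<close>
  have Meq: "M x = x * (3/2 * m2 x - 1/2)" if x: "x \<in> ball 0 r" for x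
  proof -
    let ?c = "\<lambda>s. (N x)\<^sup>2 * (- C x s - x / 2 + 3 / 2 * x * (C x s)\<^sup>2)"
    have hol: "?c holomorphic_on strip 1" using holo2D(2)[OF Ch x] by (intro holomorphic_intros) auto
    have C'per: "C' x L = C' x 0"
    proof -
      have "((\<lambda>s. C x (s + L)) has_field_derivative C' x (0 + L)) (at 0)"
      proof -
        have "(C x has_field_derivative C' x (0 + L)) (at (0 + L))" using dC[OF x, of "0 + L"] L by simp
        then show ?thesis by (simp only: DERIV_shift)
      qed
      moreover have "((\<lambda>s. C x (s + L)) has_field_derivative C' x 0) (at 0)"
        by (rule has_field_derivative_transform_within_open[OF dC[OF x S1(3)] S1(1,3)])
           (use Cper[OF x] in \<open>auto simp: L_def\<close>)
      ultimately show ?thesis using DERIV_unique by fastforce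
    qed
    have "prim ?c L = C' x L - C' x 0"
      by (rule prim_eqI[OF S1 hol L(2) dC'[OF x]])
    moreover have "prim ?c L = (\<lambda>s. (N x)\<^sup>2 * (- prim (C x) s - x / 2 * s + 3 / 2 * x * prim (\<lambda>s. (C x s)\<^sup>2) s)) L
        - (\<lambda>s. (N x)\<^sup>2 * (- prim (C x) s - x / 2 * s + 3 / 2 * x * prim (\<lambda>s. (C x s)\<^sup>2) s)) 0"
    proof (rule prim_eqI[OF S1 hol L(2)])
      fix z assume z: "z \<in> strip 1"
      have d1: "(prim (C x) has_field_derivative C x z) (at z)"
        by (rule has_field_derivative_prim[OF S1 holo2D(2)[OF Ch x] z])
      have d2: "(prim (\<lambda>s. (C x s)\<^sup>2) has_field_derivative (C x z)\<^sup>2) (at z)"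
        by (rule has_field_derivative_prim[OF S1 holo2D(2)[OF holo2_power[OF Ch] x] z])
      show "((\<lambda>s. (N x)\<^sup>2 * (- prim (C x) s - x / 2 * s + 3 / 2 * x * prim (\<lambda>s. (C x s)\<^sup>2) s)) has_field_derivative
         (N x)\<^sup>2 * (- C x z - x / 2 + 3 / 2 * x * (C x z)\<^sup>2)) (at z)"
        by (rule derivative_eq_intros d1 d2 refl | simp)+
    qed
    ultimately have "(N x)\<^sup>2 * (- prim (C x) L - x / 2 * L + 3 / 2 * x * prim (\<lambda>s. (C x s)\<^sup>2) L) = 0"
      using C'per by simp
    then have "- prim (C x) L - x / 2 * L + 3 / 2 * x * prim (\<lambda>s. (C x s)\<^sup>2) L = 0"
      using Nnz[OF x] by simp
    then have e: "prim (C x) L = x * (3 / 2 * prim (\<lambda>s. (C x s)\<^sup>2) L - 1 / 2 * L)"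
      by (simp add: algebra_simps)
    show ?thesis using L(1) unfolding M_def m2_def e by (simp add: field_simps)
  qed
  define K :: complex where "K = of_nat k"
  define w0 where "w0 = sqrt (real k ^ 2 - 1)"
  have w0: "w0 > 1" "w0\<^sup>2 = real k ^ 2 - 1"
  proof -
    have "real k ^ 2 \<ge> 2 ^ 2" by (rule power_mono) (use k in auto)
    then show "w0\<^sup>2 = real k ^ 2 - 1" "w0 > 1" by (auto simp: w0_def real_less_rsqrt)
  qed
  have K0: "K \<noteq> 0" using k by (simp add: K_def)
  have Kw: "K\<^sup>2 = (of_real w0)\<^sup>2 + 1"
  proof -
    have "K = of_real (real k)" by (simp add: K_def)
    then have "K\<^sup>2 = of_real (real k ^ 2)" by simp
    also have "\<dots> = of_real (w0\<^sup>2 + 1)" using w0(2) by simp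
    finally show ?thesis by simp
  qed
  define ta where "ta = (\<lambda>u. csqrt (K\<^sup>2 - (1 + u)\<^sup>2))"
  define om where "om = (\<lambda>u. (1 + u) * ta u)"
  define q where "q = (\<lambda>x u. K\<^sup>2 * (N x)\<^sup>2 / (2 * om u))"
  define a where "a = (\<lambda>x u. x * q x u)"
  define E1 where "E1 = (\<lambda>x u. 2 * om u * (q x u - a x u * M x - 1) * (1 - a x u * (1 - M x)) * (1 + a x u * (1 + M x)))"
  define E2 where "E2 = (\<lambda>x u. 2 * om u * (q x u - a x u * M x + 1) * (1 + a x u * (1 - M x)) * (1 - a x u * (1 + M x)))"
  define v where "v = (\<lambda>x u. (csqrt (E2 x u) - csqrt (E1 x u)) / 2)"
  define g where "g = (\<lambda>x u. - (csqrt (E2 x u) + csqrt (E1 x u)) / 2)"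
  define al where "al = (\<lambda>x u. q x u - 3 * a x u * M x - (v x u)\<^sup>2 / (2 * om u))"
  have cs0: "isCont csqrt (of_real t)" if "t > 0" for t
    by (rule continuous_at_csqrt) (use that in \<open>simp add: complex_nonpos_Reals_iff\<close>)
  have csq: "csqrt ((of_real t)\<^sup>2) = of_real t" if "t > 0" for t
    by (rule csqrt_square) (use that in simp)
  have csc: "isCont csqrt ((of_real t)\<^sup>2)" if "t > 0" for t
    using cs0[of "t\<^sup>2"] that by (simp only: of_real_power zero_less_power)
  define F where "F = (nhds (0::complex) \<times>\<^sub>F nhds (0::complex))"
  have tf: "(fst \<longlongrightarrow> 0) F" "(snd \<longlongrightarrow> 0) F" by (simp_all add: F_def filterlim_fst filterlim_snd)
  have isC: "(f \<longlongrightarrow> f 0) (nhds 0)" if "f holomorphic_on ball 0 r" for f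
  proof -
    have "isCont f 0" using holomorphic_on_imp_continuous_on[OF that] x0
      by (simp add: continuous_on_eq_continuous_at)
    then show ?thesis using tendsto_at_iff_tendsto_nhds isCont_def by blast
  qed
  have tN: "((\<lambda>z. N (fst z)) \<longlongrightarrow> 1) F" using filterlim_compose[OF isC[OF Nh] tf(1)] N0 by simp
  have tM: "((\<lambda>z. M (fst z)) \<longlongrightarrow> 0) F" using filterlim_compose[OF isC[OF Mh] tf(1)] M0 by simp
  have tta0: "((\<lambda>z. K\<^sup>2 - (1 + snd z)\<^sup>2) \<longlongrightarrow> (of_real w0)\<^sup>2) F"
    by (rule tendsto_eq_intros tf refl | simp add: Kw)+
  have tta: "((\<lambda>z. ta (snd z)) \<longlongrightarrow> of_real w0) F"
    unfolding ta_def
    using isCont_tendsto_compose[OF csc[of w0] tta0] csq[of w0] w0 by simp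
  have tom: "((\<lambda>z. om (snd z)) \<longlongrightarrow> of_real w0) F"
    unfolding om_def by (rule tendsto_eq_intros tf tta refl | simp)+
  define q0 where "q0 = K\<^sup>2 / (2 * of_real w0)"
  have q0w: "2 * of_real w0 * q0 = (of_real w0)\<^sup>2 + 1"
    using w0 by (simp add: q0_def Kw)
  have tq: "((\<lambda>z. q (fst z) (snd z)) \<longlongrightarrow> q0) F"
    unfolding q_def q0_def by (rule tendsto_eq_intros tN tom refl | use w0 in simp)+
  have ta: "((\<lambda>z. a (fst z) (snd z)) \<longlongrightarrow> 0) F"
    unfolding a_def by (rule tendsto_eq_intros tf tq refl | simp)+
  have tE1: "((\<lambda>z. E1 (fst z) (snd z)) \<longlongrightarrow> (of_real (w0 - 1))\<^sup>2) F"
  proof -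
    have "((\<lambda>z. E1 (fst z) (snd z)) \<longlongrightarrow> 2 * of_real w0 * (q0 - 0 * 0 - 1) * (1 - 0 * (1 - 0)) * (1 + 0 * (1 + 0))) F"
      unfolding E1_def by (intro tendsto_intros tf tq ta tom tM)
    moreover have "2 * of_real w0 * (q0 - 0 * 0 - 1) * (1 - 0 * (1 - 0)) * (1 + 0 * (1 + 0)) = (of_real (w0 - 1))\<^sup>2"
      using q0w by (simp add: algebra_simps power2_eq_square)
    ultimately show ?thesis by (simp only:)
  qed
  have tE2: "((\<lambda>z. E2 (fst z) (snd z)) \<longlongrightarrow> (of_real (w0 + 1))\<^sup>2) F"
  proof -
    have "((\<lambda>z. E2 (fst z) (snd z)) \<longlongrightarrow> 2 * of_real w0 * (q0 - 0 * 0 + 1) * (1 + 0 * (1 - 0)) * (1 - 0 * (1 + 0))) F"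
      unfolding E2_def by (intro tendsto_intros tf tq ta tom tM)
    moreover have "2 * of_real w0 * (q0 - 0 * 0 + 1) * (1 + 0 * (1 - 0)) * (1 - 0 * (1 + 0)) = (of_real (w0 + 1))\<^sup>2"
      using q0w by (simp add: algebra_simps power2_eq_square)
    ultimately show ?thesis by (simp only:)
  qed
  have te1: "((\<lambda>z. csqrt (E1 (fst z) (snd z))) \<longlongrightarrow> of_real (w0 - 1)) F"
    using isCont_tendsto_compose[OF csc[of "w0 - 1"] tE1] csq[of "w0 - 1"] w0 by simp
  have te2: "((\<lambda>z. csqrt (E2 (fst z) (snd z))) \<longlongrightarrow> of_real (w0 + 1)) F"
    using isCont_tendsto_compose[OF csc[of "w0 + 1"] tE2] csq[of "w0 + 1"] w0 by simp
  have tv: "((\<lambda>z. v (fst z) (snd z)) \<longlongrightarrow> 1) F"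
    unfolding v_def by (rule tendsto_eq_intros te1 te2 refl | simp)+
  have tal: "((\<lambda>z. al (fst z) (snd z)) \<longlongrightarrow> of_real w0 / 2) F"
  proof -
    have "((\<lambda>z. al (fst z) (snd z)) \<longlongrightarrow> q0 - 3 * 0 * 0 - 1\<^sup>2 / (2 * of_real w0)) F"
      unfolding al_def by (intro tendsto_intros tv tq ta tom tM) (use w0(1) in auto)
    moreover have "q0 - 3 * 0 * 0 - 1\<^sup>2 / (2 * of_real w0) = of_real w0 / 2"
      using w0(1) unfolding q0_def Kw by (simp add: field_simps power2_eq_square)
    ultimately show ?thesis by (simp only:)
  qed
  have trat: "((\<lambda>z. al (fst z) (snd z) / om (snd z)) \<longlongrightarrow> 1/2) F"
    by (rule tendsto_eq_intros tal tom refl)+ (use w0 in auto)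
  have tb: "((\<lambda>z. norm (a (fst z) (snd z) / om (snd z)) * (27 + norm (M (fst z)))) \<longlongrightarrow> 0) F"
  proof -
    have "((\<lambda>z. norm (a (fst z) (snd z) / om (snd z)) * (27 + norm (M (fst z)))) \<longlongrightarrow> norm (0 / complex_of_real w0) * (27 + norm (0::complex))) F"
      by (intro tendsto_intros tom ta tM) (use w0(1) in auto)
    then show ?thesis by simp
  qed
  have Repos: "eventually (\<lambda>z. Re (f z) > 0) F" if "(f \<longlongrightarrow> of_real t) F" "t > 0" for f t
    using order_tendstoD(1)[OF tendsto_Re[OF that(1)], of 0] that(2) by simp
  have Repos2: "eventually (\<lambda>z. Re (f z) > 0) F" if "(f \<longlongrightarrow> (of_real t)\<^sup>2) F" "t > 0" for f t
  proof (rule Repos)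
    show "(f \<longlongrightarrow> of_real (t\<^sup>2)) F" using that(1) by (simp only: of_real_power)
    show "t\<^sup>2 > 0" using that(2) by simp
  qed
  have ev: "eventually (\<lambda>z. norm (fst z) < r \<and> Re (K\<^sup>2 - (1 + snd z)\<^sup>2) > 0 \<and> Re (ta (snd z)) > 0 \<and> Re (om (snd z)) > 0 \<and> Re (1 + snd z) > 0
      \<and> Re (E1 (fst z) (snd z)) > 0 \<and> Re (E2 (fst z) (snd z)) > 0 \<and> Re (ta (snd z) - (1 + snd z)) > 0
      \<and> norm (al (fst z) (snd z) / om (snd z) - 1/2) < 1/4
      \<and> norm (a (fst z) (snd z) / om (snd z)) * (27 + norm (M (fst z))) < 1/8) F"
  proof (intro eventually_conj)
    show "eventually (\<lambda>z. norm (fst z) < r) F"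
      using order_tendstoD(2)[OF tendsto_norm[OF tf(1)], of r] r by simp
    show "eventually (\<lambda>z. Re (K\<^sup>2 - (1 + snd z)\<^sup>2) > 0) F" by (rule Repos2[OF tta0]) (use w0(1) in simp)
    show "eventually (\<lambda>z. Re (ta (snd z)) > 0) F" by (rule Repos[OF tta]) (use w0 in auto)
    show "eventually (\<lambda>z. Re (om (snd z)) > 0) F" by (rule Repos[OF tom]) (use w0 in auto)
    show "eventually (\<lambda>z. Re (1 + snd z) > 0) F"
    proof (rule Repos)
      have "((\<lambda>z. 1 + snd z) \<longlongrightarrow> 1 + 0) F" by (intro tendsto_intros tf)
      then show "((\<lambda>z. 1 + snd z) \<longlongrightarrow> of_real 1) F" by simp
    qed simp
    show "eventually (\<lambda>z. Re (E1 (fst z) (snd z)) > 0) F" by (rule Repos2[OF tE1]) (use w0(1) in simp)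
    show "eventually (\<lambda>z. Re (E2 (fst z) (snd z)) > 0) F" by (rule Repos2[OF tE2]) (use w0(1) in simp)
    show "eventually (\<lambda>z. Re (ta (snd z) - (1 + snd z)) > 0) F"
    proof (rule Repos)
      have "((\<lambda>z. ta (snd z) - (1 + snd z)) \<longlongrightarrow> of_real w0 - (1 + 0)) F" by (intro tendsto_intros tf tta)
      then show "((\<lambda>z. ta (snd z) - (1 + snd z)) \<longlongrightarrow> of_real (w0 - 1)) F" by simp
      show "w0 - 1 > 0" using w0(1) by simp
    qed
    show "eventually (\<lambda>z. norm (al (fst z) (snd z) / om (snd z) - 1/2) < 1/4) F"
      using tendstoD[OF trat, of "1/4"] by (simp add: dist_norm)
    show "eventually (\<lambda>z. norm (a (fst z) (snd z) / om (snd z)) * (27 + norm (M (fst z))) < 1/8) F"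
      using order_tendstoD(2)[OF tb, of "1/8"] by simp
  qed
  \<comment> \<open>All conditions needed to define the data are open and hold at \<open>x = u = 0\<close>.\<close>
  obtain d where d: "d > 0" and dd: "\<And>x u. norm x < d \<Longrightarrow> norm u < d \<Longrightarrow>
      norm x < r \<and> Re (K\<^sup>2 - (1 + u)\<^sup>2) > 0 \<and> Re (ta u) > 0 \<and> Re (om u) > 0 \<and> Re (1 + u) > 0
      \<and> Re (E1 x u) > 0 \<and> Re (E2 x u) > 0 \<and> Re (ta u - (1 + u)) > 0
      \<and> norm (al x u / om u - 1/2) < 1/4 \<and> norm (a x u / om u) * (27 + norm (M x)) < 1/8"
  proof -
    obtain Pf Pg where P: "eventually Pf (nhds (0::complex))" "eventually Pg (nhds (0::complex))"
      and PP: "\<And>x u. Pf x \<Longrightarrow> Pg u \<Longrightarrow> norm x < r \<and> Re (K\<^sup>2 - (1 + u)\<^sup>2) > 0 \<and> Re (ta u) > 0 \<and> Re (om u) > 0 \<and> Re (1 + u) > 0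
      \<and> Re (E1 x u) > 0 \<and> Re (E2 x u) > 0 \<and> Re (ta u - (1 + u)) > 0
      \<and> norm (al x u / om u - 1/2) < 1/4 \<and> norm (a x u / om u) * (27 + norm (M x)) < 1/8"
      using ev unfolding F_def eventually_prod_filter by auto
    obtain d1 d2 where "d1 > 0" "\<And>x. dist x 0 < d1 \<Longrightarrow> Pf x" "d2 > 0" "\<And>x. dist x 0 < d2 \<Longrightarrow> Pg x"
      using P unfolding eventually_nhds_metric by metis
    then show ?thesis by (intro that[of "min d1 d2"] PP) auto
  qed
  have norm0: "norm (0::complex) < d" using d by simp
  have dd_r: "norm x < r" if "norm x < d" for x :: complex by (rule dd[OF that norm0, THEN conjunct1])
  have dd_sq: "Re (K\<^sup>2 - (1 + u)\<^sup>2) > 0" if "norm u < d" for u by (rule dd[OF norm0 that, THEN conjunct2, THEN conjunct1])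
  have dd_ta: "Re (ta u) > 0" if "norm u < d" for u by (rule dd[OF norm0 that, THEN conjunct2, THEN conjunct2, THEN conjunct1])
  have dd_om: "Re (om u) > 0" if "norm u < d" for u by (rule dd[OF norm0 that, THEN conjunct2, THEN conjunct2, THEN conjunct2, THEN conjunct1])
  have dd_1u: "Re (1 + u) > 0" if "norm u < d" for u by (rule dd[OF norm0 that, THEN conjunct2, THEN conjunct2, THEN conjunct2, THEN conjunct2, THEN conjunct1])
  have dd_dif: "Re (ta u - (1 + u)) > 0" if "norm u < d" for u by (rule dd[OF norm0 that, THEN conjunct2, THEN conjunct2, THEN conjunct2, THEN conjunct2, THEN conjunct2, THEN conjunct2, THEN conjunct2, THEN conjunct1])
  have dd_E1: "Re (E1 x u) > 0" if "norm x < d" "norm u < d" for x u by (rule dd[OF that, THEN conjunct2, THEN conjunct2, THEN conjunct2, THEN conjunct2, THEN conjunct2, THEN conjunct1])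
  have dd_E2: "Re (E2 x u) > 0" if "norm x < d" "norm u < d" for x u by (rule dd[OF that, THEN conjunct2, THEN conjunct2, THEN conjunct2, THEN conjunct2, THEN conjunct2, THEN conjunct2, THEN conjunct1])
  have dd_al: "norm (al x u / om u - 1/2) < 1/4" if "norm x < d" "norm u < d" for x u by (rule dd[OF that, THEN conjunct2, THEN conjunct2, THEN conjunct2, THEN conjunct2, THEN conjunct2, THEN conjunct2, THEN conjunct2, THEN conjunct2, THEN conjunct1])
  have dd_a: "norm (a x u / om u) * (27 + norm (M x)) < 1/8" if "norm x < d" "norm u < d" for x u by (rule dd[OF that, THEN conjunct2, THEN conjunct2, THEN conjunct2, THEN conjunct2, THEN conjunct2, THEN conjunct2, THEN conjunct2, THEN conjunct2, THEN conjunct2])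
  have nz: "om u \<noteq> 0" if "norm u < d" for u using dd_om[OF that] by auto
  let ?D = "ball (0::complex) d"
  have dr: "?D \<subseteq> ball 0 r" using dd_r by auto
  have Nd: "N holomorphic_on ?D" and Md: "M holomorphic_on ?D"
    using Nh Mh dr by (auto intro: holomorphic_on_subset)
  have omh: "om holomorphic_on ?D"
    unfolding om_def ta_def
  proof (intro holomorphic_intros)
    fix u :: complex assume "u \<in> ?D"
    then have "Re (K\<^sup>2 - (1 + u)\<^sup>2) > 0" by (intro dd_sq) simp
    then show "K\<^sup>2 - (1 + u)\<^sup>2 \<notin> \<real>\<^sub>\<le>\<^sub>0" unfolding complex_nonpos_Reals_iff by linarith
  qed
  have omh2: "holo2 ?D ?D (\<lambda>x u. om u)" by (rule holo2_snd[OF omh])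
  have Mh2: "holo2 ?D ?D (\<lambda>x u. M x)" by (rule holo2_fst[OF Md])
  have qh: "holo2 ?D ?D q"
    unfolding q_def by (intro holo2_intros holo2_fst[OF Nd] omh2) (use nz in auto)
  have ah: "holo2 ?D ?D a"
    unfolding a_def by (intro holo2_mult qh holo2_fst) auto
  have E1h: "holo2 ?D ?D E1" unfolding E1_def by (intro holo2_intros omh2 Mh2 qh ah)
  have E2h: "holo2 ?D ?D E2" unfolding E2_def by (intro holo2_intros omh2 Mh2 qh ah)
  have e1h: "holo2 ?D ?D (\<lambda>x u. csqrt (E1 x u))" by (rule csqrt_holo2[OF E1h]) (simp add: dd_E1)
  have e2h: "holo2 ?D ?D (\<lambda>x u. csqrt (E2 x u))" by (rule csqrt_holo2[OF E2h]) (simp add: dd_E2)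
  have vh: "holo2 ?D ?D v" unfolding v_def by (intro holo2_intros e1h e2h) auto
  have gh: "holo2 ?D ?D g" unfolding g_def by (intro holo2_intros e1h e2h) auto
  have alh: "holo2 ?D ?D al" unfolding al_def by (intro holo2_intros qh ah vh Mh2 omh2) (use nz in auto)
  define P where "P = (\<lambda>x s. C x s - M x)"
  have Ph: "holo2 ?D (strip 1) P"
    unfolding P_def by (intro holo2_diff holo2_subset[OF Ch dr] holo2_fst[OF Md]) auto
  have Rrat: "Re ((al x u - a x u * P x s) / om u) > 0" if "x \<in> ?D" "u \<in> ?D" "s \<in> strip 1" for x u s
  proof -
    have "norm (P x s) \<le> 27 + norm (M x)"
      unfolding P_def using Cb[of x s] that dr norm_triangle_ineq4[of "C x s" "M x"] by force
    then have "norm (a x u / om u * P x s) \<le> norm (a x u / om u) * (27 + norm (M x))"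
      unfolding norm_mult by (rule mult_left_mono) simp
    then have "norm (a x u / om u * P x s) < 1/8" using dd_a[of x u] that by auto
    then have "Re (al x u / om u - a x u / om u * P x s) > 0" using Re_gt_half[OF dd_al[of x u]] that by auto
    moreover have "al x u / om u - a x u / om u * P x s = (al x u - a x u * P x s) / om u"
      by (simp add: diff_divide_distrib)
    ultimately show ?thesis by (simp only:)
  qed
  have den: "al x u - a x u * P x s \<noteq> 0" if "x \<in> ?D" "u \<in> ?D" "s \<in> strip 1" for x u s
    using Rrat[OF that] by auto
  define h where "h = (\<lambda>x u s. (g x u + v x u * (a x u * P x s)) / (al x u - a x u * P x s))"
  define T where "T = (\<lambda>x u. u + 1 + prim (h x u) L / L / 2)"
  have h1: "holo2 ?D (strip 1) (\<lambda>x. h x u)" if u: "u \<in> ?D" for u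
    unfolding h_def
    by (intro holo2_intros Ph holo2_fst[OF holo2D(3)[OF gh u]] holo2_fst[OF holo2D(3)[OF vh u]]
       holo2_fst[OF holo2D(3)[OF ah u]] holo2_fst[OF holo2D(3)[OF alh u]] den u)
  have h2: "holo2 ?D (strip 1) (\<lambda>u. h x u)" if x: "x \<in> ?D" for x
    unfolding h_def
    by (intro holo2_intros holo2_snd[OF holo2D(2)[OF Ph x]] holo2_fst[OF holo2D(2)[OF gh x]] holo2_fst[OF holo2D(2)[OF vh x]]
       holo2_fst[OF holo2D(2)[OF ah x]] holo2_fst[OF holo2D(2)[OF alh x]] den x)
  have Tcont: "continuous_on (?D \<times> ?D) (\<lambda>z. T (fst z) (snd z))"
  proof -
    let ?X = "(?D \<times> ?D) \<times> cbox (0::real) 1"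
    have cf: "continuous_on ?X (\<lambda>w. f (fst (fst w)) (snd (fst w)))" if "holo2 ?D ?D f" for f
      by (rule continuous_on_compose2[OF holo2D(1)[OF that] continuous_on_fst[OF continuous_on_id]]) auto
    have Ls: "of_real t * L \<in> strip 1" for t by (simp add: L_def strip_def)
    have cP: "continuous_on ((?D \<times> ?D) \<times> cbox (0::real) 1) (\<lambda>w. P (fst (fst w)) (of_real (snd w) * L))"
    proof -
      have "continuous_on ((?D \<times> ?D) \<times> cbox (0::real) 1) (\<lambda>w. (\<lambda>z. P (fst z) (snd z)) (fst (fst w), of_real (snd w) * L))"
      proof (rule continuous_on_compose2[OF holo2D(1)[OF Ph]])
        show "continuous_on ?X (\<lambda>w. (fst (fst w), of_real (snd w) * L))" by (intro continuous_intros)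
      qed (use Ls in force)
      then show ?thesis by simp
    qed
    have "continuous_on ?X (\<lambda>w. h (fst (fst w)) (snd (fst w)) (of_real (snd w) * L))"
      unfolding h_def
    proof (intro continuous_on_divide continuous_on_add continuous_on_mult continuous_on_diff cP cf gh vh ah alh ballI)
      fix w assume "w \<in> ?X"
      then show "al (fst (fst w)) (snd (fst w)) - a (fst (fst w)) (snd (fst w)) * P (fst (fst w)) (of_real (snd w) * L) \<noteq> 0"
        by (intro den Ls) (simp_all only: mem_Times_iff)
    qed
    then have "continuous_on ?X (\<lambda>(z, t). h (fst z) (snd z) (of_real t * L))"
      by (simp only: case_prod_unfold)
    then have "continuous_on (?D \<times> ?D) (\<lambda>z. integral (cbox 0 1) (\<lambda>t. h (fst z) (snd z) (of_real t * L)))"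
      by (rule integral_continuous_on_param)
    then show ?thesis
      unfolding T_def prim_def by (intro continuous_intros) (use L in auto)
  qed
  have Th: "holo2 ?D ?D T"
  proof (rule holo2I[OF Tcont])
    show "T x holomorphic_on ?D" if "x \<in> ?D" for x
      unfolding T_def using holo2D(3)[OF holo2_prim[OF h2[OF that] open_ball S1] L(2)] L(1)
      by (intro holomorphic_intros) auto
    show "(\<lambda>x. T x u) holomorphic_on ?D" if "u \<in> ?D" for u
      unfolding T_def using holo2D(3)[OF holo2_prim[OF h1[OF that] open_ball S1] L(2)] L(1)
      by (intro holomorphic_intros) auto
  qed
  \<comment> \<open>At zero modulus the radicands are perfect squares of \<open>ta u - (1 + u)\<close> and \<open>ta u + (1 + u)\<close>.\<close>
  have base: "v 0 u = 1 + u \<and> g 0 u = - ta u \<and> al 0 u = ta u / (2 * (1 + u))" if u: "norm u < d" for u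
  proof -
    have ta2: "(ta u)\<^sup>2 = K\<^sup>2 - (1 + u)\<^sup>2" by (simp add: ta_def)
    have n0: "ta u \<noteq> 0" "1 + u \<noteq> 0" using nz[OF u] by (auto simp: om_def)
    have a0: "a 0 u = 0" by (simp add: a_def)
    have q1: "2 * om u * q 0 u = K\<^sup>2" using nz[OF u] by (simp add: q_def N0)
    have e1: "E1 0 u = (ta u - (1 + u))\<^sup>2"
    proof -
      have "E1 0 u = 2 * om u * q 0 u - 2 * om u" unfolding E1_def a0 by (simp add: algebra_simps)
      also have "\<dots> = K\<^sup>2 - 2 * (1 + u) * ta u" unfolding q1 by (simp add: om_def)
      also have "\<dots> = (ta u - (1 + u))\<^sup>2" using ta2 by algebra
      finally show ?thesis .
    qed
    have e2: "E2 0 u = (ta u + (1 + u))\<^sup>2"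
    proof -
      have "E2 0 u = 2 * om u * q 0 u + 2 * om u" unfolding E2_def a0 by (simp add: algebra_simps)
      also have "\<dots> = K\<^sup>2 + 2 * (1 + u) * ta u" unfolding q1 by (simp add: om_def)
      also have "\<dots> = (ta u + (1 + u))\<^sup>2" using ta2 by algebra
      finally show ?thesis .
    qed
    have c1: "csqrt (E1 0 u) = ta u - (1 + u)" unfolding e1 by (rule csqrt_square) (use dd_dif[OF u] in simp)
    have c2: "csqrt (E2 0 u) = ta u + (1 + u)" unfolding e2 by (rule csqrt_square) (use dd_ta[OF u] dd_1u[OF u] in simp)
    have v0: "v 0 u = 1 + u" unfolding v_def c1 c2 by (simp add: field_simps)
    have g0: "g 0 u = - ta u" unfolding g_def c1 c2 by (simp add: field_simps)
    have "al 0 u = (2 * om u * q 0 u - (1 + u)\<^sup>2) / (2 * om u)"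
      unfolding al_def a0 v0 using nz[OF u] by (simp add: field_simps)
    also have "\<dots> = (ta u)\<^sup>2 / (2 * om u)" unfolding q1 ta2 ..
    also have "\<dots> = ta u / (2 * (1 + u))" using n0 by (simp add: om_def power2_eq_square)
    finally show ?thesis using v0 g0 by simp
  qed
  have T0: "T 0 u = 0" if u: "norm u < d" for u
  proof -
    have n0: "ta u \<noteq> 0" "1 + u \<noteq> 0" using nz[OF u] by (auto simp: om_def)
    have "h 0 u = (\<lambda>s. - 2 * (1 + u))"
      unfolding h_def using base[OF u] n0 by (auto simp: a_def field_simps fun_eq_iff)
    then have "prim (h 0 u) L = (- 2 * (1 + u)) * L" by (simp add: prim_def)
    then have "prim (h 0 u) L / L / 2 = - (1 + u)" using L(1) by simp
    then show ?thesis unfolding T_def by simp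
  qed
  obtain d1 where d1: "d1 > 0" "d1 \<le> d" "\<And>x w. norm x < d1 \<Longrightarrow> w \<in> cball 0 (d/2) \<Longrightarrow> norm (T x w) \<le> d/4/4"
  proof (rule uniformly_small_near_zero[of d "cball 0 (d/2)" T "d/4/4"])
    show "continuous_on (?D \<times> cball 0 (d/2)) (\<lambda>z. T (fst z) (snd z))"
      by (rule continuous_on_subset[OF Tcont]) (use d in auto)
  qed (use d T0 in auto)
  let ?E = "ball (0::complex) d1"
  have ED: "?E \<subseteq> ?D" using d1 by auto
  obtain U where Uh: "U holomorphic_on ?E" and Ub: "\<And>x. x \<in> ?E \<Longrightarrow> norm (U x) \<le> d/4/4"
    and UT: "\<And>x. x \<in> ?E \<Longrightarrow> T x (U x) = U x"
    and UR: "\<And>x. x \<in> ?E \<Longrightarrow> (\<And>w. w \<in> \<real> \<Longrightarrow> norm w \<le> d/4 \<Longrightarrow> T x w \<in> \<real>) \<Longrightarrow> U x \<in> \<real>"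
  proof (rule holomorphic_fixed_point[of ?E "d/4" T])
    show "holo2 ?E (ball 0 (2 * (d/4))) T"
      by (rule holo2_subset[OF Th ED]) (use d in auto)
    show "norm (T x w) \<le> d/4/4" if "x \<in> ?E" "w \<in> ball 0 (2 * (d/4))" for x w
      by (rule d1(3)) (use that in auto)
  qed (use d in auto)
  have UD: "U x \<in> ?D" if "x \<in> ?E" for x using Ub[OF that] d by auto
  have U0: "U 0 = 0" using UT[of 0] T0[of "U 0"] UD[of 0] d1 by simp
  have along: "(\<lambda>x. f x (U x)) holomorphic_on ?E" if "holo2 ?D ?D f" for f
    by (rule holo2_compose_holomorphic[OF holo2_subset[OF that ED subset_refl] open_ball open_ball Uh]) (use UD in blast)
  define om1 where "om1 = (\<lambda>x. om (U x))"
  define v1 where "v1 = (\<lambda>x. v x (U x))"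
  define g1 where "g1 = (\<lambda>x. g x (U x))"
  define al1 where "al1 = (\<lambda>x. al x (U x))"
  define a1 where "a1 = (\<lambda>x. a x (U x))"
  define q1 where "q1 = (\<lambda>x. q x (U x))"
  define p where "p = (\<lambda>x s. a1 x * P x s)"
  define p' where "p' = (\<lambda>x s. a1 x * C' x s)"
  have h1s: "om1 holomorphic_on ?E" "v1 holomorphic_on ?E" "g1 holomorphic_on ?E" "al1 holomorphic_on ?E" "a1 holomorphic_on ?E" "q1 holomorphic_on ?E"
    unfolding om1_def v1_def g1_def al1_def a1_def q1_def
    using along[OF omh2] along[OF vh] along[OF gh] along[OF alh] along[OF ah] along[OF qh] by simp_all
  have ph: "holo2 ?E (strip 1) p"
    unfolding p_def by (intro holo2_mult holo2_fst h1s holo2_subset[OF Ph ED]) auto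
  note basic = om1_def v1_def g1_def al1_def a1_def q1_def
  have rel: "om1 x \<noteq> 0" "2 * om1 x * q1 x = K\<^sup>2 * (N x)\<^sup>2" "a1 x = x * q1 x"
    "(g1 x)\<^sup>2 + (v1 x)\<^sup>2 = (E1 x (U x) + E2 x (U x)) / 2" "4 * g1 x * v1 x = E1 x (U x) - E2 x (U x)"
    "E1 x (U x) = 2 * om1 x * (q1 x - a1 x * M x - 1) * (1 - a1 x * (1 - M x)) * (1 + a1 x * (1 + M x))"
    "E2 x (U x) = 2 * om1 x * (q1 x - a1 x * M x + 1) * (1 + a1 x * (1 - M x)) * (1 - a1 x * (1 + M x))"
    "2 * om1 x * al1 x = 2 * om1 x * (q1 x - 3 * a1 x * M x) - (v1 x)\<^sup>2"
    if x: "x \<in> ?E" for x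
  proof -
    have n: "om (U x) \<noteq> 0" using nz UD[OF x] by simp
    then show "om1 x \<noteq> 0" "2 * om1 x * q1 x = K\<^sup>2 * (N x)\<^sup>2" "a1 x = x * q1 x"
      by (simp_all add: basic q_def a_def)
    have "(csqrt (E1 x (U x)))\<^sup>2 = E1 x (U x)" "(csqrt (E2 x (U x)))\<^sup>2 = E2 x (U x)" by simp_all
    then show "(g1 x)\<^sup>2 + (v1 x)\<^sup>2 = (E1 x (U x) + E2 x (U x)) / 2" "4 * g1 x * v1 x = E1 x (U x) - E2 x (U x)"
      unfolding g1_def v1_def g_def v_def by (simp_all add: field_simps power2_eq_square)
    show "E1 x (U x) = 2 * om1 x * (q1 x - a1 x * M x - 1) * (1 - a1 x * (1 - M x)) * (1 + a1 x * (1 + M x))"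
      "E2 x (U x) = 2 * om1 x * (q1 x - a1 x * M x + 1) * (1 + a1 x * (1 - M x)) * (1 - a1 x * (1 + M x))"
      by (simp_all add: E1_def E2_def basic)
    show "2 * om1 x * al1 x = 2 * om1 x * (q1 x - 3 * a1 x * M x) - (v1 x)\<^sup>2"
      unfolding basic al_def using n by (simp add: field_simps)
  qed
  have xr: "x \<in> ball 0 r" "x \<in> ?D" if "x \<in> ?E" for x
    using subsetD[OF dr subsetD[OF ED that]] subsetD[OF ED that] .
  have a1P: "al1 x - p x s \<noteq> 0" "Re ((al1 x - p x s) / om1 x) > 0" if "x \<in> ?E" "s \<in> strip 1" for x s
    using den[OF xr(2)[OF that(1)] UD[OF that(1)] that(2)] Rrat[OF xr(2)[OF that(1)] UD[OF that(1)] that(2)]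
    by (simp_all add: basic p_def)
  have E0: "0 \<in> ?E" using d1 by simp
  have om0: "om 0 = of_real w0"
    using csq[of w0] w0 Kw by (simp add: om_def ta_def)
  have at0: "om1 0 = of_real w0" "v1 0 = 1" "g1 0 = - of_real w0" "al1 0 = of_real w0 / 2" "a1 0 = 0" "q1 0 = q0"
    using base[of 0] d om0 by (simp_all add: basic U0 om_def a_def q_def q0_def N0)
  have meanp: "prim (p x) L = 0" if x: "x \<in> ?E" for x
  proof -
    have "prim (p x) L = (\<lambda>s. a1 x * (prim (C x) s - M x * s)) L - (\<lambda>s. a1 x * (prim (C x) s - M x * s)) 0"
    proof (rule prim_eqI[OF S1 holo2D(2)[OF ph x] L(2)])
      fix z assume z: "z \<in> strip 1"
      have d1: "(prim (C x) has_field_derivative C x z) (at z)"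
        by (rule has_field_derivative_prim[OF S1 holo2D(2)[OF Ch xr(1)[OF x]] z])
      show "((\<lambda>s. a1 x * (prim (C x) s - M x * s)) has_field_derivative p x z) (at z)"
        unfolding p_def P_def by (rule derivative_eq_intros d1 refl | simp)+
    qed
    then show ?thesis using L(1) by (simp add: M_def)
  qed
  have meanh: "prim (\<lambda>s. (g1 x + v1 x * p x s) / (al1 x - p x s)) L = - 2 * L" if x: "x \<in> ?E" for x
  proof -
    have "prim (h x (U x)) L / L / 2 + 1 = 0"
      using UT[OF x] unfolding T_def by (simp only: add.assoc add_cancel_right_right) (simp add: add.commute)
    then have "prim (h x (U x)) L / L / 2 = -1" by (simp only: eq_neg_iff_add_eq_0)
    then have "prim (h x (U x)) L = -2 * L" using L(1) by (simp add: field_simps)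
    then show ?thesis by (simp add: h_def[abs_def] basic p_def mult.assoc)
  qed
  define Qm where "Qm = (\<lambda>x. prim (\<lambda>s. (P x s)\<^sup>2 / (al1 x - p x s)) L / L)"
  have Q2: "holo2 ?E (strip 1) (\<lambda>x s. (P x s)\<^sup>2 / (al1 x - p x s))"
    by (intro holo2_divide holo2_power holo2_diff holo2_subset[OF Ph ED] holo2_fst[OF h1s(4)] ph a1P) auto
  have Qh: "Qm holomorphic_on ?E"
    unfolding Qm_def using holo2D(3)[OF holo2_prim[OF Q2 open_ball S1] L(2)] L(1) by (intro holomorphic_intros) auto
  have Q0: "Qm 0 = 1 / of_real w0"
  proof -
    have f0: "(P 0 s)\<^sup>2 / (al1 0 - p 0 s) = 2 / of_real w0 * (C 0 s)\<^sup>2" for s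
      by (simp add: P_def M0 p_def at0)
    have "prim (\<lambda>s. (P 0 s)\<^sup>2 / (al1 0 - p 0 s)) L = 2 / of_real w0 * prim (\<lambda>s. (C 0 s)\<^sup>2) L"
      unfolding f0 by (simp add: prim_def)
    also have "prim (\<lambda>s. (C 0 s)\<^sup>2) L = L / 2" using m20 L(1) by (simp add: m2_def field_simps)
    finally show ?thesis using L(1) by (simp add: Qm_def)
  qed
  \<comment> \<open>Two steps of the geometric expansion of the angular speed in \<open>p\<close>; the linear term has mean zero.\<close>
  have E4: "g1 x + 2 * al1 x = - (v1 x + g1 x / al1 x) * (a1 x)\<^sup>2 * Qm x" if x: "x \<in> ?E" and alnz: "al1 x \<noteq> 0" for x
  proof -
    define c where "c = (v1 x + g1 x / al1 x) / al1 x"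
    have eq: "(g1 x + v1 x * p x s) / (al1 x - p x s) = g1 x / al1 x + c * p x s + c * (a1 x)\<^sup>2 * ((P x s)\<^sup>2 / (al1 x - p x s))"
      if s: "s \<in> strip 1" for s
    proof -
      have "(p x s)\<^sup>2 = (a1 x)\<^sup>2 * (P x s)\<^sup>2" by (simp add: p_def power_mult_distrib)
      then have *: "c * (a1 x)\<^sup>2 * ((P x s)\<^sup>2 / (al1 x - p x s)) = c * ((p x s)\<^sup>2 / (al1 x - p x s))" by simp
      show ?thesis
        unfolding * using a1P(1)[OF x s] alnz unfolding c_def by (simp add: divide_simps) (simp add: algebra_simps power2_eq_square)
    qed
    have hol: "(\<lambda>s. (g1 x + v1 x * p x s) / (al1 x - p x s)) holomorphic_on strip 1"
      using holo2D(2)[OF ph x] a1P(1)[OF x] by (intro holomorphic_intros) auto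
    let ?G = "\<lambda>s. g1 x / al1 x * s + c * prim (p x) s + c * (a1 x)\<^sup>2 * prim (\<lambda>s. (P x s)\<^sup>2 / (al1 x - p x s)) s"
    have "prim (\<lambda>s. (g1 x + v1 x * p x s) / (al1 x - p x s)) L = ?G L - ?G 0"
    proof (rule prim_eqI[OF S1 hol L(2)])
      fix z assume z: "z \<in> strip 1"
      have d1: "(prim (p x) has_field_derivative p x z) (at z)"
        by (rule has_field_derivative_prim[OF S1 holo2D(2)[OF ph x] z])
      have d2: "(prim (\<lambda>s. (P x s)\<^sup>2 / (al1 x - p x s)) has_field_derivative (P x z)\<^sup>2 / (al1 x - p x z)) (at z)"
        by (rule has_field_derivative_prim[OF S1 holo2D(2)[OF Q2 x] z])
      show "(?G has_field_derivative (g1 x + v1 x * p x z) / (al1 x - p x z)) (at z)"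
        unfolding eq[OF z] by (rule derivative_eq_intros d1 d2 refl | simp)+
    qed
    then have "-2 * L = g1 x / al1 x * L + c * (a1 x)\<^sup>2 * (Qm x * L)"
      unfolding meanh[OF x] meanp[OF x] using L(1) by (simp add: Qm_def)
    then have "-2 * L = (g1 x / al1 x + c * (a1 x)\<^sup>2 * Qm x) * L" by (simp add: algebra_simps)
    then have "-2 = g1 x / al1 x + c * (a1 x)\<^sup>2 * Qm x" using L(1) by (metis mult_right_cancel)
    then have "-2 * al1 x = (g1 x / al1 x + c * (a1 x)\<^sup>2 * Qm x) * al1 x" by (rule arg_cong)
    also have "\<dots> = g1 x + (v1 x + g1 x / al1 x) * (a1 x)\<^sup>2 * Qm x"
      using alnz by (simp add: c_def field_simps)
    finally have "-2 * al1 x = g1 x + (v1 x + g1 x / al1 x) * (a1 x)\<^sup>2 * Qm x" .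
    moreover have "g + 2 * y = - z" if "-2 * y = g + z" for g y z :: complex using that by algebra
    ultimately show ?thesis by (simp only: mult_minus_left)
  qed
  define B1 where "B1 = (\<lambda>x. 1 - 3 * (M x)\<^sup>2 + 2 * (3/2 * m2 x - 1/2))"
  define B3 where "B3 = (\<lambda>x. 2 * om1 x * (1 - (M x)\<^sup>2) * (q1 x - a1 x * M x))"
  define B4 where "B4 = (\<lambda>x. (v1 x + g1 x / al1 x) * Qm x)"
  have key: "(g1 x)\<^sup>2 * (1 - v1 x) = - (a1 x)\<^sup>2 * (om1 x * B4 x + B3 x + g1 x * om1 x * B1 x)"
    if x: "x \<in> ?E" and alnz: "al1 x \<noteq> 0" for x
    by (rule velocity_defect_identity[OF rel(3-8)[OF x] E4[OF x alnz] Meq[OF xr(1)[OF x]]])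
       (simp_all add: B1_def B3_def B4_def)
  have isC1: "(f \<longlongrightarrow> f 0) (at 0)" if "f holomorphic_on ?E" for f
  proof -
    have "isCont f 0" using holomorphic_on_imp_continuous_on[OF that] E0
      by (simp add: continuous_on_eq_continuous_at)
    then show ?thesis using isCont_def by blast
  qed
  have MhE: "M holomorphic_on ?E" "m2 holomorphic_on ?E"
    using Mh m2h ED dr by (meson holomorphic_on_subset order_trans)+
  have lim: "((\<lambda>x. (1 - v1 x) / x\<^sup>2) \<longlongrightarrow> of_real ((real k ^ 2 / (2 * w0))\<^sup>2 / 2)) (at 0)"
  proof (rule Lim_transform_eventually)
    note t = isC1[OF h1s(1), unfolded at0] isC1[OF h1s(2), unfolded at0] isC1[OF h1s(3), unfolded at0]
       isC1[OF h1s(4), unfolded at0] isC1[OF h1s(5), unfolded at0] isC1[OF h1s(6), unfolded at0]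
       isC1[OF MhE(1), unfolded M0] isC1[OF MhE(2), unfolded m20] isC1[OF Qh, unfolded Q0]
    have w0c: "complex_of_real w0 \<noteq> 0" using w0 by simp
    have tB1: "(B1 \<longlongrightarrow> 3/2) (at 0)" unfolding B1_def by (rule tendsto_eq_intros t refl | simp)+
    have tB3: "(B3 \<longlongrightarrow> 2 * of_real w0 * q0) (at 0)" unfolding B3_def by (rule tendsto_eq_intros t refl | simp)+
    have tB4: "(B4 \<longlongrightarrow> - 1 / of_real w0) (at 0)"
    proof -
      have "(B4 \<longlongrightarrow> (1 + - of_real w0 / (of_real w0 / 2)) * (1 / of_real w0)) (at 0)"
        unfolding B4_def by (intro tendsto_intros t) (use w0c in auto)
      moreover have "(1 + - of_real w0 / (of_real w0 / 2)) * (1 / of_real w0) = - 1 / complex_of_real w0"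
        using w0c by simp
      ultimately show ?thesis by (simp only:)
    qed
    have val: "- q0\<^sup>2 * (of_real w0 * (- 1 / of_real w0) + 2 * of_real w0 * q0 + - of_real w0 * of_real w0 * (3/2)) / (- of_real w0)\<^sup>2
       = of_real ((real k ^ 2 / (2 * w0))\<^sup>2 / 2)"
    proof -
      have q0': "q0 = of_real (real k ^ 2 / (2 * w0))" by (simp add: q0_def K_def)
      have "of_real w0 * (- 1 / of_real w0) + 2 * of_real w0 * q0 + - of_real w0 * of_real w0 * (3/2) = - (of_real w0)\<^sup>2 / 2"
        unfolding q0w using w0c by (simp add: power2_eq_square)
      then have "- q0\<^sup>2 * (of_real w0 * (- 1 / of_real w0) + 2 * of_real w0 * q0 + - of_real w0 * of_real w0 * (3/2)) / (- of_real w0)\<^sup>2 = q0\<^sup>2 / 2"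
        using w0c by (simp only:) (simp add: field_simps)
      moreover have "of_real ((real k ^ 2 / (2 * w0))\<^sup>2 / 2) = q0\<^sup>2 / 2" unfolding q0' by simp
      ultimately show ?thesis by (simp only:)
    qed
    show "((\<lambda>x. - (q1 x)\<^sup>2 * (om1 x * B4 x + B3 x + g1 x * om1 x * B1 x) / (g1 x)\<^sup>2) \<longlongrightarrow> of_real ((real k ^ 2 / (2 * w0))\<^sup>2 / 2)) (at 0)"
      unfolding val[symmetric] by (intro tendsto_intros t tB1 tB3 tB4) (use w0c in auto)
    have "eventually (\<lambda>x. al1 x \<noteq> 0) (at 0)" using tendsto_imp_eventually_ne[OF t(4)] w0c by simp
    moreover have "eventually (\<lambda>x. g1 x \<noteq> 0) (at 0)" using tendsto_imp_eventually_ne[OF t(3)] w0c by simp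
    moreover have "eventually (\<lambda>x. x \<in> ?E) (at 0)" by (rule eventually_at_in_open'[OF open_ball E0])
    moreover have "eventually (\<lambda>x. x \<noteq> 0) (at (0::complex))" by (simp add: eventually_at_filter)
    ultimately show "eventually (\<lambda>x. - (q1 x)\<^sup>2 * (om1 x * B4 x + B3 x + g1 x * om1 x * B1 x) / (g1 x)\<^sup>2 = (1 - v1 x) / x\<^sup>2) (at 0)"
    proof eventually_elim
      case (elim x)
      have "(g1 x)\<^sup>2 * (1 - v1 x) = x\<^sup>2 * (- (q1 x)\<^sup>2 * (om1 x * B4 x + B3 x + g1 x * om1 x * B1 x))"
        using key[OF elim(3,1)] rel(3)[OF elim(3)] by (simp add: power_mult_distrib algebra_simps)
      moreover have "X / G = D / Y" if "G * D = Y * X" "G \<noteq> 0" "Y \<noteq> 0" for X G D Y :: complex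
        using that by (simp add: field_simps)
      ultimately show ?case using elim(2,4) by (metis power_not_zero)
    qed
  qed
  have reals: "om u \<in> \<real> \<and> a x u \<in> \<real> \<and> v x u \<in> \<real> \<and> g x u \<in> \<real> \<and> al x u \<in> \<real> \<and> (\<forall>s\<in>\<real>. P x s \<in> \<real>)"
    if x: "x \<in> ?D" "x \<in> \<real>" and u: "u \<in> ?D" "u \<in> \<real>" for x u
  proof -
    have KR: "K \<in> \<real>" by (simp add: K_def)
    have dd': "Re (K\<^sup>2 - (1 + u)\<^sup>2) > 0" "Re (E1 x u) > 0" "Re (E2 x u) > 0" using dd_sq[of u] dd_E1[of x u] dd_E2[of x u] x u by auto
    have "K\<^sup>2 - (1 + u)\<^sup>2 \<in> \<real>" using u KR by (intro Reals_diff Reals_power Reals_add) auto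
    then have taR: "ta u \<in> \<real>" unfolding ta_def using dd'(1) by (intro csqrt_Reals)
    then have omR: "om u \<in> \<real>" unfolding om_def using u by (intro Reals_mult Reals_add) auto
    have NxR: "N x \<in> \<real>" using NR x dr by auto
    have MxR: "M x \<in> \<real>"
      unfolding M_def using CR[of x] x dr L(3)
      by (intro Reals_divide prim_Reals continuous_on_subset[OF holomorphic_on_imp_continuous_on[OF holo2D(2)[OF Ch]] RS]) auto
    have qR: "q x u \<in> \<real>" unfolding q_def using KR NxR omR by (intro Reals_divide Reals_mult Reals_power) auto
    have aR: "a x u \<in> \<real>" unfolding a_def using x qR by (intro Reals_mult)
    have "E1 x u \<in> \<real>" "E2 x u \<in> \<real>"
      unfolding E1_def E2_def using omR qR aR MxR by (auto intro!: Reals_mult Reals_add Reals_diff)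
    then have "csqrt (E1 x u) \<in> \<real>" "csqrt (E2 x u) \<in> \<real>" using dd' by (auto intro: csqrt_Reals)
    then have vg: "v x u \<in> \<real>" "g x u \<in> \<real>"
      unfolding v_def g_def by (auto intro!: Reals_divide Reals_diff Reals_add Reals_minus)
    have alR: "al x u \<in> \<real>"
      unfolding al_def using vg qR aR MxR omR by (auto intro!: Reals_divide Reals_diff Reals_mult Reals_power)
    have "\<forall>s\<in>\<real>. P x s \<in> \<real>" unfolding P_def using CR[of x] x dr MxR by (auto intro!: Reals_diff)
    then show ?thesis using omR aR vg alR by blast
  qed
  have UR': "U x \<in> \<real>" if x: "x \<in> ?E" "x \<in> \<real>" for x
  proof (rule UR[OF x(1)])
    fix w :: complex assume w: "w \<in> \<real>" "norm w \<le> d/4"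
    have wD: "w \<in> ?D" using w d by auto
    have hR: "h x w s \<in> \<real>" if "s \<in> \<real>" for s
      unfolding h_def using reals[OF xr(2)[OF x(1)] x(2) wD w(1)] that
      by (intro Reals_divide Reals_add Reals_mult Reals_diff) auto
    have "prim (h x w) L \<in> \<real>"
      by (rule prim_Reals[OF hR L(3) continuous_on_subset[OF holomorphic_on_imp_continuous_on[OF holo2D(2)[OF h1[OF wD] xr(2)[OF x(1)]]] RS]])
    then show "T x w \<in> \<real>" unfolding T_def using w(1) L(3) by (intro Reals_add Reals_divide) auto
  qed
  have Lpi: "- of_real (4 * pi) = - 2 * L" by (simp add: L_def)
  show ?thesis
  proof (rule that[of d1 om1 v1 g1 al1 p p'])
    show "d1 > 0" by (rule d1(1))
    show "om1 holomorphic_on ?E" "v1 holomorphic_on ?E" "g1 holomorphic_on ?E" "al1 holomorphic_on ?E" by (rule h1s)+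
    show "holo2 ?E (strip 1) p" by (rule ph)
    show "(p x has_field_derivative p' x s) (at s)" if "x \<in> ?E" "s \<in> strip 1" for x s
      unfolding p_def p'_def P_def by (rule derivative_eq_intros dC[OF xr(1)[OF that(1)] that(2)] refl | simp)+
    show "(p' x has_field_derivative
       (- om1 x * (1 - (p x s)\<^sup>2) - 2 * om1 x * p x s * (al1 x - p x s) - v1 x * (g1 x + v1 x * p x s)) / (of_nat k)\<^sup>2) (at s)"
      if x: "x \<in> ?E" and s: "s \<in> strip 1" for x s
    proof -
      have "(p' x has_field_derivative a1 x * ((N x)\<^sup>2 * (- C x s - x / 2 + 3 / 2 * x * (C x s)\<^sup>2))) (at s)"
        unfolding p'_def by (rule DERIV_cmult[OF dC'[OF xr(1)[OF x] s]])
      moreover have eq: "(of_nat k)\<^sup>2 * (a1 x * ((N x)\<^sup>2 * (- C x s - x / 2 + 3 / 2 * x * (C x s)\<^sup>2))) =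
          - om1 x * (1 - (p x s)\<^sup>2) - 2 * om1 x * p x s * (al1 x - p x s) - v1 x * (g1 x + v1 x * p x s)"
        unfolding K_def[symmetric]
        by (rule profile_acceleration_identity[OF rel(2,3,5-8)[OF x]]) (simp add: p_def P_def)
      have "a1 x * ((N x)\<^sup>2 * (- C x s - x / 2 + 3 / 2 * x * (C x s)\<^sup>2)) =
          (- om1 x * (1 - (p x s)\<^sup>2) - 2 * om1 x * p x s * (al1 x - p x s) - v1 x * (g1 x + v1 x * p x s)) / (of_nat k)\<^sup>2"
        unfolding eq[symmetric] using K0 unfolding K_def by simp
      ultimately show ?thesis by (simp only:)
    qed
    show "(of_nat k)\<^sup>2 * (p' x s)\<^sup>2 = 2 * om1 x * (al1 x - p x s) * (1 - (p x s)\<^sup>2) - (g1 x + v1 x * p x s)\<^sup>2"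
      if x: "x \<in> ?E" and s: "s \<in> strip 1" for x s
    proof -
      have "(of_nat k)\<^sup>2 * (p' x s)\<^sup>2 = K\<^sup>2 * (N x)\<^sup>2 * (a1 x)\<^sup>2 * ((1 - (C x s)\<^sup>2) * (1 - x * C x s))"
        unfolding p'_def power_mult_distrib C'2[OF xr(1)[OF x] s] K_def by (simp add: algebra_simps)
      also have "\<dots> = 2 * om1 x * (al1 x - p x s) * (1 - (p x s)\<^sup>2) - (g1 x + v1 x * p x s)\<^sup>2"
        by (rule profile_energy_identity[OF rel(2-8)[OF x]]) (simp add: p_def P_def)
      finally show ?thesis .
    qed
    show "p x (s + of_real (2 * pi)) = p x s" if "x \<in> ?E" "s \<in> strip 1" for x s
      unfolding p_def P_def using Cper[OF xr(1)[OF that(1)] that(2)] by simp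
    show "prim (p x) (of_real (2 * pi)) = 0" if "x \<in> ?E" for x
      using meanp[OF that] by (simp add: L_def)
    show "prim (\<lambda>s. (g1 x + v1 x * p x s) / (al1 x - p x s)) (of_real (2 * pi)) = - of_real (4 * pi)" if "x \<in> ?E" for x
      using meanh[OF that] unfolding Lpi unfolding L_def .
    show "Re ((al1 x - p x s) / om1 x) > 0" if "x \<in> ?E" "s \<in> strip 1" for x s by (rule a1P(2)[OF that])
    show "Re (om1 x) > 0" if "x \<in> ?E" for x using dd_om[of "U x"] UD[OF that] by (simp add: om1_def)
    show "om1 x \<in> \<real> \<and> v1 x \<in> \<real> \<and> g1 x \<in> \<real> \<and> al1 x \<in> \<real>" if "x \<in> ?E" "x \<in> \<real>" for x
      using reals[OF xr(2)[OF that(1)] that(2) UD[OF that(1)] UR'[OF that]] by (simp add: basic)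
    show "p x s \<in> \<real>" if "x \<in> ?E" "x \<in> \<real>" "s \<in> \<real>" for x s
      using reals[OF xr(2)[OF that(1)] that(2) UD[OF that(1)] UR'[OF that(1,2)]] that(3) by (simp add: p_def basic)
    show "om1 0 = of_real (sqrt (real k ^ 2 - 1))" by (simp add: at0 w0_def)
    show "v1 0 = 1" "g1 0 = - om1 0" "al1 0 = om1 0 / 2" by (simp_all add: at0)
    show "p 0 s = 0" for s by (simp add: p_def at0)
    show "((\<lambda>x. (1 - v1 x) / x\<^sup>2) \<longlongrightarrow> of_real ((real k ^ 2 / (2 * sqrt (real k ^ 2 - 1)))\<^sup>2 / 2)) (at 0)"
      using lim unfolding w0_def .
  qed
qed

section \<open>Sobolev norms of smooth periodic functions\<close>

lemma has_real_derivative_Re: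
  assumes f: "f holomorphic_on U" and U: "open U" and s: "of_real s \<in> U"
  shows "((\<lambda>t. Re (f (of_real t))) has_real_derivative Re (deriv f (of_real s))) (at s)"
proof -
  have "(f has_field_derivative deriv f (of_real s)) (at (of_real s))"
    by (rule holomorphic_derivI[OF f U s])
  then have "((\<lambda>t. f (of_real t)) has_vector_derivative deriv f (of_real s)) (at s)"
    by (rule has_vector_derivative_real_field)
  then have "((\<lambda>t. Re (f (of_real t))) has_vector_derivative Re (deriv f (of_real s))) (at s)"
    by (rule bounded_linear.has_vector_derivative[OF bounded_linear_Re])
  then show ?thesis by (simp add: has_real_derivative_iff_has_vector_derivative)
qed

lemma higher_deriv_Re:
  assumes f: "f holomorphic_on U" and U: "open U" and s: "\<And>s. of_real s \<in> U"
  shows "(deriv ^^ n) (\<lambda>t. Re (f (of_real t))) = (\<lambda>t. Re ((deriv ^^ n) f (of_real t)))"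
proof (induction n)
  case (Suc n)
  have "((\<lambda>t. Re ((deriv ^^ n) f (of_real t))) has_real_derivative Re (deriv ((deriv ^^ n) f) (of_real s))) (at s)" for s
    by (rule has_real_derivative_Re[OF holomorphic_higher_deriv[OF f U] U assms(3)])
  then show ?case by (auto simp: Suc intro!: ext DERIV_imp_deriv)
qed simp

text \<open>
  All smooth periodic functions below arise as real parts of functions that are holomorphic near the
  real axis.
\<close>
lemma smooth_torus_Re:
  assumes f: "f holomorphic_on U" and U: "open U" and s: "\<And>s. of_real s \<in> U"
    and per: "\<And>s. f (of_real (s + L)) = f (of_real s)"
  shows "(\<lambda>t. Re (f (of_real t))) \<in> smooth_torus L"
  unfolding smooth_torus_def
proof (intro CollectI conjI allI)
  show "Re (f (of_real (s + L))) = Re (f (of_real s))" for s using per[of s] by simp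
  show "(deriv ^^ n) (\<lambda>t. Re (f (of_real t))) field_differentiable at s" for n s
    unfolding higher_deriv_Re[OF f U s]
    using has_real_derivative_Re[OF holomorphic_higher_deriv[OF f U] U assms(3)] field_differentiable_def by blast
qed

lemma smooth_torus_DERIV:
  assumes "f \<in> smooth_torus L"
  shows "((deriv ^^ n) f has_real_derivative (deriv ^^ Suc n) f s) (at s)"
proof -
  have "(deriv ^^ n) f field_differentiable (at s)" using assms by (simp add: smooth_torus_def)
  then show ?thesis by (simp add: field_differentiable_derivI)
qed

lemma smooth_torus_deriv:
  assumes f: "f \<in> smooth_torus L"
  shows "deriv f \<in> smooth_torus L"
proof -
  have "deriv f (s + L) = deriv f s" for s
  proof -
    have "(f has_real_derivative deriv f (s + L)) (at (s + L))"
      using smooth_torus_DERIV[OF f, of 0] by simp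
    then have "((\<lambda>s. f (s + L)) has_real_derivative deriv f (s + L)) (at s)" by (simp only: DERIV_shift)
    moreover have "(\<lambda>s. f (s + L)) = f" using f by (simp add: smooth_torus_def)
    ultimately show ?thesis using DERIV_imp_deriv by metis
  qed
  moreover have "(deriv ^^ n) (deriv f) field_differentiable at s" for n s
  proof -
    have "(deriv ^^ Suc n) f field_differentiable at s" using f unfolding smooth_torus_def by blast
    then show ?thesis by (simp add: funpow_swap1)
  qed
  ultimately show ?thesis by (simp add: smooth_torus_def)
qed

lemma smooth_torus_higher_deriv: "f \<in> smooth_torus L \<Longrightarrow> (deriv ^^ n) f \<in> smooth_torus L"
  by (induction n) (simp_all add: smooth_torus_deriv)

lemma smooth_torus_continuous: "f \<in> smooth_torus L \<Longrightarrow> continuous_on S f"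
proof -
  assume f: "f \<in> smooth_torus L"
  have "isCont f s" for s using DERIV_isCont[OF smooth_torus_DERIV[OF f, of 0]] by simp
  then show ?thesis by (simp add: continuous_at_imp_continuous_on)
qed

lemma smooth_torus_set_integrable_mult:
  assumes "f \<in> smooth_torus L" "g \<in> smooth_torus L"
  shows "set_integrable lebesgue {0..L} (\<lambda>s. f s * g s)"
  by (rule absolutely_integrable_continuous_real[OF continuous_on_mult[OF smooth_torus_continuous[OF assms(1)] smooth_torus_continuous[OF assms(2)]]])

lemma smooth_torus_L2: "f \<in> smooth_torus L \<Longrightarrow> f \<in> L2_torus L"
proof -
  assume f: "f \<in> smooth_torus L"
  have "f \<in> borel_measurable lebesgue"
    using borel_measurable_continuous_onI[OF smooth_torus_continuous[OF f]] by (simp add: measurable_completion)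
  then show ?thesis
    using smooth_torus_set_integrable_mult[OF f f] f by (simp add: L2_torus_def smooth_torus_def power2_eq_square)
qed

lemma smooth_torus_by_parts:
  assumes L: "L > 0" and f: "f \<in> smooth_torus L" and g: "g \<in> smooth_torus L"
  shows "(LINT s:{0..L}|lebesgue. f s * deriv g s) = - (LINT s:{0..L}|lebesgue. deriv f s * g s)"
proof -
  have 1: "set_integrable lebesgue {0..L} (\<lambda>s. f s * deriv g s)" "set_integrable lebesgue {0..L} (\<lambda>s. deriv f s * g s)"
    using smooth_torus_set_integrable_mult f g smooth_torus_deriv by blast+
  have "((\<lambda>s. f s * deriv g s + deriv f s * g s) has_integral (f L * g L - f 0 * g 0)) {0..L}"
  proof (rule fundamental_theorem_of_calculus)
    fix s assume "s \<in> {0..L}"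
    have "(f has_real_derivative deriv f s) (at s)" "(g has_real_derivative deriv g s) (at s)"
      using smooth_torus_DERIV[OF f, of 0] smooth_torus_DERIV[OF g, of 0] by simp_all
    then have "((\<lambda>s. f s * g s) has_real_derivative f s * deriv g s + deriv f s * g s) (at s)"
      by (auto intro!: derivative_eq_intros)
    then show "((\<lambda>s. f s * g s) has_vector_derivative f s * deriv g s + deriv f s * g s) (at s within {0..L})"
      by (simp add: has_real_derivative_iff_has_vector_derivative has_vector_derivative_at_within)
  qed (use L in auto)
  moreover have "f (0 + L) = f 0" "g (0 + L) = g 0" using f g unfolding smooth_torus_def by blast+
  then have "f L = f 0" "g L = g 0" by simp_all
  ultimately have "((\<lambda>s. f s * deriv g s + deriv f s * g s) has_integral 0) {0..L}" by simp
  moreover have "((\<lambda>s. f s * deriv g s + deriv f s * g s) has_integral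
     ((LINT s:{0..L}|lebesgue. f s * deriv g s) + (LINT s:{0..L}|lebesgue. deriv f s * g s))) {0..L}"
    by (intro has_integral_add has_integral_set_lebesgue 1)
  ultimately have "(LINT s:{0..L}|lebesgue. f s * deriv g s) + (LINT s:{0..L}|lebesgue. deriv f s * g s) = 0"
    by (metis has_integral_unique)
  then show ?thesis by simp
qed

lemma smooth_torus_is_weak_deriv:
  assumes L: "L > 0" and f: "f \<in> smooth_torus L"
  shows "is_weak_deriv L j f ((deriv ^^ j) f)"
  unfolding is_weak_deriv_def
proof (intro conjI ballI)
  show "(deriv ^^ j) f \<in> L2_torus L" by (rule smooth_torus_L2[OF smooth_torus_higher_deriv[OF f]])
  fix \<phi> assume \<phi>: "\<phi> \<in> smooth_torus L"
  show "(LINT s:{0..L}|lebesgue. f s * (deriv ^^ j) \<phi> s) = (-1) ^ j * (LINT s:{0..L}|lebesgue. (deriv ^^ j) f s * \<phi> s)"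
    using \<phi>
  proof (induction j arbitrary: \<phi>)
    case (Suc j)
    have "(deriv ^^ Suc j) \<phi> = (deriv ^^ j) (deriv \<phi>)" by (simp add: funpow_swap1)
    then have "(LINT s:{0..L}|lebesgue. f s * (deriv ^^ Suc j) \<phi> s) = (-1) ^ j * (LINT s:{0..L}|lebesgue. (deriv ^^ j) f s * deriv \<phi> s)"
      using Suc.IH[OF smooth_torus_deriv[OF Suc.prems]] by simp
    then show ?case
      using smooth_torus_by_parts[OF L smooth_torus_higher_deriv[OF f, of j] Suc.prems] by simp
  qed simp
qed

lemma smooth_torus_sobolev:
  assumes "L > 0" "f \<in> smooth_torus L"
  shows "f \<in> sobolev L m"
proof -
  have "\<exists>g. is_weak_deriv L j f g" for j using smooth_torus_is_weak_deriv[OF assms] by blast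
  then show ?thesis using smooth_torus_L2[OF assms(2)] by (simp add: sobolev_def)
qed

lemma L2_torus_set_integrable:
  assumes "g \<in> L2_torus L"
  shows "set_integrable lebesgue {0..L} g"
proof (rule set_integrable_bound[of lebesgue "{0..L}" "\<lambda>s. 1 + (g s)\<^sup>2"])
  have "set_integrable lebesgue {0..L} (\<lambda>s. (1::real))"
    by (rule absolutely_integrable_continuous_real) auto
  then show "set_integrable lebesgue {0..L} (\<lambda>s. 1 + (g s)\<^sup>2)"
    using assms by (intro set_integral_add) (auto simp: L2_torus_def)
  have [measurable]: "g \<in> borel_measurable lebesgue" using assms by (simp add: L2_torus_def)
  show "set_borel_measurable lebesgue {0..L} g"
    unfolding set_borel_measurable_def by (intro borel_measurable_scaleR borel_measurable_indicator) auto
  have "\<bar>x\<bar> \<le> 1 + x\<^sup>2" for x :: real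
    using sum_squares_ge_zero[of "\<bar>x\<bar> - 1" 0] zero_le_power2[of "\<bar>x\<bar> - 1"] by (simp add: power2_eq_square algebra_simps)
  then show "AE s in lebesgue. s \<in> {0..L} \<longrightarrow> norm (g s) \<le> norm (1 + (g s)\<^sup>2)"
    by (intro AE_I2) (auto intro: order_trans)
qed

lemma L2_torus_mult_smooth_integrable:
  assumes g: "g \<in> L2_torus L" and \<phi>: "\<phi> \<in> smooth_torus L"
  shows "set_integrable lebesgue {0..L} (\<lambda>s. g s * \<phi> s)"
proof -
  have "compact (\<phi> ` {0..L})" by (intro compact_continuous_image smooth_torus_continuous[OF \<phi>]) auto
  then obtain B where B: "\<And>s. s \<in> {0..L} \<Longrightarrow> \<bar>\<phi> s\<bar> \<le> B" "B > 0"
    using bounded_pos compact_imp_bounded by (metis (no_types, lifting) imageI real_norm_def)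
  show ?thesis
  proof (rule set_integrable_bound[of lebesgue "{0..L}" "\<lambda>s. B * g s"])
    show "set_integrable lebesgue {0..L} (\<lambda>s. B * g s)"
      by (intro set_integrable_mult_right L2_torus_set_integrable[OF g])
    have [measurable]: "g \<in> borel_measurable lebesgue" "\<phi> \<in> borel_measurable lebesgue"
      using g smooth_torus_L2[OF \<phi>] by (simp_all add: L2_torus_def)
    show "set_borel_measurable lebesgue {0..L} (\<lambda>s. g s * \<phi> s)"
      unfolding set_borel_measurable_def by (intro borel_measurable_scaleR borel_measurable_times borel_measurable_indicator) auto
    show "AE s in lebesgue. s \<in> {0..L} \<longrightarrow> norm (g s * \<phi> s) \<le> norm (B * g s)"
      using B by (intro AE_I2) (auto simp: abs_mult mult.commute[of B] intro!: mult_left_mono)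
  qed
qed

text \<open>
  Logistic functions of \<open>cos (2 \<pi> (s - m) / L) - cos (2 \<pi> h / L)\<close>, which is positive exactly for the points
  of the circle at distance less than \<open>h < L / 2\<close> from \<open>m\<close>.  As \<open>n\<close> grows they approach the indicator of that arc while
  staying smooth, periodic and bounded by one.
\<close>
definition bump :: "real \<Rightarrow> real \<Rightarrow> real \<Rightarrow> nat \<Rightarrow> real \<Rightarrow> real" where
  "bump L m h n s = 1 / (1 + exp (- real n * (cos (2 * pi * (s - m) / L) - cos (2 * pi * h / L))))"

lemma bump_smooth:
  assumes "L > 0"
  shows "bump L m h n \<in> smooth_torus L"
proof -
  define E where "E = (\<lambda>z::complex. 1 + exp (- of_nat n * (cos (2 * of_real pi * (z - of_real m) / of_real L) - of_real (cos (2 * pi * h / L)))))"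
  have Ecl: "continuous_on UNIV E" unfolding E_def using assms by (intro continuous_intros) auto
  have "E holomorphic_on UNIV" unfolding E_def using assms by (intro holomorphic_intros) auto
  define U where "U = {z. E z \<noteq> 0}"
  have U: "open U" unfolding U_def by (intro open_Collect_neq Ecl continuous_intros)
  have Er: "E (of_real s) = of_real (1 + exp (- real n * (cos (2 * pi * (s - m) / L) - cos (2 * pi * h / L))))" for s
    by (simp add: E_def exp_of_real[symmetric] cos_of_real[symmetric])
  have "(\<lambda>t. Re ((\<lambda>z. 1 / E z) (of_real t))) \<in> smooth_torus L"
  proof (rule smooth_torus_Re[OF _ U])
    show "(\<lambda>z. 1 / E z) holomorphic_on U"
      using \<open>E holomorphic_on UNIV\<close> by (intro holomorphic_intros) (auto simp: U_def intro: holomorphic_on_subset)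
    show "of_real s \<in> U" for s
      unfolding U_def mem_Collect_eq Er of_real_eq_0_iff by (smt (verit) exp_gt_zero)
    fix s
    have "2 * pi * (s + L - m) / L = 2 * pi * (s - m) / L + 2 * pi" using assms by (simp add: field_simps)
    then show "1 / E (of_real (s + L)) = 1 / E (of_real s)" unfolding Er by simp
  qed
  moreover have "Re (1 / E (of_real t)) = bump L m h n t" for t
    unfolding Er bump_def by (simp only: Re_divide_of_real one_complex.simps)
  ultimately show ?thesis by (simp add: fun_eq_iff[symmetric])
qed

lemma bump_bounds: "0 \<le> bump L m h n s" "bump L m h n s \<le> 1"
proof -
  have "0 \<le> 1 / (1 + exp x)" "1 / (1 + exp x) \<le> 1" for x :: real
    by (simp_all add: divide_le_eq_1 add_pos_pos)
  then show "0 \<le> bump L m h n s" "bump L m h n s \<le> 1" unfolding bump_def by blast+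
qed

lemma bump_tendsto:
  assumes L: "L > 0" and ab: "0 \<le> a" "a < b" "b \<le> L" "b - a < L" and s: "s \<in> {0..L}" "s \<noteq> a" "s \<noteq> b" "s \<noteq> 0" "s \<noteq> L"
  shows "(\<lambda>n. bump L ((a+b)/2) ((b-a)/2) n s) \<longlonglongrightarrow> indicator {a..b} s"
proof -
  let ?m = "(a+b)/2" and ?h = "(b-a)/2"
  define c where "c = cos (2 * pi * (s - ?m) / L) - cos (2 * pi * ?h / L)"
  define \<theta> where "\<theta> = 2 * pi * ?h / L"
  define t where "t = 2 * pi * \<bar>s - ?m\<bar> / L"
  have "pi * (b - a) < pi * L" using ab by simp
  then have th: "0 < \<theta>" "\<theta> < pi" using ab L by (simp_all add: \<theta>_def field_simps)
  have ct: "cos (2 * pi * (s - ?m) / L) = cos t"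
    unfolding t_def using L by (subst cos_abs_real[symmetric]) (simp add: abs_mult abs_divide)
  have c: "c = cos t - cos \<theta>" by (simp add: c_def ct \<theta>_def)
  have tn: "0 \<le> t" using L by (simp add: t_def)
  show ?thesis
  proof (cases "s \<in> {a..b}")
    case True
    then have "\<bar>s - ?m\<bar> < ?h" using s by (auto simp: abs_less_iff field_simps)
    then have "t < \<theta>" using L by (simp add: t_def \<theta>_def divide_strict_right_mono)
    then have "cos \<theta> < cos t" using th tn by (intro cos_monotone_0_pi) auto
    then have "c > 0" by (simp add: c)
    then have "(\<lambda>n::nat. 1 / (1 + exp (- real n * c))) \<longlonglongrightarrow> 1" by real_asymp
    then show ?thesis using True by (simp add: bump_def c_def)
  next
    case False
    then have "\<bar>s - ?m\<bar> > ?h" by (auto simp: field_simps abs_if)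
    then have 1: "\<theta> < t" using L by (simp add: t_def \<theta>_def divide_strict_right_mono)
    have "\<bar>s - ?m\<bar> < L - ?h" using s ab by (auto simp: abs_less_iff field_simps)
    then have "t < 2 * pi * (L - ?h) / L" using L by (simp add: t_def divide_strict_right_mono)
    also have "\<dots> = 2 * pi - \<theta>" using L by (simp add: \<theta>_def field_simps)
    finally have 2: "t < 2 * pi - \<theta>" .
    have "cos t < cos \<theta>"
    proof (cases "t \<le> pi")
      case True
      then show ?thesis using 1 th by (intro cos_monotone_0_pi) auto
    next
      case False
      have "cos (2 * pi - t) < cos \<theta>" using 2 False th by (intro cos_monotone_0_pi) auto
      then show ?thesis by simp
    qed
    then have "c < 0" by (simp add: c)
    then have "(\<lambda>n::nat. 1 / (1 + exp (- real n * c))) \<longlonglongrightarrow> 0" by real_asymp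
    then show ?thesis using False by (simp add: bump_def c_def)
  qed
qed

text \<open>
  Testing with bumps and dominated convergence shows that the integral of \<open>d\<close> over every interval vanishes, hence
  over every Borel set.  A Borel representative of \<open>d\<close> is used since the induction over sets runs in \<open>borel\<close>.
\<close>
lemma L2_torus_orthogonal_smooth_zero:
  assumes L: "L > 0" and dI: "set_integrable lebesgue {0..L} d"
    and orth: "\<And>\<phi>. \<phi> \<in> smooth_torus L \<Longrightarrow> (LINT s:{0..L}|lebesgue. d s * \<phi> s) = 0"
  shows "AE s in lebesgue. s \<in> {0..L} \<longrightarrow> d s = 0"
proof -
  define D where "D = (\<lambda>s. indicator {0..L} s * d s)"
  have DI: "integrable lebesgue D" using dI by (simp add: set_integrable_def D_def)
  have one: "(\<lambda>s. 1) \<in> smooth_torus L"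
  proof -
    have "(deriv ^^ n) (\<lambda>s. 1) field_differentiable at s" for n and s :: real
      by (cases n) (auto simp: funpow_swap1 simp del: funpow.simps)
    then show ?thesis by (simp add: smooth_torus_def)
  qed
  have tot: "integral\<^sup>L lebesgue D = 0"
    using orth[OF one] by (simp add: set_lebesgue_integral_def D_def)
  have sub: "(LINT s|lebesgue. indicator {a..b} s * D s) = 0" if ab: "0 \<le> a" "a < b" "b \<le> L" for a b
  proof (cases "b - a < L")
    case False
    then have "a = 0" "b = L" using ab by auto
    then have "(\<lambda>s. indicator {a..b} s * D s) = D" by (auto simp: D_def indicator_def)
    then show ?thesis using tot by simp
  next
    case True
    have "(\<lambda>n. LINT s|lebesgue. bump L ((a+b)/2) ((b-a)/2) n s * D s) \<longlonglongrightarrow> (LINT s|lebesgue. indicator {a..b} s * D s)"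
    proof (rule integral_dominated_convergence[where w="\<lambda>s. norm (D s)"])
      have [measurable]: "D \<in> borel_measurable lebesgue" using DI by auto
      have [measurable]: "bump L ((a+b)/2) ((b-a)/2) n \<in> borel_measurable lebesgue" for n
        using smooth_torus_L2[OF bump_smooth[OF L]] by (simp add: L2_torus_def)
      show "(\<lambda>s. indicator {a..b} s * D s) \<in> borel_measurable lebesgue"
        by (intro borel_measurable_times borel_measurable_indicator) auto
      show "(\<lambda>s. bump L ((a+b)/2) ((b-a)/2) n s * D s) \<in> borel_measurable lebesgue" for n
        by measurable
      show "integrable lebesgue (\<lambda>s. norm (D s))" using DI by (rule integrable_norm)
      show "AE s in lebesgue. norm (bump L ((a+b)/2) ((b-a)/2) n s * D s) \<le> norm (D s)" for n
        using bump_bounds by (intro AE_I2) (simp add: abs_mult mult_left_le_one_le)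
      have "AE s in lebesgue. s \<notin> {a, b, 0, L}"
        by (intro AE_not_in null_sets_completionI finite_imp_null_set_lborel) auto
      then show "AE s in lebesgue. (\<lambda>n. bump L ((a+b)/2) ((b-a)/2) n s * D s) \<longlonglongrightarrow> indicator {a..b} s * D s"
      proof eventually_elim
        case (elim s)
        show ?case
        proof (cases "s \<in> {0..L}")
          case True
          show ?thesis by (intro tendsto_mult_right bump_tendsto[OF L ab \<open>b - a < L\<close> True]) (use elim in auto)
        qed (simp add: D_def)
      qed
    qed
    moreover have "(LINT s|lebesgue. bump L ((a+b)/2) ((b-a)/2) n s * D s) = 0" for n
    proof -
      have "(\<lambda>s. bump L ((a+b)/2) ((b-a)/2) n s * D s) = (\<lambda>s. indicator {0..L} s *\<^sub>R (d s * bump L ((a+b)/2) ((b-a)/2) n s))"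
        by (auto simp: D_def)
      then show ?thesis using orth[OF bump_smooth[OF L, of "(a+b)/2" "(b-a)/2" n]] by (simp add: set_lebesgue_integral_def)
    qed
    ultimately have "(\<lambda>n::nat. 0) \<longlonglongrightarrow> (LINT s|lebesgue. indicator {a..b} s * D s)" by simp
    then show ?thesis by (simp add: LIMSEQ_const_iff)
  qed
  have int: "(LINT s|lebesgue. indicator {a..b} s * D s) = 0" if "a \<le> b" for a b
  proof -
    have "(\<lambda>s. indicator {a..b} s * D s) = (\<lambda>s. indicator {max 0 a..min L b} s * D s)"
      by (auto simp: D_def indicator_def)
    moreover have "(LINT s|lebesgue. indicator {max 0 a..min L b} s * D s) = 0"
    proof (cases "max 0 a < min L b")
      case True
      then show ?thesis by (intro sub) auto
    next
      case False
      have "AE s in lebesgue. s \<noteq> max 0 a" by (rule AE_completion[OF AE_lborel_singleton])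
      then have "AE s in lebesgue. indicator {max 0 a..min L b} s * D s = 0"
        by eventually_elim (use False in \<open>auto simp: indicator_def\<close>)
      then show ?thesis by (rule integral_eq_zero_AE)
    qed
    ultimately show ?thesis by simp
  qed
  obtain D' where D'm: "D' \<in> borel_measurable lborel" and D': "AE s in lborel. D s = D' s"
    using completion_ex_borel_measurable_real[of D lborel] DI by auto
  have D'leb: "AE s in lebesgue. D s = D' s" by (rule AE_completion[OF D'])
  have D'm2: "D' \<in> borel_measurable lebesgue" using D'm by (rule measurable_completion)
  have D'I: "integrable lborel D'"
  proof -
    have "integrable lebesgue D'" using integrable_cong_AE[OF _ D'm2 D'leb] DI by auto
    then show ?thesis using integrable_completion[OF D'm] by simp
  qed
  have "AE s in lborel. D' s = 0"
  proof (rule density_unique_real[OF D'I])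
    show "integrable lborel (\<lambda>s. 0::real)" by simp
    fix A :: "real set" assume "A \<in> sets lborel"
    then have "A \<in> sets borel" by simp
    then have "(LINT s:A|lborel. D' s) = 0"
    proof (induction rule: borel_set_induct)
      case empty
      then show ?case by (simp add: set_lebesgue_integral_def)
    next
      case (interval a b)
      have m: "(\<lambda>s. indicator {a..b} s * D' s) \<in> borel_measurable lborel"
        using D'm by (intro borel_measurable_times borel_measurable_indicator) auto
      have "(LINT s:{a..b}|lborel. D' s) = (LINT s|lborel. indicator {a..b} s * D' s)"
        by (simp add: set_lebesgue_integral_def)
      also have "\<dots> = (LINT s|lebesgue. indicator {a..b} s * D' s)"
        by (rule integral_completion[OF m, symmetric])
      also have "\<dots> = (LINT s|lebesgue. indicator {a..b} s * D s)"
      proof (rule integral_cong_AE)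
        show "(\<lambda>s. indicator {a..b} s * D' s) \<in> borel_measurable lebesgue" using m by (rule measurable_completion)
        show "(\<lambda>s. indicator {a..b} s * D s) \<in> borel_measurable lebesgue"
          using DI by (intro borel_measurable_times borel_measurable_indicator) auto
        show "AE s in lebesgue. indicator {a..b} s * D' s = indicator {a..b} s * D s" using D'leb by eventually_elim simp
      qed
      also have "\<dots> = 0" by (rule int[OF interval])
      finally show ?case .
    next
      case (compl A)
      have "(LINT s|lborel. D' s) = (LINT s:A|lborel. D' s) + (LINT s:-A|lborel. D' s)"
      proof -
        have "(LINT s:(A \<union> -A)|lborel. D' s) = (LINT s:A|lborel. D' s) + (LINT s:-A|lborel. D' s)"
          by (rule set_integral_Un) (use compl D'I in \<open>auto simp: set_integrable_def intro!: integrable_mult_indicator[where 'b=real, simplified]\<close>)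
        then show ?thesis by (simp add: set_lebesgue_integral_def)
      qed
      moreover have "(LINT s|lborel. D' s) = 0"
      proof -
        have "(LINT s|lborel. D' s) = (LINT s|lebesgue. D' s)" by (rule integral_completion[OF D'm, symmetric])
        also have "\<dots> = (LINT s|lebesgue. D s)"
          by (rule integral_cong_AE) (use D'm2 DI D'leb in \<open>auto elim: eventually_mono\<close>)
        finally show ?thesis using tot by simp
      qed
      ultimately show ?case using compl by simp
    next
      case (union f)
      have "(LINT s:(\<Union>i. f i)|lborel. D' s) = (\<Sum>i. LINT s:f i|lborel. D' s)"
      proof (rule lebesgue_integral_countable_add)
        show "f i \<inter> f j = {}" if "i \<noteq> j" for i j using union(1) that by (auto simp: disjoint_family_on_def)
        have "(\<Union>i. f i) \<in> sets borel" using union(2) by auto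
        then show "set_integrable lborel (\<Union>i. f i) D'"
          unfolding set_integrable_def using integrable_mult_indicator[of "\<Union>i. f i" lborel D'] D'I by simp
      qed (use union in auto)
      then show ?case using union by simp
    qed
    then show "(LINT s:A|lborel. D' s) = (LINT s:A|lborel. 0)" by (simp add: set_lebesgue_integral_def)
  qed
  then have "AE s in lebesgue. D' s = 0" by (rule AE_completion)
  with D'leb show ?thesis by eventually_elim (auto simp: D_def indicator_def)
qed

text \<open>
  Consequently the choice made by \<open>weak_deriv\<close> does not matter, and for smooth functions the Sobolev norm can be
  computed from classical derivatives.
\<close>
lemma is_weak_deriv_unique_norm:
  assumes L: "L > 0" and g1: "is_weak_deriv L j f g1" and g2: "is_weak_deriv L j f g2"
  shows "(LINT s:{0..L}|lebesgue. (g1 s)\<^sup>2) = (LINT s:{0..L}|lebesgue. (g2 s)\<^sup>2)"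
proof -
  have m: "g1 \<in> L2_torus L" "g2 \<in> L2_torus L" using g1 g2 by (auto simp: is_weak_deriv_def)
  have ae: "AE s in lebesgue. s \<in> {0..L} \<longrightarrow> g1 s - g2 s = 0"
  proof (rule L2_torus_orthogonal_smooth_zero[OF L])
    show "set_integrable lebesgue {0..L} (\<lambda>s. g1 s - g2 s)"
      by (intro set_integral_diff L2_torus_set_integrable m)
    fix \<phi> assume \<phi>: "\<phi> \<in> smooth_torus L"
    note i = L2_torus_mult_smooth_integrable[OF m(1) \<phi>] L2_torus_mult_smooth_integrable[OF m(2) \<phi>]
    have "(LINT s:{0..L}|lebesgue. f s * (deriv ^^ j) \<phi> s) = (-1) ^ j * (LINT s:{0..L}|lebesgue. g1 s * \<phi> s)"
      using g1 \<phi> unfolding is_weak_deriv_def by blast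
    moreover have "(LINT s:{0..L}|lebesgue. f s * (deriv ^^ j) \<phi> s) = (-1) ^ j * (LINT s:{0..L}|lebesgue. g2 s * \<phi> s)"
      using g2 \<phi> unfolding is_weak_deriv_def by blast
    ultimately have "(-1) ^ j * (LINT s:{0..L}|lebesgue. g1 s * \<phi> s) = (-1) ^ j * (LINT s:{0..L}|lebesgue. g2 s * \<phi> s)"
      by (rule trans[OF sym])
    then have "(LINT s:{0..L}|lebesgue. g1 s * \<phi> s) = (LINT s:{0..L}|lebesgue. g2 s * \<phi> s)" by simp
    then show "(LINT s:{0..L}|lebesgue. (g1 s - g2 s) * \<phi> s) = 0"
      using set_integral_diff(2)[OF i] by (simp add: left_diff_distrib)
  qed
  show ?thesis
    by (rule set_lebesgue_integral_cong_AE)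
       (use m ae in \<open>auto simp: L2_torus_def elim!: eventually_mono\<close>)
qed

lemma hnorm_le:
  assumes L: "L > 0" and f: "f \<in> smooth_torus L"
    and K: "\<And>j s. j \<le> m \<Longrightarrow> s \<in> {0..L} \<Longrightarrow> \<bar>(deriv ^^ j) f s\<bar> \<le> K"
  shows "hnorm L m f \<le> K * sqrt (real (m + 1) * L)"
proof -
  have K0: "K \<ge> 0" using K[of 0 0] L by (smt (verit) abs_ge_zero atLeastAtMost_iff le0)
  have "(LINT s:{0..L}|lebesgue. (weak_deriv L j f s)\<^sup>2) \<le> K\<^sup>2 * L" if j: "j \<le> m" for j
  proof -
    have "is_weak_deriv L j f (weak_deriv L j f)"
      unfolding weak_deriv_def by (rule someI[of _ "(deriv ^^ j) f"]) (rule smooth_torus_is_weak_deriv[OF L f])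
    then have "(LINT s:{0..L}|lebesgue. (weak_deriv L j f s)\<^sup>2) = (LINT s:{0..L}|lebesgue. ((deriv ^^ j) f s)\<^sup>2)"
      using is_weak_deriv_unique_norm[OF L] smooth_torus_is_weak_deriv[OF L f] by blast
    also have "\<dots> \<le> (LINT s:{0..L}|lebesgue. K\<^sup>2)"
    proof (rule set_integral_mono)
      show "set_integrable lebesgue {0..L} (\<lambda>s. ((deriv ^^ j) f s)\<^sup>2)"
        using smooth_torus_L2[OF smooth_torus_higher_deriv[OF f]] by (simp add: L2_torus_def)
      show "set_integrable lebesgue {0..L} (\<lambda>s. K\<^sup>2)"
        by (rule absolutely_integrable_continuous_real) auto
      show "((deriv ^^ j) f s)\<^sup>2 \<le> K\<^sup>2" if "s \<in> {0..L}" for s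
        using K[OF j that] by (simp add: abs_le_square_iff[symmetric] K0)
    qed
    also have "\<dots> = K\<^sup>2 * L" using L by (simp add: set_lebesgue_integral_def)
    finally show ?thesis .
  qed
  then have "(\<Sum>j\<le>m. LINT s:{0..L}|lebesgue. (weak_deriv L j f s)\<^sup>2) \<le> (\<Sum>j\<le>m. K\<^sup>2 * L)"
    by (intro sum_mono) auto
  also have "\<dots> = K\<^sup>2 * (real (m + 1) * L)" by simp
  finally have "hnorm L m f \<le> sqrt (K\<^sup>2 * (real (m + 1) * L))" by (simp add: hnorm_def)
  then show ?thesis using K0 by (simp add: real_sqrt_mult)
qed

lemma hnorm_nonneg: "hnorm L m f \<ge> 0"
  unfolding hnorm_def set_lebesgue_integral_def by (intro real_sqrt_ge_zero sum_nonneg Bochner_Integration.integral_nonneg) auto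

lemma hnorm3_nonneg: "hnorm3 L m f \<ge> 0"
  unfolding hnorm3_def by (intro real_sqrt_ge_zero sum_nonneg) auto

lemma hnorm3_le:
  fixes y :: "real \<Rightarrow> real^3"
  assumes "\<And>i. hnorm L m (\<lambda>s. y s $ i) \<le> H"
  shows "hnorm3 L m y \<le> 2 * H"
proof -
  have H0: "H \<ge> 0" using assms[of 1] hnorm_nonneg order_trans by blast
  have "(\<Sum>i\<in>UNIV. (hnorm L m (\<lambda>s. y s $ i))\<^sup>2) \<le> (\<Sum>i\<in>(UNIV::3 set). H\<^sup>2)"
    by (intro sum_mono power_mono assms hnorm_nonneg)
  also have "\<dots> = 3 * H\<^sup>2" by simp
  also have "\<dots> \<le> (2 * H)\<^sup>2" by (simp add: power_mult_distrib)
  finally have "hnorm3 L m y \<le> sqrt ((2 * H)\<^sup>2)" unfolding hnorm3_def by (rule real_sqrt_le_mono)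
  then show ?thesis using H0 by (simp only: real_sqrt_abs)
qed

text \<open>
  Cauchy's estimates on discs of radius \<open>b / 2\<close>, summed over the derivatives that occur in the norm.
\<close>
definition sobolev_const :: "real \<Rightarrow> nat \<Rightarrow> real \<Rightarrow> real" where
  "sobolev_const L m b = (\<Sum>j\<le>m. fact j / (b / 2) ^ j) * sqrt (real (m + 1) * L)"

text \<open>
  A supremum bound on a strip controls the Sobolev norm on the real axis: no derivative needs to be
  estimated by hand.
\<close>
lemma hnorm_Re_le:
  assumes L: "L > 0" and b: "b > 0" and f: "f holomorphic_on strip b"
    and per: "\<And>s. s \<in> strip b \<Longrightarrow> f (s + of_real L) = f s" and B: "\<And>z. z \<in> strip b \<Longrightarrow> norm (f z) \<le> B"
  shows "hnorm L m (\<lambda>s. Re (f (of_real s))) \<le> B * sobolev_const L m b"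
proof -
  have S: "open (strip b)" "\<And>s. of_real s \<in> strip b" using b by (simp_all add: open_strip of_real_in_strip)
  have B0: "B \<ge> 0" using B[OF S(2)] norm_ge_zero order_trans by blast
  have "hnorm L m (\<lambda>s. Re (f (of_real s))) \<le> (B * (\<Sum>j\<le>m. fact j / (b / 2) ^ j)) * sqrt (real (m + 1) * L)"
  proof (rule hnorm_le[OF L smooth_torus_Re[OF f S]])
    show "f (of_real (s + L)) = f (of_real s)" for s using per[OF S(2)] by simp
    fix j :: nat and s :: real assume j: "j \<le> m"
    have sub: "cball (of_real s) (b/2) \<subseteq> strip b"
    proof
      fix z :: complex assume "z \<in> cball (of_real s) (b/2)"
      then have "\<bar>Im (z - of_real s)\<bar> \<le> b/2" using abs_Im_le_cmod[of "z - of_real s"] by (simp add: dist_norm norm_minus_commute)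
      then show "z \<in> strip b" using b by (simp add: strip_def)
    qed
    have "\<bar>(deriv ^^ j) (\<lambda>s. Re (f (of_real s))) s\<bar> \<le> norm ((deriv ^^ j) f (of_real s))"
      unfolding higher_deriv_Re[OF f S] by (rule abs_Re_le_cmod)
    also have "\<dots> \<le> fact j * B / (b / 2) ^ j"
      by (rule norm_deriv_le_Cauchy[OF f sub]) (use b B sub in auto)
    also have "\<dots> = B * (fact j / (b / 2) ^ j)" by simp
    also have "\<dots> \<le> B * (\<Sum>j\<le>m. fact j / (b / 2) ^ j)"
      by (intro mult_left_mono member_le_sum B0) (use j b in auto)
    finally show "\<bar>(deriv ^^ j) (\<lambda>s. Re (f (of_real s))) s\<bar> \<le> B * (\<Sum>j\<le>m. fact j / (b / 2) ^ j)" .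
  qed
  then show ?thesis by (simp add: sobolev_const_def)
qed

section \<open>Smooth curves from holomorphic families\<close>

lemma holo2_higher_deriv_fst:
  assumes "holo2 A B f" "open A" "open B"
  shows "holo2 A B (\<lambda>x y. (deriv ^^ n) (\<lambda>x. f x y) x)"
  using holo2_deriv_fst[OF _ assms(2,3)] by (induction n) (auto intro: assms)

lemma higher_deriv_fst_periodic:
  assumes f: "holo2 A (strip b) f" and A: "open A"
    and per: "\<And>x s. x \<in> A \<Longrightarrow> s \<in> strip b \<Longrightarrow> f x (s + of_real L) = f x s"
    and x: "x \<in> A" and s: "s \<in> strip b"
  shows "(deriv ^^ n) (\<lambda>x. f x (s + of_real L)) x = (deriv ^^ n) (\<lambda>x. f x s) x"
  by (rule higher_deriv_transform_within_open[OF holo2D(3)[OF f strip_plus_of_real[OF s]] holo2D(3)[OF f s] A x])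
     (simp add: per[OF _ s])

text \<open>
  The strip is not compact, but by periodicity a rectangle suffices.
\<close>
lemma holo2_strip_bound:
  assumes f: "holo2 A (strip b) f" and b: "0 < b'" "b' < b" and K: "compact K" "K \<subseteq> A" and L: "L > 0"
    and per: "\<And>x s. x \<in> A \<Longrightarrow> s \<in> strip b \<Longrightarrow> f x (s + of_real L) = f x s"
  obtains M where "M > 0" "\<And>x s. x \<in> K \<Longrightarrow> s \<in> strip b' \<Longrightarrow> norm (f x s) \<le> M"
proof -
  let ?Q = "cbox (Complex 0 (-b')) (Complex L b')"
  have Q: "?Q \<subseteq> strip b" using b by (auto simp: strip_def in_cbox_complex_iff)
  have "compact ((\<lambda>z. f (fst z) (snd z)) ` (K \<times> ?Q))"
    by (intro compact_continuous_image compact_Times K compact_cbox continuous_on_subset[OF holo2D(1)[OF f]])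
       (use Q K in auto)
  then obtain M where M: "M > 0" "\<And>z. z \<in> K \<times> ?Q \<Longrightarrow> norm (f (fst z) (snd z)) \<le> M"
    using bounded_pos compact_imp_bounded by (metis (no_types, lifting) image_eqI)
  show ?thesis
  proof (rule that[OF M(1)])
    fix x s assume x: "x \<in> K" and s: "s \<in> strip b'"
    obtain n :: int where n: "0 \<le> Re s + of_int n * L" "Re s + of_int n * L \<le> L"
      using reduce_mod_period[OF L] by blast
    have "s \<in> strip b" using s strip_mono[of b' b] b by auto
    then have "f x (s + of_real (of_int n * L)) = f x s"
      using periodic_strip_int[of b "f x" L s n] per x K by blast
    moreover have "s + of_real (of_int n * L) \<in> ?Q"
      using n s by (auto simp: in_cbox_complex_iff strip_def)
    ultimately show "norm (f x s) \<le> M" using M(2)[of "(x, s + of_real (of_int n * L))"] x by simp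
  qed
qed

lemma holo2_difference_quotient_bound:
  assumes f: "holo2 A (strip b) f" and A: "open A" and b: "b > 0" and L: "L > 0" and a: "a \<in> A"
    and per: "\<And>x s. x \<in> A \<Longrightarrow> s \<in> strip b \<Longrightarrow> f x (s + of_real L) = f x s"
  obtains K d where "K > 0" "d > 0" "cball a d \<subseteq> A"
    "\<And>h s. norm h \<le> d \<Longrightarrow> h \<noteq> 0 \<Longrightarrow> s \<in> strip (b/2) \<Longrightarrow> norm ((f (a + h) s - f a s) / h - deriv (\<lambda>x. f x s) a) \<le> K * norm h"
    "\<And>h s. norm h \<le> d \<Longrightarrow> s \<in> strip (b/2) \<Longrightarrow> norm (f (a + h) s - f a s) \<le> K * norm h"
proof -
  obtain e where e: "e > 0" "cball a e \<subseteq> A" using A a open_contains_cball by blast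
  obtain M where M: "M > 0" "\<And>x s. x \<in> cball a e \<Longrightarrow> s \<in> strip (b/2) \<Longrightarrow> norm (f x s) \<le> M"
    using holo2_strip_bound[OF f, of "b/2" "cball a e" L] b e L per by auto
  define d where "d = e/2"
  have d: "d > 0" "cball a (2*d) \<subseteq> A" "cball a d \<subseteq> A" using e by (auto simp: d_def)
  have sb: "s \<in> strip b" if "s \<in> strip (b/2)" for s using that b strip_mono[of "b/2" b] by auto
  show ?thesis
  proof (rule that[of "2 * M / d\<^sup>2 + M / d" d])
    show "2 * M / d\<^sup>2 + M / d > 0" using M d by (simp add: add_pos_pos)
    fix h s :: complex assume h: "norm h \<le> d" and s: "s \<in> strip (b/2)"
    have "norm (f (a + h) s - f a s) \<le> M / d * norm (a + h - a)"
      by (rule norm_diff_le_Cauchy[OF holo2D(3)[OF f sb[OF s]] A d(2,1)])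
         (use M(2)[OF _ s] d h in \<open>auto simp: d_def dist_norm\<close>)
    also have "\<dots> \<le> (2 * M / d\<^sup>2 + M / d) * norm h" using M d by (intro mult_mono) auto
    finally show "norm (f (a + h) s - f a s) \<le> (2 * M / d\<^sup>2 + M / d) * norm h" .
  next
    fix h s :: complex assume h: "norm h \<le> d" "h \<noteq> 0" and s: "s \<in> strip (b/2)"
    have "norm ((f (a + h) s - f a s) / h - deriv (\<lambda>x. f x s) a) \<le> 2 * M / d\<^sup>2 * norm h"
      by (rule difference_quotient_le[OF holo2D(3)[OF f sb[OF s]] A d(2,1) _ h])
         (use M(2)[OF _ s] d in \<open>auto simp: d_def\<close>)
    also have "\<dots> \<le> (2 * M / d\<^sup>2 + M / d) * norm h" using M d by (intro mult_mono) auto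
    finally show "norm ((f (a + h) s - f a s) / h - deriv (\<lambda>x. f x s) a) \<le> (2 * M / d\<^sup>2 + M / d) * norm h" .
  qed (use d in auto)
qed

lemma real_difference_quotient_tendsto:
  assumes f: "f holomorphic_on A" and A: "open A" and l: "of_real l \<in> A"
  shows "((\<lambda>h. 1 / h * (Re (f (of_real (l + h))) - Re (f (of_real l))) - Re (deriv f (of_real l))) \<longlongrightarrow> 0) (at 0)"
proof -
  have "((\<lambda>t. Re (f (of_real t))) has_real_derivative Re (deriv f (of_real l))) (at l)"
    by (rule has_real_derivative_Re[OF f A l])
  then have "((\<lambda>h. (Re (f (of_real (l + h))) - Re (f (of_real l))) / h) \<longlongrightarrow> Re (deriv f (of_real l))) (at 0)"
    by (simp add: has_field_derivative_def has_derivative_at DERIV_def flip: has_field_derivative_def)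
  then show ?thesis by (simp add: LIM_zero_iff)
qed

lemma sobolev3_Re:
  assumes L: "L > 0" and b: "b > 0" and f: "\<And>i. f i holomorphic_on strip b"
    and per: "\<And>i s. s \<in> strip b \<Longrightarrow> f i (s + of_real L) = f i s"
  shows "(\<lambda>s. \<chi> i. Re (f i (of_real s))) \<in> sobolev3 L m"
proof -
  have "(\<lambda>s. Re (f i (of_real s))) \<in> smooth_torus L" for i
    by (rule smooth_torus_Re[OF f open_strip of_real_in_strip[OF b]]) (use per of_real_in_strip[OF b] in simp)
  then show ?thesis using smooth_torus_sobolev[OF L] by (simp add: sobolev3_def)
qed

text \<open>
  The derivatives of the curve are the complex derivatives with respect to the parameter.  Their difference quotients
  converge uniformly on a strip around the real axis, hence in the Sobolev norm.
\<close>
theorem smooth_curve_on_holo2: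
  fixes Y :: "3 \<Rightarrow> complex \<Rightarrow> complex \<Rightarrow> complex"
  assumes L: "L > 0" and b: "b > 0"
    and om: "om holomorphic_on ball 0 r" and c: "c holomorphic_on ball 0 r" and V: "V holomorphic_on ball 0 r"
    and Y: "\<And>i. holo2 (ball 0 r) (strip b) (Y i)"
    and per: "\<And>i x s. x \<in> ball 0 r \<Longrightarrow> s \<in> strip b \<Longrightarrow> Y i x (s + of_real L) = Y i x s"
  shows "smooth_curve_on L {-r<..<r} (\<lambda>l. (Re (om (of_real l)), (\<lambda>s. \<chi> i. Re (Y i (of_real l) (of_real s))), Re (c (of_real l)), Re (V (of_real l))))"
proof -
  define Dy where "Dy = (\<lambda>n i x s. (deriv ^^ n) (\<lambda>x. Y i x s) x)"
  define D where "D = (\<lambda>n l. (Re ((deriv ^^ n) om (of_real l)), (\<lambda>s. \<chi> i. Re (Dy n i (of_real l) (of_real s))),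
      Re ((deriv ^^ n) c (of_real l)), Re ((deriv ^^ n) V (of_real l))))"
  have Dyh: "holo2 (ball 0 r) (strip b) (Dy n i)" for n i
    unfolding Dy_def by (rule holo2_higher_deriv_fst[OF Y open_ball open_strip])
  have Dyper: "Dy n i x (s + of_real L) = Dy n i x s" if "x \<in> ball 0 r" "s \<in> strip b" for n i x s
    unfolding Dy_def by (rule higher_deriv_fst_periodic[OF Y open_ball per that])
  have DySuc: "Dy (Suc n) i x s = deriv (\<lambda>x. Dy n i x s) x" for n i x s by (simp add: Dy_def)
  have lb: "complex_of_real l \<in> ball 0 r" if "l \<in> {-r<..<r}" for l using that by auto
  show ?thesis
    unfolding smooth_curve_on_def
  proof (intro exI[of _ D] conjI ballI allI)
    show "D 0 l = (Re (om (of_real l)), (\<lambda>s. \<chi> i. Re (Y i (of_real l) (of_real s))), Re (c (of_real l)), Re (V (of_real l)))" for l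
      by (simp add: D_def Dy_def)
    fix n l assume l: "l \<in> {-r<..<r}"
    have "(\<lambda>s. \<chi> i. Re (Dy n i (of_real l) (of_real s))) \<in> sobolev3 L 4"
      by (rule sobolev3_Re[OF L b holo2D(2)[OF Dyh lb[OF l]]]) (use Dyper[OF lb[OF l]] in auto)
    then show "D n l \<in> screw_param_space L" by (simp add: D_def screw_param_space_def)
    have bd: "\<exists>K d. K > 0 \<and> d > 0 \<and> cball (complex_of_real l) d \<subseteq> ball 0 r \<and> (\<forall>h s. norm h \<le> d \<longrightarrow> h \<noteq> 0 \<longrightarrow> s \<in> strip (b/2) \<longrightarrow>
        norm ((Dy n i (of_real l + h) s - Dy n i (of_real l) s) / h - Dy (Suc n) i (of_real l) s) \<le> K * norm h)" for i
      using holo2_difference_quotient_bound[OF Dyh open_ball b L lb[OF l] Dyper, of n i] unfolding DySuc by metis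
    then obtain K d where Kd: "\<And>i. K i > 0" "\<And>i. d i > 0" "\<And>i. cball (complex_of_real l) (d i) \<subseteq> ball 0 r"
       and Kb: "\<And>i h s. norm h \<le> d i \<Longrightarrow> h \<noteq> 0 \<Longrightarrow> s \<in> strip (b/2) \<Longrightarrow>
        norm ((Dy n i (of_real l + h) s - Dy n i (of_real l) s) / h - Dy (Suc n) i (of_real l) s) \<le> K i * norm h"
      by metis
    define d0 where "d0 = Min (range d)"
    define K0 where "K0 = Max (range K)"
    have d0: "d0 > 0" "d0 \<le> d i" for i using Kd by (auto simp: d0_def)
    have K0: "K i \<le> K0" for i by (simp add: K0_def)
    define w where "w = (\<lambda>h s. (1/h) *\<^sub>R ((\<chi> i. Re (Dy n i (of_real (l+h)) (of_real s))) - (\<chi> i. Re (Dy n i (of_real l) (of_real s)))) - (\<chi> i. Re (Dy (Suc n) i (of_real l) (of_real s))) :: real^3)"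
    have est: "hnorm3 L 4 (w h) \<le> 2 * ((K0 * \<bar>h\<bar>) * sobolev_const L 4 (b/2))" if h: "h \<noteq> 0" "\<bar>h\<bar> \<le> d0" for h
    proof (rule hnorm3_le)
      fix i
      let ?f = "\<lambda>s. (Dy n i (of_real l + of_real h) s - Dy n i (of_real l) s) / of_real h - Dy (Suc n) i (of_real l) s"
      have lh: "complex_of_real l + of_real h \<in> ball 0 r"
      proof -
        have "complex_of_real l + of_real h \<in> cball (of_real l) (d i)" using h d0(2)[of i] by (simp add: dist_norm)
        then show ?thesis using Kd(3)[of i] by blast
      qed
      have sb: "strip (b/2) \<subseteq> strip b" using b by (simp add: strip_mono)
      have eq: "(\<lambda>s. w h s $ i) = (\<lambda>s. Re (?f (of_real s)))"
        using h(1) by (auto simp: w_def fun_eq_iff)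
      show "hnorm L 4 (\<lambda>s. w h s $ i) \<le> (K0 * \<bar>h\<bar>) * sobolev_const L 4 (b/2)"
        unfolding eq
      proof (rule hnorm_Re_le[OF L])
        have "Dy n i (of_real l + of_real h) holomorphic_on strip (b/2)" "Dy n i (of_real l) holomorphic_on strip (b/2)"
          "Dy (Suc n) i (of_real l) holomorphic_on strip (b/2)"
          using holo2D(2)[OF Dyh] lh lb[OF l] sb holomorphic_on_subset by blast+
        then show "?f holomorphic_on strip (b/2)" using h(1) by (intro holomorphic_intros) auto
        fix s assume s: "s \<in> strip (b/2)"
        then have sb': "s \<in> strip b" using sb by auto
        show "?f (s + of_real L) = ?f s" by (simp add: Dyper[OF lh sb'] Dyper[OF lb[OF l] sb'])
        have "norm (?f s) \<le> K i * norm (complex_of_real h)"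
          by (rule Kb) (use h d0(2)[of i] s in auto)
        also have "\<dots> \<le> K0 * \<bar>h\<bar>" using K0[of i] by (simp add: mult_right_mono)
        finally show "norm (?f s) \<le> K0 * \<bar>h\<bar>" .
      qed (use b in auto)
    qed
    have t1: "((\<lambda>h. hnorm3 L 4 (w h)) \<longlongrightarrow> 0) (at 0)"
    proof (rule Lim_null_comparison)
      have "eventually (\<lambda>h. h \<noteq> 0 \<and> \<bar>h\<bar> \<le> d0) (at 0)"
        unfolding eventually_at using d0(1) by (auto intro!: exI[of _ d0] simp: dist_norm)
      then show "eventually (\<lambda>h. norm (hnorm3 L 4 (w h)) \<le> 2 * ((K0 * \<bar>h\<bar>) * sobolev_const L 4 (b/2))) (at 0)"
        by eventually_elim (use est hnorm3_nonneg in auto)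
      show "((\<lambda>h. 2 * ((K0 * \<bar>h\<bar>) * sobolev_const L 4 (b/2))) \<longlongrightarrow> 0) (at 0)"
        by (auto intro!: tendsto_eq_intros)
    qed
    have hol: "(deriv ^^ n) om holomorphic_on ball 0 r" "(deriv ^^ n) c holomorphic_on ball 0 r" "(deriv ^^ n) V holomorphic_on ball 0 r"
      using om c V by (simp_all add: holomorphic_higher_deriv)
    note t2 = real_difference_quotient_tendsto[OF hol(1) open_ball lb[OF l]]
      real_difference_quotient_tendsto[OF hol(2) open_ball lb[OF l]]
      real_difference_quotient_tendsto[OF hol(3) open_ball lb[OF l]]
    have nrm: "screw_param_norm L (screw_param_scale (1 / h) (D n (l + h) - D n l) - D (Suc n) l) =
      sqrt ((1 / h * (Re ((deriv ^^ n) om (of_real (l + h))) - Re ((deriv ^^ n) om (of_real l))) - Re (deriv ((deriv ^^ n) om) (of_real l)))\<^sup>2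
        + (hnorm3 L 4 (w h))\<^sup>2
        + (1 / h * (Re ((deriv ^^ n) c (of_real (l + h))) - Re ((deriv ^^ n) c (of_real l))) - Re (deriv ((deriv ^^ n) c) (of_real l)))\<^sup>2
        + (1 / h * (Re ((deriv ^^ n) V (of_real (l + h))) - Re ((deriv ^^ n) V (of_real l))) - Re (deriv ((deriv ^^ n) V) (of_real l)))\<^sup>2)" for h
      unfolding D_def w_def by (simp add: fun_diff_def)
    show "has_curve_derivative L (D n) (D (Suc n) l) l"
      unfolding has_curve_derivative_def nrm
      by (rule tendsto_eq_rhs[OF tendsto_real_sqrt[OF tendsto_add[OF tendsto_add[OF tendsto_add[OF tendsto_power[OF t2(1)] tendsto_power[OF t1]] tendsto_power[OF t2(2)]] tendsto_power[OF t2(3)]]]]) simp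
  qed
qed

section \<open>Screw motions from axial profiles\<close>

definition vec3 :: "real \<Rightarrow> real \<Rightarrow> real \<Rightarrow> real^3" where
  "vec3 a b c = vector [a, b, c]"

lemma vec3_nth: "vec3 a b c $ 1 = a" "vec3 a b c $ 2 = b" "vec3 a b c $ 3 = c"
  by (simp_all add: vec3_def)

lemma vec3_eq: "vec3 a b c = a *\<^sub>R axis 1 1 + b *\<^sub>R axis 2 1 + c *\<^sub>R axis 3 1"
  by (simp add: vec_eq_iff forall_3 vec3_nth axis_def)

lemma has_vector_derivative_vec3:
  assumes "(a has_real_derivative a') (at s)" "(b has_real_derivative b') (at s)" "(c has_real_derivative c') (at s)"
  shows "((\<lambda>s. vec3 (a s) (b s) (c s)) has_vector_derivative vec3 a' b' c') (at s)"
  unfolding vec3_eq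
  by (intro has_vector_derivative_add bounded_linear.has_vector_derivative[OF bounded_linear_scaleR_left]
        assms[unfolded has_real_derivative_iff_has_vector_derivative])

lemma norm_vec3: "norm (vec3 a b c) = sqrt (a\<^sup>2 + b\<^sup>2 + c\<^sup>2)"
  by (simp add: norm_vec_def L2_set_def sum_3 vec3_nth)

lemma cross3_vec3: "cross3 (vec3 a b c) (vec3 a' b' c') = vec3 (b * c' - c * b') (c * a' - a * c') (a * b' - b * a')"
  by (simp add: cross3_def vec3_def)

lemma rot_z_vec3: "rot_z t *v vec3 a b c = vec3 (cos t * a - sin t * b) (sin t * a + cos t * b) c"
  by (simp add: rot_z_def matrix_vector_mult_def vec_eq_iff forall_3 sum_3 vec3_nth)

lemma screw_motion_vec3:
  "screw_motion (Om, \<lambda>s. vec3 (a s) (b s) (d s), c, V) s t =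
     vec3 (cos (Om * t) * a (s + c * t) - sin (Om * t) * b (s + c * t))
          (sin (Om * t) * a (s + c * t) + cos (Om * t) * b (s + c * t)) (d (s + c * t) + V * t)"
  by (simp add: rot_z_vec3) (simp add: vec_eq_iff forall_3 vec3_nth axis_def)

lemma rotated_wedge:
  fixes C S a b c d :: real
  shows "(C * a - S * b) * (S * c + C * d) - (S * a + C * b) * (C * c - S * d) = (C * C + S * S) * (a * d - b * c)"
  by (simp add: algebra_simps)

lemma rotated_square:
  fixes C S a b :: real
  shows "(a * C - b * S)\<^sup>2 + (a * S + b * C)\<^sup>2 = (a\<^sup>2 + b\<^sup>2) * (C * C + S * S)"
  by (simp add: algebra_simps power2_eq_square)

text \<open>
  A rotation about the axis commutes with the cross product, so the equation reduces to the moving frame,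
  where it is the stationary equation for the profile.
\<close>
lemma solves_LIE_screw_motion:
  assumes a: "\<And>s. (a has_real_derivative a1 s) (at s)" "\<And>s. (a1 has_real_derivative a2 s) (at s)"
    and b: "\<And>s. (b has_real_derivative b1 s) (at s)" "\<And>s. (b1 has_real_derivative b2 s) (at s)"
    and d: "\<And>s. (d has_real_derivative d1 s) (at s)" "\<And>s. (d1 has_real_derivative d2 s) (at s)"
    and e1: "\<And>s. b1 s * d2 s - d1 s * b2 s = - Om * b s + c * a1 s"
    and e2: "\<And>s. d1 s * a2 s - a1 s * d2 s = Om * a s + c * b1 s"
    and e3: "\<And>s. a1 s * b2 s - b1 s * a2 s = V + c * d1 s"
    and per: "\<And>s. a (s + L) = a s" "\<And>s. b (s + L) = b s" "\<And>s. d (s + L) = d s"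
  shows "solves_LIE L (screw_motion (Om, \<lambda>s. vec3 (a s) (b s) (d s), c, V))"
proof -
  let ?x = "screw_motion (Om, \<lambda>s. vec3 (a s) (b s) (d s), c, V)"
  define rot where "rot = (\<lambda>t p q w. vec3 (cos (Om * t) * p - sin (Om * t) * q) (sin (Om * t) * p + cos (Om * t) * q) w)"
  have x: "?x = (\<lambda>s t. rot t (a (s + c * t)) (b (s + c * t)) (d (s + c * t) + V * t))"
    unfolding screw_motion_vec3 rot_def by (intro ext) simp
  define xs where "xs = (\<lambda>s t. rot t (a1 (s + c * t)) (b1 (s + c * t)) (d1 (s + c * t)))"
  define xss where "xss = (\<lambda>s t. rot t (a2 (s + c * t)) (b2 (s + c * t)) (d2 (s + c * t)))"
  define xt where "xt = (\<lambda>s t. rot t (- Om * b (s + c * t) + c * a1 (s + c * t)) (Om * a (s + c * t) + c * b1 (s + c * t)) (V + c * d1 (s + c * t)))"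
  have sh: "((\<lambda>s. f (s + k)) has_real_derivative f' (s + k)) (at s)" if "\<And>s. (f has_real_derivative f' s) (at s)" for f f' k s
    using that[of "s + k"] by (simp only: DERIV_shift)
  have sht: "((\<lambda>t. f (s + c * t)) has_real_derivative c * f' (s + c * t)) (at t)" if "\<And>s. (f has_real_derivative f' s) (at s)" for f f' s t
    by (rule DERIV_chain2[of f "f' (s + c * t)" "\<lambda>t. s + c * t" t c, OF that, THEN DERIV_cong]) (auto intro!: derivative_eq_intros)
  have rotd: "((\<lambda>t. rot t (f1 t) (f2 t) (f3 t)) has_vector_derivative rot t (- Om * f2 t + D1) (Om * f1 t + D2) D3) (at t)"
    if "(f1 has_real_derivative D1) (at t)" "(f2 has_real_derivative D2) (at t)" "(f3 has_real_derivative D3) (at t)"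
    for f1 f2 f3 D1 D2 D3 t
    unfolding rot_def
    by (rule has_vector_derivative_vec3) (auto intro!: derivative_eq_intros that simp: algebra_simps)
  show ?thesis
    unfolding solves_LIE_def
  proof (rule conjI, intro allI impI)
    fix s t
    have "s + L + c * t = (s + c * t) + L" by simp
    then show "?x (s + L) t = ?x s t" unfolding x by (simp only: per)
  next
    note sh' = sh[OF a(1)] sh[OF a(2)] sh[OF b(1)] sh[OF b(2)] sh[OF d(1)] sh[OF d(2)]
    have "((\<lambda>\<sigma>. ?x \<sigma> t) has_vector_derivative xs s t) (at s) \<and> ((\<lambda>\<sigma>. xs \<sigma> t) has_vector_derivative xss s t) (at s) \<and>
        ((\<lambda>\<tau>. ?x s \<tau>) has_vector_derivative xt s t) (at t) \<and> xt s t = cross3 (xs s t) (xss s t)" for s t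
    proof (intro conjI)
    show "((\<lambda>\<sigma>. ?x \<sigma> t) has_vector_derivative xs s t) (at s)"
      unfolding x xs_def rot_def
      by (rule has_vector_derivative_vec3) (auto intro!: derivative_eq_intros sh')
    show "((\<lambda>\<sigma>. xs \<sigma> t) has_vector_derivative xss s t) (at s)"
      unfolding xss_def xs_def rot_def
      by (rule has_vector_derivative_vec3) (auto intro!: derivative_eq_intros sh')
    show "((\<lambda>\<tau>. ?x s \<tau>) has_vector_derivative xt s t) (at t)"
      unfolding x xt_def
    proof (rule rotd[OF sht[OF a(1)] sht[OF b(1)]])
      show "((\<lambda>t. d (s + c * t) + V * t) has_real_derivative V + c * d1 (s + c * t)) (at t)"
        by (rule DERIV_cong[OF DERIV_add[OF sht[OF d(1)] DERIV_cmult[OF DERIV_ident]]]) simp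
    qed
    show "xt s t = cross3 (xs s t) (xss s t)"
    proof -
      let ?u = "s + c * t"
      have cs: "cos (Om * t) * cos (Om * t) + sin (Om * t) * sin (Om * t) = 1"
        using sin_cos_squared_add2[of "Om * t"] by (simp add: power2_eq_square)
      have "(sin (Om * t) * a1 ?u + cos (Om * t) * b1 ?u) * d2 ?u - d1 ?u * (sin (Om * t) * a2 ?u + cos (Om * t) * b2 ?u)
          = cos (Om * t) * (b1 ?u * d2 ?u - d1 ?u * b2 ?u) - sin (Om * t) * (d1 ?u * a2 ?u - a1 ?u * d2 ?u)"
        by (simp add: algebra_simps)
      moreover have "d1 ?u * (cos (Om * t) * a2 ?u - sin (Om * t) * b2 ?u) - (cos (Om * t) * a1 ?u - sin (Om * t) * b1 ?u) * d2 ?u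
          = sin (Om * t) * (b1 ?u * d2 ?u - d1 ?u * b2 ?u) + cos (Om * t) * (d1 ?u * a2 ?u - a1 ?u * d2 ?u)"
        by (simp add: algebra_simps)
      moreover have "(cos (Om * t) * a1 ?u - sin (Om * t) * b1 ?u) * (sin (Om * t) * a2 ?u + cos (Om * t) * b2 ?u) -
          (sin (Om * t) * a1 ?u + cos (Om * t) * b1 ?u) * (cos (Om * t) * a2 ?u - sin (Om * t) * b2 ?u)
          = (cos (Om * t) * cos (Om * t) + sin (Om * t) * sin (Om * t)) * (a1 ?u * b2 ?u - b1 ?u * a2 ?u)"
        by (rule rotated_wedge)
      ultimately show ?thesis
        unfolding xt_def xs_def xss_def rot_def cross3_vec3 by (simp only: cs e1 e2 e3 mult_1)
    qed
  qed
  note all = this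
  show "\<exists>xs xss xt. \<forall>s. \<forall>t>0. ((\<lambda>\<sigma>. ?x \<sigma> t) has_vector_derivative xs s t) (at s) \<and>
      ((\<lambda>\<sigma>. xs \<sigma> t) has_vector_derivative xss s t) (at s) \<and>
      ((\<lambda>\<tau>. ?x s \<tau>) has_vector_derivative xt s t) (at t) \<and> xt s t = cross3 (xs s t) (xss s t)"
    by (rule exI[of _ xs], rule exI[of _ xss], rule exI[of _ xt], intro allI impI, rule all)
  qed
qed

text \<open>
  In the frame turning with the angle \<open>th\<close>, velocity and acceleration have components \<open>(r1, B1, p)\<close> and \<open>(A2, B2, p')\<close>.
  Unit speed is the energy equation, and the facts \<open>F4\<close>, \<open>F5\<close> are the equation of motion
  \<open>y'' = (V e3 + \<Omega> e3 \<times> y) \<times> y'\<close>; the stationary equation is its cross product with \<open>y'\<close>.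
\<close>
lemma screw_motion_from_axial_profile:
  assumes Om: "Om > 0" and L: "\<And>s. p (s + L) = p s" "\<And>s. z (s + L) = z s" "\<And>s. cos (th (s + L)) = cos (th s)" "\<And>s. sin (th (s + L)) = sin (th s)"
    and dp: "\<And>s. (p has_real_derivative p' s) (at s)" "\<And>s. (p' has_real_derivative p'' s) (at s)"
    and energy: "\<And>s. (p' s)\<^sup>2 = 2 * Om * (A - p s) * (1 - (p s)\<^sup>2) - (c + V * p s)\<^sup>2"
    and acc: "\<And>s. p'' s = - Om * (1 - (p s)\<^sup>2) - 2 * Om * p s * (A - p s) - V * (c + V * p s)"
    and pos: "\<And>s. A - p s > 0"
    and dth: "\<And>s. (th has_real_derivative - (c + V * p s) / (2 * (A - p s))) (at s)"
    and dz: "\<And>s. (z has_real_derivative p s) (at s)"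
    and y: "y = (\<lambda>s. vec3 (sqrt (2 * (A - p s) / Om) * cos (th s)) (sqrt (2 * (A - p s) / Om) * sin (th s)) (z s))"
  shows "(\<forall>s. y differentiable (at s) \<and> norm (vector_derivative y (at s)) = 1) \<and> solves_LIE L (screw_motion (Om, y, c, V))"
proof -
  define r where "r = (\<lambda>s. sqrt (2 * (A - p s) / Om))"
  define w where "w = (\<lambda>s. - (c + V * p s) / (2 * (A - p s)))"
  have r0: "r s > 0" and r2: "r s * r s = 2 * (A - p s) / Om" for s
    using pos[of s] Om by (simp_all add: r_def)
  have A0: "A - p s \<noteq> 0" for s using pos[of s] by simp
  define r1 where "r1 = (\<lambda>s. - p' s / (Om * r s))"
  define r11 where "r11 = (\<lambda>s. - p'' s / (Om * r s) + p' s * r1 s / (Om * (r s * r s)))"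
  define w1 where "w1 = (\<lambda>s. - p' s * (V * (A - p s) + c + V * p s) / (2 * (A - p s)\<^sup>2))"
  have dr: "(r has_real_derivative r1 s) (at s)" for s
  proof -
    have "(r has_real_derivative inverse (sqrt (2 * (A - p s) / Om)) / 2 * (- 2 * p' s / Om)) (at s)"
      unfolding r_def
    proof (rule DERIV_chain2[OF DERIV_real_sqrt])
      show "((\<lambda>s. 2 * (A - p s) / Om) has_real_derivative - 2 * p' s / Om) (at s)"
        using Om by (auto intro!: derivative_eq_intros dp)
    qed (use pos[of s] Om in simp)
    moreover have "inverse (sqrt (2 * (A - p s) / Om)) / 2 * (- 2 * p' s / Om) = r1 s"
    proof -
      have "sqrt (2 * (A - p s) / Om) = r s" by (simp add: r_def)
      then show ?thesis unfolding r1_def using r0[of s] Om by (simp only:) (simp add: field_simps)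
    qed
    ultimately show ?thesis by simp
  qed
  have dr1: "(r1 has_real_derivative r11 s) (at s)" for s
  proof -
    have "((\<lambda>s. - p' s / (Om * r s)) has_real_derivative (- p'' s * (Om * r s) - (- p' s) * (Om * r1 s)) / ((Om * r s) * (Om * r s))) (at s)"
      by (rule DERIV_divide[OF DERIV_minus[OF dp(2)] DERIV_cmult[OF dr]]) (use r0[of s] Om in simp)
    moreover have "(\<lambda>s. - p' s / (Om * r s)) = r1" by (simp add: r1_def)
    moreover have "(- p'' s * (Om * r s) - (- p' s) * (Om * r1 s)) / ((Om * r s) * (Om * r s)) = r11 s"
      unfolding r11_def using r0[of s] Om by (simp add: field_simps)
    ultimately show ?thesis by simp
  qed
  have dth': "(th has_real_derivative w s) (at s)" for s unfolding w_def by (rule dth)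
  have dw: "(w has_real_derivative w1 s) (at s)" for s
  proof -
    have "((\<lambda>s. - (c + V * p s) / (2 * (A - p s))) has_real_derivative (- (V * p' s) * (2 * (A - p s)) - (- (c + V * p s)) * (2 * (- p' s))) / ((2 * (A - p s)) * (2 * (A - p s)))) (at s)"
    proof (rule DERIV_divide)
      show "((\<lambda>s. - (c + V * p s)) has_real_derivative - (V * p' s)) (at s)" "((\<lambda>s. 2 * (A - p s)) has_real_derivative 2 * (- p' s)) (at s)"
        by (auto intro!: derivative_eq_intros dp)
    qed (use A0[of s] in simp)
    moreover have "(\<lambda>s. - (c + V * p s) / (2 * (A - p s))) = w" by (simp add: w_def)
    moreover have "(- (V * p' s) * (2 * (A - p s)) - (- (c + V * p s)) * (2 * (- p' s))) / ((2 * (A - p s)) * (2 * (A - p s))) = w1 s"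
      unfolding w1_def using A0[of s] by (simp add: divide_simps) (simp add: algebra_simps power2_eq_square)
    ultimately show ?thesis by simp
  qed
  \<comment> \<open>velocity and acceleration in the rotating frame\<close>
  define B1 where "B1 = (\<lambda>s. r s * w s)"
  define A2 where "A2 = (\<lambda>s. r11 s - r s * (w s)\<^sup>2)"
  define B2 where "B2 = (\<lambda>s. 2 * r1 s * w s + r s * w1 s)"
  have F1: "p' s = - Om * (r s * r1 s)" for s using r0[of s] Om by (simp add: r1_def)
  have F2: "r s * B1 s = - (c + V * p s) / Om" for s
  proof -
    have "r s * B1 s = (r s * r s) * w s" by (simp add: B1_def)
    moreover have "2 * X / Om * (- Y / (2 * X)) = - Y / Om" if "X \<noteq> 0" for X Y :: real
      using that Om by (simp add: field_simps)
    ultimately show ?thesis unfolding r2 w_def by (simp only: A0 not_False_eq_True)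
  qed
  have F3: "(r1 s)\<^sup>2 + (B1 s)\<^sup>2 + (p s)\<^sup>2 = 1" for s
  proof -
    have "Om\<^sup>2 * (r s * r s) * ((r1 s)\<^sup>2 + (B1 s)\<^sup>2) = (Om * (r s * r1 s))\<^sup>2 + (Om * (r s * B1 s))\<^sup>2"
      by (simp add: power2_eq_square algebra_simps)
    also have "Om * (r s * r1 s) = - p' s" unfolding F1 by simp
    also have "Om * (r s * B1 s) = - (c + V * p s)" unfolding F2 using Om by simp
    also have "(- p' s)\<^sup>2 + (- (c + V * p s))\<^sup>2 = (p' s)\<^sup>2 + (c + V * p s)\<^sup>2" by (simp only: power2_minus)
    also have "\<dots> = 2 * Om * (A - p s) * (1 - (p s)\<^sup>2)" unfolding energy by simp
    finally have "Om\<^sup>2 * (r s * r s) * ((r1 s)\<^sup>2 + (B1 s)\<^sup>2) = 2 * Om * (A - p s) * (1 - (p s)\<^sup>2)" .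
    moreover have "Om\<^sup>2 * (r s * r s) = 2 * Om * (A - p s)" unfolding r2 using Om by (simp add: power2_eq_square)
    ultimately have "(2 * Om * (A - p s)) * ((r1 s)\<^sup>2 + (B1 s)\<^sup>2) = (2 * Om * (A - p s)) * (1 - (p s)\<^sup>2)"
      by (simp only:)
    then have "(r1 s)\<^sup>2 + (B1 s)\<^sup>2 = 1 - (p s)\<^sup>2" using A0[of s] Om by simp
    then show ?thesis by simp
  qed
  have F4: "B2 s = V * r1 s" for s
  proof -
    have "r s * B2 s = 2 * (r s * r1 s) * w s + (r s * r s) * w1 s" by (simp add: B2_def algebra_simps)
    also have "r s * r1 s = - p' s / Om" using F1[of s] Om by (simp add: field_simps)
    also have "2 * (- p' s / Om) * w s + (r s * r s) * w1 s = V * (- p' s / Om)"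
      unfolding r2 w_def w1_def using A0[of s] Om by (simp add: divide_simps) (simp add: power2_eq_square algebra_simps)
    also have "- p' s / Om = r s * r1 s" using F1[of s] Om by (simp add: field_simps)
    finally have "r s * B2 s = r s * (V * r1 s)" by simp
    then show ?thesis using r0[of s] by simp
  qed
  have F5: "A2 s = Om * r s * p s - V * B1 s" for s
  proof -
    have "r s * r11 s = - p'' s / Om + p' s * r1 s / (Om * r s)"
      unfolding r11_def using r0[of s] Om by (simp add: field_simps)
    also have "p' s * r1 s / (Om * r s) = - (r1 s)\<^sup>2"
      unfolding F1 using r0[of s] Om by (simp add: power2_eq_square)
    finally have "r s * A2 s = - p'' s / Om - ((r1 s)\<^sup>2 + (B1 s)\<^sup>2)"
      by (simp add: A2_def B1_def power2_eq_square algebra_simps)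
    also have "(r1 s)\<^sup>2 + (B1 s)\<^sup>2 = 1 - (p s)\<^sup>2" using F3[of s] by simp
    also have "- p'' s / Om - (1 - (p s)\<^sup>2) = 2 * (A - p s) * p s - V * (- (c + V * p s) / Om)"
      unfolding acc using Om by (simp add: field_simps)
    also have "\<dots> = Om * (r s * r s) * p s - V * (r s * B1 s)" unfolding F2 r2 using Om by simp
    finally have "r s * A2 s = r s * (Om * r s * p s - V * B1 s)" by (simp add: algebra_simps)
    then show ?thesis using r0[of s] by simp
  qed
  have cB1: "c + V * p s = - Om * (r s * B1 s)" for s using F2[of s] Om by (simp add: field_simps)
  have G1: "B1 s * p' s - p s * B2 s = c * r1 s" for s
  proof -
    have "B1 s * p' s = r1 s * (- Om * (r s * B1 s))" unfolding F1 by simp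
    then show ?thesis unfolding cB1[symmetric] F4 by (simp add: algebra_simps)
  qed
  have G2: "p s * A2 s - r1 s * p' s = Om * r s + c * B1 s" for s
  proof -
    have "p s * A2 s - r1 s * p' s = Om * r s * ((p s)\<^sup>2 + (r1 s)\<^sup>2) - V * p s * B1 s"
      unfolding F1 F5 by (simp add: algebra_simps power2_eq_square)
    also have "(p s)\<^sup>2 + (r1 s)\<^sup>2 = 1 - (B1 s)\<^sup>2" using F3[of s] by simp
    also have "Om * r s * (1 - (B1 s)\<^sup>2) - V * p s * B1 s = Om * r s + (- Om * (r s * B1 s)) * B1 s - V * p s * B1 s"
      by (simp add: algebra_simps power2_eq_square)
    finally show ?thesis unfolding cB1[symmetric] by (simp add: algebra_simps)
  qed
  have G3: "r1 s * B2 s - B1 s * A2 s = V + c * p s" for s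
  proof -
    have "r1 s * B2 s - B1 s * A2 s = V * ((r1 s)\<^sup>2 + (B1 s)\<^sup>2) + (- Om * (r s * B1 s)) * p s"
      unfolding F4 F5 by (simp add: algebra_simps power2_eq_square)
    also have "(r1 s)\<^sup>2 + (B1 s)\<^sup>2 = 1 - (p s)\<^sup>2" using F3[of s] by simp
    finally show ?thesis unfolding cB1[symmetric] by (simp add: algebra_simps power2_eq_square)
  qed
  define a where "a = (\<lambda>s. r s * cos (th s))"
  define b where "b = (\<lambda>s. r s * sin (th s))"
  define a1 where "a1 = (\<lambda>s. r1 s * cos (th s) - B1 s * sin (th s))"
  define b1 where "b1 = (\<lambda>s. r1 s * sin (th s) + B1 s * cos (th s))"
  define a2 where "a2 = (\<lambda>s. A2 s * cos (th s) - B2 s * sin (th s))"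
  define b2 where "b2 = (\<lambda>s. A2 s * sin (th s) + B2 s * cos (th s))"
  have da: "(a has_real_derivative a1 s) (at s)" "(b has_real_derivative b1 s) (at s)" for s
    unfolding a_def b_def a1_def b1_def B1_def
    by (auto intro!: derivative_eq_intros dr dth' simp: algebra_simps)
  have da1: "(a1 has_real_derivative a2 s) (at s)" "(b1 has_real_derivative b2 s) (at s)" for s
    unfolding a1_def b1_def a2_def b2_def A2_def B2_def B1_def
    by (auto intro!: derivative_eq_intros dr dr1 dw dth' simp: algebra_simps power2_eq_square)
  have cs: "cos (th s) * cos (th s) + sin (th s) * sin (th s) = 1" for s
    using sin_cos_squared_add2[of "th s"] by (simp add: power2_eq_square)
  have yv: "y = (\<lambda>s. vec3 (a s) (b s) (z s))" unfolding y a_def b_def r_def ..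
  have dy: "(y has_vector_derivative vec3 (a1 s) (b1 s) (p s)) (at s)" for s
    unfolding yv by (rule has_vector_derivative_vec3[OF da dz])
  have "norm (vec3 (a1 s) (b1 s) (p s)) = 1" for s
  proof -
    have "(a1 s)\<^sup>2 + (b1 s)\<^sup>2 = ((r1 s)\<^sup>2 + (B1 s)\<^sup>2) * (cos (th s) * cos (th s) + sin (th s) * sin (th s))"
      unfolding a1_def b1_def by (rule rotated_square)
    then show ?thesis unfolding cs norm_vec3 using F3[of s] by simp
  qed
  then have speed: "y differentiable (at s) \<and> norm (vector_derivative y (at s)) = 1" for s
    using vector_derivative_at[OF dy] differentiableI_vector[OF dy] by simp
  have "solves_LIE L (screw_motion (Om, \<lambda>s. vec3 (a s) (b s) (z s), c, V))"
  proof (rule solves_LIE_screw_motion[OF da(1) da1(1) da(2) da1(2) dz dp(1)])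
    fix s
    have "b1 s * p' s - p s * b2 s = (B1 s * p' s - p s * B2 s) * cos (th s) - (p s * A2 s - r1 s * p' s) * sin (th s)"
      unfolding b1_def b2_def by (simp add: algebra_simps)
    then show "b1 s * p' s - p s * b2 s = - Om * b s + c * a1 s"
      unfolding G1 G2 b_def a1_def by (simp add: algebra_simps)
    have "p s * a2 s - a1 s * p' s = (p s * A2 s - r1 s * p' s) * cos (th s) + (B1 s * p' s - p s * B2 s) * sin (th s)"
      unfolding a1_def a2_def by (simp add: algebra_simps)
    then show "p s * a2 s - a1 s * p' s = Om * a s + c * b1 s"
      unfolding G1 G2 a_def b1_def by (simp add: algebra_simps)
    have "a1 s * b2 s - b1 s * a2 s = (cos (th s) * cos (th s) + sin (th s) * sin (th s)) * (r1 s * B2 s - B1 s * A2 s)"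
      unfolding a1_def b1_def a2_def b2_def
      using rotated_wedge[of "cos (th s)" "r1 s" "sin (th s)" "B1 s" "A2 s" "B2 s"] by (simp only: mult.commute)
    then show "a1 s * b2 s - b1 s * a2 s = V + c * p s" unfolding G3 cs by simp
    show "a (s + L) = a s" "b (s + L) = b s" "z (s + L) = z s" by (simp_all add: a_def b_def r_def L)
  qed
  then show ?thesis using speed unfolding yv[symmetric] by blast
qed

section \<open>The bifurcating family\<close>

lemma prim_periodic_nat:
  assumes B: "open B" "convex B" "0 \<in> B" and f: "f holomorphic_on B" and y: "y \<in> B"
    and p: "\<And>z. z \<in> B \<Longrightarrow> z + p \<in> B" "\<And>z. z \<in> B \<Longrightarrow> f (z + p) = f z"
  shows "y + of_nat n * p \<in> B \<and> prim f (y + of_nat n * p) = prim f y + of_nat n * prim f p"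
proof (induction n)
  case (Suc n)
  have e: "y + of_nat (Suc n) * p = (y + of_nat n * p) + p" by (simp add: algebra_simps)
  show ?case
    unfolding e
  proof (rule conjI)
    show "(y + of_nat n * p) + p \<in> B" using p(1) Suc by blast
    show "prim f ((y + of_nat n * p) + p) = prim f y + of_nat (Suc n) * prim f p"
      using Suc prim_periodic[OF B f _ p, of "y + of_nat n * p"] by (simp add: distrib_right)
  qed
qed (use y in simp)

lemma has_real_derivative_Re_scaled:
  assumes "(f has_field_derivative D) (at (of_real (k * s)))"
  shows "((\<lambda>s. Re (f (of_real (k * s)))) has_real_derivative k * Re D) (at s)"
proof -
  have "(f has_field_derivative D) (at (of_real k * of_real s))" using assms by simp
  then have "((\<lambda>z. f (of_real k * z)) has_field_derivative D * of_real k) (at (of_real s))"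
    by (rule DERIV_chain2) (auto intro!: derivative_eq_intros)
  then have "((\<lambda>t. f (of_real k * of_real t)) has_vector_derivative D * of_real k) (at s)"
    by (rule has_vector_derivative_real_field)
  then have "((\<lambda>t. Re (f (of_real k * of_real t))) has_vector_derivative Re (D * of_real k)) (at s)"
    by (rule bounded_linear.has_vector_derivative[OF bounded_linear_Re])
  then show ?thesis by (simp add: has_real_derivative_iff_has_vector_derivative mult.commute)
qed

text \<open>
  The imaginary part vanishes on the real axis, and so does its derivative.
\<close>
lemma derivative_Reals:
  fixes f :: "complex \<Rightarrow> complex"
  assumes f: "(f has_field_derivative D) (at (of_real s))" and re: "\<And>t. f (of_real t) \<in> \<real>"
  shows "D \<in> \<real>"
proof -
  have "((\<lambda>t. f (of_real t)) has_vector_derivative D) (at s)"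
    by (rule has_vector_derivative_real_field[OF f])
  then have "((\<lambda>t. Im (f (of_real t))) has_vector_derivative Im D) (at s)"
    by (rule bounded_linear.has_vector_derivative[OF bounded_linear_Im])
  moreover have "Im (f (of_real t)) = 0" for t using re[of t] by (simp add: complex_is_Real_iff)
  ultimately have "((\<lambda>t. 0::real) has_vector_derivative Im D) (at s)" by simp
  then have "Im D = 0" using vector_derivative_unique_at has_vector_derivative_const by blast
  then show ?thesis by (simp add: complex_is_Real_iff)
qed

text \<open>
  The normalised data are rescaled to radius \<open>R\<close>: the angle variable is \<open>k s / R\<close> and the modulus is
  \<open>x = 2 (k^2 - 1) / (k R) \<lambda>\<close>.  The latter factor is chosen so that the second-order coefficient of the velocity comes out as in
  the statement.  The curve is assembled in cylindrical coordinates; over \<open>k\<close> periods of the profile its angle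
  gains exactly \<open>2 \<pi>\<close>.
\<close>
lemma screw_family_exists:
  fixes R :: real and k :: nat
  assumes R: "R > 0" and k: "k \<ge> 2"
  obtains r b :: real and Om c V :: "complex \<Rightarrow> complex" and Y :: "3 \<Rightarrow> complex \<Rightarrow> complex \<Rightarrow> complex" where
    "r > 0" "b > 0" "Om holomorphic_on ball 0 r" "c holomorphic_on ball 0 r" "V holomorphic_on ball 0 r"
    "\<And>i. holo2 (ball 0 r) (strip b) (Y i)"
    "\<And>i x s. x \<in> ball 0 r \<Longrightarrow> s \<in> strip b \<Longrightarrow> Y i x (s + of_real (torus_length R)) = Y i x s"
    "\<And>l. \<bar>l\<bar> < r \<Longrightarrow> defines_axial_screw_motion (torus_length R)
       (Re (Om (of_real l)), (\<lambda>s. \<chi> i. Re (Y i (of_real l) (of_real s))), Re (c (of_real l)), Re (V (of_real l)))"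
    "Re (Om 0) = critical_velocity R k" "(\<lambda>s. \<chi> i. Re (Y i 0 (of_real s))) = circle_profile R"
    "Re (c 0) = - R * critical_velocity R k" "Re (V 0) = 1 / R"
    "((\<lambda>l. (1 / R - Re (V (of_real l))) / l\<^sup>2) \<longlongrightarrow> (real k)\<^sup>2 * ((real k)\<^sup>2 - 1) / (2 * R ^ 3)) (at 0)"
proof -
  obtain d :: real and om v g al :: "complex \<Rightarrow> complex" and p p' :: "complex \<Rightarrow> complex \<Rightarrow> complex" where
    d: "d > 0" and hol: "om holomorphic_on ball 0 d" "v holomorphic_on ball 0 d" "g holomorphic_on ball 0 d" "al holomorphic_on ball 0 d"
    and ph: "holo2 (ball 0 d) (strip 1) p"
    and dp: "\<And>x s. x \<in> ball 0 d \<Longrightarrow> s \<in> strip 1 \<Longrightarrow> (p x has_field_derivative p' x s) (at s)"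
    and dp': "\<And>x s. x \<in> ball 0 d \<Longrightarrow> s \<in> strip 1 \<Longrightarrow> (p' x has_field_derivative
       (- om x * (1 - (p x s)\<^sup>2) - 2 * om x * p x s * (al x - p x s) - v x * (g x + v x * p x s)) / (of_nat k)\<^sup>2) (at s)"
    and energy: "\<And>x s. x \<in> ball 0 d \<Longrightarrow> s \<in> strip 1 \<Longrightarrow>
       (of_nat k)\<^sup>2 * (p' x s)\<^sup>2 = 2 * om x * (al x - p x s) * (1 - (p x s)\<^sup>2) - (g x + v x * p x s)\<^sup>2"
    and pper: "\<And>x s. x \<in> ball 0 d \<Longrightarrow> s \<in> strip 1 \<Longrightarrow> p x (s + of_real (2 * pi)) = p x s"
    and mp: "\<And>x. x \<in> ball 0 d \<Longrightarrow> prim (p x) (of_real (2 * pi)) = 0"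
    and mh: "\<And>x. x \<in> ball 0 d \<Longrightarrow> prim (\<lambda>s. (g x + v x * p x s) / (al x - p x s)) (of_real (2 * pi)) = - of_real (4 * pi)"
    and pos: "\<And>x s. x \<in> ball 0 d \<Longrightarrow> s \<in> strip 1 \<Longrightarrow> Re ((al x - p x s) / om x) > 0"
    and ompos: "\<And>x. x \<in> ball 0 d \<Longrightarrow> Re (om x) > 0"
    and real1: "\<And>x. x \<in> ball 0 d \<Longrightarrow> x \<in> \<real> \<Longrightarrow> om x \<in> \<real> \<and> v x \<in> \<real> \<and> g x \<in> \<real> \<and> al x \<in> \<real>"
    and preal: "\<And>x s. x \<in> ball 0 d \<Longrightarrow> x \<in> \<real> \<Longrightarrow> s \<in> \<real> \<Longrightarrow> p x s \<in> \<real>"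
    and z0: "om 0 = of_real (sqrt (real k ^ 2 - 1))" "v 0 = 1" "g 0 = - om 0" "al 0 = om 0 / 2" "\<And>s. p 0 s = 0"
    and lim: "((\<lambda>x. (1 - v x) / x\<^sup>2) \<longlongrightarrow> of_real ((real k ^ 2 / (2 * sqrt (real k ^ 2 - 1)))\<^sup>2 / 2)) (at 0)"
    by (rule screw_data_exists[OF k], rule that)
  have S1: "open (strip 1)" "convex (strip 1)" "0 \<in> strip 1"
    by (simp_all add: open_strip convex_strip zero_in_strip)
  define w0 where "w0 = sqrt (real k ^ 2 - 1)"
  have w0: "w0 > 0" "w0\<^sup>2 = real k ^ 2 - 1"
  proof -
    have "real k ^ 2 \<ge> 2 ^ 2" by (rule power_mono) (use k in auto)
    then show "w0\<^sup>2 = real k ^ 2 - 1" "w0 > 0" by (auto simp: w0_def)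
  qed
  have k0: "real k > 0" "(of_nat k :: complex) \<noteq> 0" using k by auto
  have omnz: "om x \<noteq> 0" if "x \<in> ball 0 d" for x using ompos[OF that] by auto
  have den: "al x - p x s \<noteq> 0" if "x \<in> ball 0 d" "s \<in> strip 1" for x s using pos[OF that] by auto
  define h where "h = (\<lambda>x s. (g x + v x * p x s) / (al x - p x s))"
  have hh: "holo2 (ball 0 d) (strip 1) h"
    unfolding h_def by (intro holo2_intros ph holo2_fst hol den)
  have hper: "h x (s + of_real (2 * pi)) = h x s" if "x \<in> ball 0 d" "s \<in> strip 1" for x s
    unfolding h_def pper[OF that] ..
  define Hp where "Hp = (\<lambda>x. prim (h x))"
  define Z where "Z = (\<lambda>x. prim (p x))"
  have Hh: "holo2 (ball 0 d) (strip 1) Hp" unfolding Hp_def by (rule holo2_prim[OF hh open_ball S1])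
  have Zh: "holo2 (ball 0 d) (strip 1) Z" unfolding Z_def by (rule holo2_prim[OF ph open_ball S1])
  define T where "T = (\<lambda>x s. - Hp x s / (2 * of_nat k))"
  have Th: "holo2 (ball 0 d) (strip 1) T" unfolding T_def by (intro holo2_intros Hh) (use k0 in auto)
  define rr where "rr = (\<lambda>x s. of_real R * csqrt (2 * ((al x - p x s) / om x)))"
  have rrh: "holo2 (ball 0 d) (strip 1) rr"
    unfolding rr_def
  proof (intro holo2_mult holo2_const csqrt_holo2 holo2_divide holo2_diff ph holo2_fst hol omnz)
    have "Re (2 * z) > 0" if "Re z > 0" for z :: complex using that by simp
    then show "Re (2 * ((al x - p x s) / om x)) > 0" if "x \<in> ball 0 d" "s \<in> strip 1" for x s
      using pos[OF that] by blast
  qed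
  define W :: "3 \<Rightarrow> complex \<Rightarrow> complex \<Rightarrow> complex" where
    "W = (\<lambda>i x s. if i = 1 then rr x s * cos (T x s) else if i = 2 then rr x s * sin (T x s) else of_real R / of_nat k * Z x s)"
  have Wi: "W 1 = (\<lambda>x s. rr x s * cos (T x s))" "W 2 = (\<lambda>x s. rr x s * sin (T x s))" "W 3 = (\<lambda>x s. of_real R / of_nat k * Z x s)"
    by (simp_all add: W_def)
  have ct: "holo2 (ball 0 d) (strip 1) (\<lambda>x s. cos (T x s))" "holo2 (ball 0 d) (strip 1) (\<lambda>x s. sin (T x s))"
    by (rule holo2_compose[OF Th, of cos UNIV] holo2_compose[OF Th, of sin UNIV]; auto intro!: holomorphic_intros)+
  have Wh: "holo2 (ball 0 d) (strip 1) (W i)" for i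
    using exhaust_3[of i]
    by (elim disjE) (simp_all only: Wi, intro holo2_mult rrh ct, intro holo2_mult rrh ct, intro holo2_mult holo2_const Zh)
  have addper: "s + of_nat k * of_real (2 * pi) \<in> strip 1" if "s \<in> strip 1" for s :: complex
    using strip_plus_of_real[OF that, of "real k * (2 * pi)"] by simp
  have pperk: "p x (s + of_nat k * of_real (2 * pi)) = p x s" if "x \<in> ball 0 d" "s \<in> strip 1" for x s
    using periodic_strip_int[of 1 "p x" "2 * pi" s "int k"] pper[OF that(1)] that(2) by simp
  have Hperk: "Hp x (s + of_nat k * of_real (2 * pi)) = Hp x s - of_nat k * of_real (4 * pi)" if x: "x \<in> ball 0 d" and s: "s \<in> strip 1" for x s
    unfolding Hp_def
    using prim_periodic_nat[OF S1 holo2D(2)[OF hh x] s strip_plus_of_real hper[OF x], of k] mh[OF x] by (simp add: h_def[abs_def])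
  have Zperk: "Z x (s + of_nat k * of_real (2 * pi)) = Z x s" if x: "x \<in> ball 0 d" and s: "s \<in> strip 1" for x s
    unfolding Z_def
    using prim_periodic_nat[OF S1 holo2D(2)[OF ph x] s strip_plus_of_real pper[OF x], of k] mp[OF x] by simp
  have Tperk: "T x (s + of_nat k * of_real (2 * pi)) = T x s + of_real (2 * pi)" if x: "x \<in> ball 0 d" and s: "s \<in> strip 1" for x s
    unfolding T_def Hperk[OF that] using k0 by (simp add: field_simps)
  have Wperk: "W i x (s + of_nat k * of_real (2 * pi)) = W i x s" if x: "x \<in> ball 0 d" and s: "s \<in> strip 1" for i x s
  proof -
    have "rr x (s + of_nat k * of_real (2 * pi)) = rr x s" unfolding rr_def pperk[OF that] ..
    moreover have "cos (T x s + of_real (2 * pi)) = cos (T x s)" "sin (T x s + of_real (2 * pi)) = sin (T x s)"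
      by (simp_all only: cos_add sin_add cos_of_real sin_of_real cos_two_pi sin_two_pi) simp_all
    ultimately show ?thesis unfolding W_def Tperk[OF that] Zperk[OF that] by simp
  qed
  define be where "be = 2 * (real k ^ 2 - 1) / (real k * R)"
  have be: "be > 0" using w0 k0 R by (simp add: be_def zero_less_divide_iff flip: w0(2))
  define ka where "ka = real k / R"
  have ka: "ka > 0" using k0 R by (simp add: ka_def)
  define r where "r = d / be"
  define b where "b = 1 / ka"
  have rb: "r > 0" "b > 0" using d be ka by (simp_all add: r_def b_def)
  have xin: "of_real be * l \<in> ball 0 d" if "l \<in> ball 0 r" for l :: complex
    using that be by (simp add: r_def norm_mult field_simps)
  have sin1: "of_real ka * s \<in> strip 1" if "s \<in> strip b" for s :: complex
    using that ka by (simp add: b_def strip_def abs_mult field_simps)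
  define Y where "Y = (\<lambda>i l s. W i (of_real be * l) (of_real ka * s))"
  define Om where "Om = (\<lambda>l. om (of_real be * l) / of_real (R\<^sup>2))"
  define c where "c = (\<lambda>l. g (of_real be * l) / of_real R)"
  define V where "V = (\<lambda>l. v (of_real be * l) / of_real R)"
  have comp: "(\<lambda>l. f (of_real be * l)) holomorphic_on ball 0 r" if "f holomorphic_on ball 0 d" for f
    by (rule holomorphic_on_compose_gen[of "\<lambda>l. of_real be * l" _ f "ball 0 d", unfolded o_def])
       (use that xin in \<open>auto intro!: holomorphic_intros\<close>)
  have Yh: "holo2 (ball 0 r) (strip b) (Y i)" for i
    unfolding Y_def by (rule holo2_subst[OF Wh]) (use xin sin1 in \<open>auto intro!: holomorphic_intros\<close>)
  have Yper: "Y i x (s + of_real (torus_length R)) = Y i x s" if x: "x \<in> ball 0 r" and s: "s \<in> strip b" for i x s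
  proof -
    have "of_real ka * (s + of_real (torus_length R)) = of_real ka * s + of_nat k * of_real (2 * pi)"
      using R by (simp add: ka_def field_simps)
    then show ?thesis unfolding Y_def using Wperk[OF xin[OF x] sin1[OF s]] by simp
  qed
  have L: "torus_length R > 0" using R by simp
  have screw: "defines_axial_screw_motion (torus_length R)
       (Re (Om (of_real l)), (\<lambda>s. \<chi> i. Re (Y i (of_real l) (of_real s))), Re (c (of_real l)), Re (V (of_real l)))"
    if l: "\<bar>l\<bar> < r" for l
  proof -
    define x :: complex where "x = of_real be * of_real l"
    have lr: "complex_of_real l \<in> ball 0 r" using l by simp
    have x: "x \<in> ball 0 d" "x \<in> \<real>" unfolding x_def using xin[OF lr] by auto
    obtain om1 v1 g1 al1 where e: "om x = of_real om1" "v x = of_real v1" "g x = of_real g1" "al x = of_real al1"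
      using real1[OF x] by (auto elim!: Reals_cases)
    have s1: "of_real t \<in> strip 1" for t by (simp add: strip_def)
    define P where "P = (\<lambda>s. Re (p x (of_real (ka * s))))"
    define Pd where "Pd = (\<lambda>s. Re (p' x (of_real (ka * s))))"
    have pe: "p x (of_real (ka * s)) = of_real (P s)" for s
      using preal[OF x, of "of_real (ka * s)"] by (simp add: P_def)
    have p'e: "p' x (of_real (ka * s)) = of_real (Pd s)" for s
      using derivative_Reals[OF dp[OF x(1) s1, of "ka * s"]] preal[OF x] by (simp add: Pd_def)
    have om1: "om1 > 0" using ompos[OF x(1)] by (simp add: e)
    have pos1: "(al1 - P s) / om1 > 0" for s
    proof -
      have "Re (of_real ((al1 - P s) / om1) :: complex) > 0"
        using pos[OF x(1) s1, of "ka * s"] unfolding pe e by simp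
      then show ?thesis by simp
    qed
    have pos2: "al1 - P s > 0" for s using pos1[of s] om1 by (simp add: zero_less_divide_iff)
    define th where "th = (\<lambda>s. Re (T x (of_real (ka * s))))"
    define z where "z = (\<lambda>s. Re (W 3 x (of_real (ka * s))))"
    have Rs: "\<real> \<subseteq> strip 1" by (auto simp: strip_def complex_is_Real_iff)
    have hreal: "h x s \<in> \<real>" if "s \<in> \<real>" for s
      unfolding h_def using real1[OF x] preal[OF x that] by (intro Reals_divide Reals_add Reals_diff Reals_mult) auto
    have Hreal: "Hp x (of_real t) \<in> \<real>" for t
      unfolding Hp_def
      by (rule prim_Reals[OF hreal _ continuous_on_subset[OF holomorphic_on_imp_continuous_on[OF holo2D(2)[OF hh x(1)]] Rs]]) auto
    have Te: "T x (of_real (ka * s)) = of_real (th s)" for s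
    proof -
      have "T x (of_real (ka * s)) \<in> \<real>" unfolding T_def by (rule Reals_divide[OF Reals_minus[OF Hreal]]) simp
      then show ?thesis by (simp add: th_def)
    qed
    have Lka: "ka * (s + torus_length R) = ka * s + real k * (2 * pi)" for s using R by (simp add: ka_def field_simps)
    have sper: "complex_of_real (ka * (s + torus_length R)) = of_real (ka * s) + of_nat k * of_real (2 * pi)" for s
      unfolding Lka by simp
    define y where "y = (\<lambda>s. \<chi> i. Re (Y i (of_real l) (of_real s)))"
    have yeq: "y = (\<lambda>s. vec3 (sqrt (2 * (al1 - P s) / (om1 / R\<^sup>2)) * cos (th s)) (sqrt (2 * (al1 - P s) / (om1 / R\<^sup>2)) * sin (th s)) (z s))"
    proof
      fix s
      have "rr x (of_real (ka * s)) = of_real (R * sqrt (2 * ((al1 - P s) / om1)))"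
      proof -
        have eq: "2 * ((al x - p x (of_real (ka * s))) / om x) = of_real (2 * ((al1 - P s) / om1))"
          unfolding pe e by simp
        have "csqrt (of_real X) = of_real (sqrt X)" if "X > 0" for X :: real
          using that by (simp add: csqrt_of_real_nonneg)
        moreover have "2 * ((al1 - P s) / om1) > 0" by (rule mult_pos_pos[OF _ pos1]) simp
        ultimately have "csqrt (of_real (2 * ((al1 - P s) / om1))) = of_real (sqrt (2 * ((al1 - P s) / om1)))" by blast
        then show ?thesis unfolding rr_def eq by (simp only: of_real_mult[of R])
      qed
      moreover have "R * sqrt (2 * ((al1 - P s) / om1)) = sqrt (2 * (al1 - P s) / (om1 / R\<^sup>2))"
      proof -
        have "2 * (al1 - P s) / (om1 / R\<^sup>2) = R\<^sup>2 * (2 * ((al1 - P s) / om1))" using om1 R by (simp add: field_simps)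
        then show ?thesis using R by (simp only: real_sqrt_mult real_sqrt_abs abs_of_pos)
      qed
      ultimately have re: "rr x (of_real (ka * s)) = of_real (sqrt (2 * (al1 - P s) / (om1 / R\<^sup>2)))" by (simp only:)
      have Yw: "Y i (of_real l) (of_real s) = W i x (of_real (ka * s))" for i by (simp add: Y_def x_def)
      show "y s = vec3 (sqrt (2 * (al1 - P s) / (om1 / R\<^sup>2)) * cos (th s)) (sqrt (2 * (al1 - P s) / (om1 / R\<^sup>2)) * sin (th s)) (z s)"
        unfolding y_def vec_eq_iff forall_3 vec3_nth vec_lambda_beta z_def Yw Wi(1,2) re Te
        by (simp only: cos_of_real sin_of_real of_real_mult[symmetric] Re_complex_of_real)
    qed
    have dP: "(P has_real_derivative ka * Pd s) (at s)" for s
      unfolding P_def Pd_def by (rule has_real_derivative_Re_scaled[OF dp[OF x(1) s1]])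
    \<comment> \<open>The real second derivative of the rescaled slope.\<close>
    define Pdd where "Pdd = (\<lambda>s. - (om1 / R\<^sup>2) * (1 - (P s)\<^sup>2) - 2 * (om1 / R\<^sup>2) * P s * (al1 - P s) - v1 / R * (g1 / R + v1 / R * P s))"
    have dPd: "((\<lambda>s. ka * Pd s) has_real_derivative Pdd s) (at s)" for s
    proof -
      let ?E = "(- om1 * (1 - (P s)\<^sup>2) - 2 * om1 * P s * (al1 - P s) - v1 * (g1 + v1 * P s)) / (real k)\<^sup>2"
      have "(Pd has_real_derivative ka * Re (of_real ?E)) (at s)"
      proof -
        have "(p' x has_field_derivative of_real ?E) (at (of_real (ka * s)))"
          using dp'[OF x(1) s1, of "ka * s"] unfolding pe e by simp
        then show ?thesis unfolding Pd_def by (rule has_real_derivative_Re_scaled)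
      qed
      then have "((\<lambda>s. ka * Pd s) has_real_derivative ka * (ka * ?E)) (at s)" by (intro DERIV_cmult) simp
      moreover have "ka * (ka * ?E) = Pdd s"
        unfolding ka_def Pdd_def using k0 R by (simp add: field_simps power2_eq_square)
      ultimately show ?thesis by simp
    qed
    have main: "(\<forall>s. y differentiable (at s) \<and> norm (vector_derivative y (at s)) = 1) \<and>
        solves_LIE (torus_length R) (screw_motion (om1 / R\<^sup>2, y, g1 / R, v1 / R))"
    proof (rule screw_motion_from_axial_profile[OF _ _ _ _ _ dP dPd _ _ pos2 _ _ yeq])
      show "om1 / R\<^sup>2 > 0" using om1 R by simp
      show "P (s + torus_length R) = P s" for s unfolding P_def sper pperk[OF x(1) s1] ..
      show "z (s + torus_length R) = z s" for s unfolding z_def sper Wperk[OF x(1) s1] ..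
      have "th (s + torus_length R) = th s + 2 * pi" for s unfolding th_def sper Tperk[OF x(1) s1] by simp
      then show "cos (th (s + torus_length R)) = cos (th s)" "sin (th (s + torus_length R)) = sin (th s)" for s by simp_all
      show "(ka * Pd s)\<^sup>2 = 2 * (om1 / R\<^sup>2) * (al1 - P s) * (1 - (P s)\<^sup>2) - (g1 / R + v1 / R * P s)\<^sup>2" for s
      proof -
        have "complex_of_real ((real k)\<^sup>2 * (Pd s)\<^sup>2) = of_real (2 * om1 * (al1 - P s) * (1 - (P s)\<^sup>2) - (g1 + v1 * P s)\<^sup>2)"
          using energy[OF x(1) s1, of "ka * s"] unfolding pe p'e e by simp
        then have "(real k)\<^sup>2 * (Pd s)\<^sup>2 = 2 * om1 * (al1 - P s) * (1 - (P s)\<^sup>2) - (g1 + v1 * P s)\<^sup>2"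
          by (simp only: of_real_eq_iff)
        then have "((real k)\<^sup>2 * (Pd s)\<^sup>2) / R\<^sup>2 = (2 * om1 * (al1 - P s) * (1 - (P s)\<^sup>2) - (g1 + v1 * P s)\<^sup>2) / R\<^sup>2"
          by simp
        moreover have "((real k)\<^sup>2 * (Pd s)\<^sup>2) / R\<^sup>2 = (ka * Pd s)\<^sup>2" by (simp add: ka_def power_mult_distrib power_divide)
        moreover have "(2 * om1 * (al1 - P s) * (1 - (P s)\<^sup>2) - (g1 + v1 * P s)\<^sup>2) / R\<^sup>2 =
          2 * (om1 / R\<^sup>2) * (al1 - P s) * (1 - (P s)\<^sup>2) - (g1 / R + v1 / R * P s)\<^sup>2"
          using R by (simp add: field_simps power2_eq_square)
        ultimately show ?thesis by simp
      qed
      show "Pdd s = - (om1 / R\<^sup>2) * (1 - (P s)\<^sup>2) - 2 * (om1 / R\<^sup>2) * P s * (al1 - P s) - v1 / R * (g1 / R + v1 / R * P s)" for s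
        by (simp add: Pdd_def)
      show "(th has_real_derivative - (g1 / R + v1 / R * P s) / (2 * (al1 - P s))) (at s)" for s
      proof -
        have "(Hp x has_field_derivative h x (of_real (ka * s))) (at (of_real (ka * s)))"
          unfolding Hp_def by (rule has_field_derivative_prim[OF S1 holo2D(2)[OF hh x(1)] s1])
        then have "(T x has_field_derivative - h x (of_real (ka * s)) / (2 * of_nat k)) (at (of_real (ka * s)))"
          unfolding T_def by (intro DERIV_cdivide DERIV_minus)
        then have "(th has_real_derivative ka * Re (- h x (of_real (ka * s)) / (2 * of_nat k))) (at s)"
          unfolding th_def by (rule has_real_derivative_Re_scaled)
        moreover have "- h x (of_real (ka * s)) / (2 * of_nat k) = of_real (- ((g1 + v1 * P s) / (al1 - P s)) / (2 * real k))"
          unfolding h_def pe e by simp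
        moreover have "ka * (- ((g1 + v1 * P s) / (al1 - P s)) / (2 * real k)) = - (g1 / R + v1 / R * P s) / (2 * (al1 - P s))"
          unfolding ka_def using k0 R pos2[of s] by (simp add: field_simps)
        ultimately show ?thesis by (simp only: Re_complex_of_real)
      qed
      show "(z has_real_derivative P s) (at s)" for s
      proof -
        have "(Z x has_field_derivative p x (of_real (ka * s))) (at (of_real (ka * s)))"
          unfolding Z_def by (rule has_field_derivative_prim[OF S1 holo2D(2)[OF ph x(1)] s1])
        then have "(W 3 x has_field_derivative of_real R / of_nat k * p x (of_real (ka * s))) (at (of_real (ka * s)))"
          unfolding Wi by (rule DERIV_cmult)
        then have "(z has_real_derivative ka * Re (of_real R / of_nat k * p x (of_real (ka * s)))) (at s)"
          unfolding z_def by (rule has_real_derivative_Re_scaled)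
        moreover have "of_real R / of_nat k * p x (of_real (ka * s)) = of_real (R / real k * P s)"
          unfolding pe by simp
        moreover have "ka * (R / real k * P s) = P s" unfolding ka_def using k0 R by simp
        ultimately show ?thesis by (simp only: Re_complex_of_real)
      qed
    qed
    have sob: "y \<in> sobolev3 (torus_length R) 4"
      unfolding y_def by (rule sobolev3_Re[OF L rb(2) holo2D(2)[OF Yh lr]]) (rule Yper[OF lr])
    have vals: "Re (Om (of_real l)) = om1 / R\<^sup>2" "Re (c (of_real l)) = g1 / R" "Re (V (of_real l)) = v1 / R"
      unfolding Om_def c_def V_def x_def[symmetric] e by simp_all
    show ?thesis
      unfolding vals y_def[symmetric] using main sob by simp
  qed
  have cv: "critical_velocity R k = w0 / R\<^sup>2" by (simp add: critical_velocity_def w0_def)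
  have circ: "(\<lambda>s. \<chi> i. Re (Y i 0 (of_real s))) = circle_profile R"
  proof
    fix s :: real
    have "Z 0 s = 0" for s by (simp add: Z_def prim_def z0)
    moreover have "h 0 = (\<lambda>s. -2)" using w0(1) by (auto simp: h_def z0 w0_def[symmetric] fun_eq_iff)
    then have "T 0 (of_real (ka * s)) = of_real (s / R)" using k0 by (simp add: T_def Hp_def prim_def ka_def)
    moreover have "rr 0 s = of_real R" for s using w0(1) by (simp add: rr_def z0 w0_def[symmetric])
    ultimately show "(\<chi> i. Re (Y i 0 (of_real s))) = circle_profile R s"
      unfolding vec_eq_iff forall_3 vec_lambda_beta circle_profile_def
      by (simp add: Y_def Wi axis_def cos_of_real sin_of_real flip: of_real_mult of_real_divide)
  qed
  have limV: "((\<lambda>l. (1 / R - Re (V (of_real l))) / l\<^sup>2) \<longlongrightarrow> (real k)\<^sup>2 * ((real k)\<^sup>2 - 1) / (2 * R ^ 3)) (at 0)"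
  proof -
    let ?q = "(real k ^ 2 / (2 * w0))\<^sup>2 / 2"
    have "((\<lambda>l::real. of_real be * of_real l :: complex) \<longlongrightarrow> of_real be * of_real 0) (at 0)" by (intro tendsto_intros)
    then have "filterlim (\<lambda>l::real. of_real be * of_real l :: complex) (at 0) (at 0)"
      unfolding filterlim_at using be by (auto simp: eventually_at_filter)
    then have "((\<lambda>l::real. (1 - v (of_real be * of_real l)) / (of_real be * of_real l)\<^sup>2) \<longlongrightarrow> of_real ?q) (at 0)"
      using filterlim_compose[OF lim[folded w0_def]] by blast
    then have "((\<lambda>l::real. Re ((1 - v (of_real be * of_real l)) / (of_real be * of_real l)\<^sup>2)) \<longlongrightarrow> ?q) (at 0)"
      using tendsto_Re by fastforce
    then have "((\<lambda>l::real. be\<^sup>2 / R * Re ((1 - v (of_real be * of_real l)) / (of_real be * of_real l)\<^sup>2)) \<longlongrightarrow> be\<^sup>2 / R * ?q) (at 0)"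
      by (rule tendsto_mult_left)
    moreover have "be\<^sup>2 / R * Re ((1 - v (of_real be * of_real l)) / (of_real be * of_real l)\<^sup>2) = (1 / R - Re (V (of_real l))) / l\<^sup>2" for l
    proof -
      have "(1 - v (of_real be * of_real l)) / (of_real be * of_real l)\<^sup>2 = (1 - v (of_real be * of_real l)) / of_real ((be * l)\<^sup>2)" by simp
      then have "Re ((1 - v (of_real be * of_real l)) / (of_real be * of_real l)\<^sup>2) = (1 - Re (v (of_real be * of_real l))) / (be * l)\<^sup>2"
        by (simp only: Re_divide_of_real minus_complex.simps one_complex.simps)
      moreover have "Re (V (of_real l)) = Re (v (of_real be * of_real l)) / R" unfolding V_def by (rule Re_divide_of_real)
      ultimately show ?thesis using be R by (cases "l = 0") (simp_all add: field_simps power_mult_distrib)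
    qed
    moreover have "be\<^sup>2 / R * ?q = (real k)\<^sup>2 * ((real k)\<^sup>2 - 1) / (2 * R ^ 3)"
    proof -
      have bee: "be = 2 * w0\<^sup>2 / (real k * R)" by (simp add: be_def w0(2))
      have "be\<^sup>2 / R * ?q = (real k)\<^sup>2 * w0\<^sup>2 / (2 * R ^ 3)"
        unfolding bee using k0 R w0(1) by (simp add: field_simps power2_eq_square power3_eq_cube)
      then show ?thesis by (simp only: w0(2))
    qed
    ultimately show ?thesis by simp
  qed
  show ?thesis
  proof (rule that[of r b Om c V Y])
    show "Om holomorphic_on ball 0 r" unfolding Om_def using R by (intro holomorphic_on_divide comp hol holomorphic_on_const) simp
    show "c holomorphic_on ball 0 r" unfolding c_def using R by (intro holomorphic_on_divide comp hol holomorphic_on_const) simp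
    show "V holomorphic_on ball 0 r" unfolding V_def using R by (intro holomorphic_on_divide comp hol holomorphic_on_const) simp
    show "Re (Om 0) = critical_velocity R k" unfolding cv Om_def by (simp add: z0 w0_def)
    show "Re (c 0) = - R * critical_velocity R k" unfolding cv c_def using R by (simp add: z0 w0_def power2_eq_square)
    show "Re (V 0) = 1 / R" unfolding V_def by (simp add: z0)
  qed (use rb Yh Yper screw circ limV in auto)
qed

lemma dist_H2_le:
  assumes g: "g \<in> A" shows "dist_H2 L f A \<le> hnorm3 L 2 (\<lambda>s. f s - g s)"
  unfolding dist_H2_def by (rule cINF_lower[OF bdd_belowI2[of _ 0] g]) (rule hnorm3_nonneg)

theorem theorem1p5:
  fixes R :: real and k :: nat
  assumes "R > 0" and "k \<ge> 2"
  shows "\<exists>\<epsilon>>0. \<exists>(\<Omega> :: real \<Rightarrow> real) (y :: real \<Rightarrow> real \<Rightarrow> real^3) (c :: real \<Rightarrow> real) (V :: real \<Rightarrow> real).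
    smooth_curve_on (torus_length R) {-\<epsilon><..<\<epsilon>} (\<lambda>l. (\<Omega> l, y l, c l, V l)) \<and>
    (\<Omega> 0, y 0, c 0, V 0) =
      (critical_velocity R k, circle_profile R, - R * critical_velocity R k, 1 / R) \<and>
    (\<forall>l\<in>{-\<epsilon><..<\<epsilon>}. defines_axial_screw_motion (torus_length R) (\<Omega> l, y l, c l, V l)) \<and>
    (\<exists>C>0. \<forall>l\<in>{-\<epsilon><..<\<epsilon>}. \<forall>t\<ge>0.
       dist_H2 (torus_length R) (\<lambda>s. screw_motion (\<Omega> l, y l, c l, V l) s t) (circle_orbit R)
         \<le> C * \<bar>l\<bar>) \<and>
    (\<forall>l\<in>{-\<epsilon><..<\<epsilon>}. l \<noteq> 0 \<longrightarrow>
       (\<exists>\<gamma>>0. \<exists>t0>0. \<forall>s. \<forall>t\<ge>t0.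
          norm (screw_motion (\<Omega> l, y l, c l, V l) s t - circle_filament R s t) \<ge> \<gamma> * t)) \<and>
    (\<forall>l\<in>{-\<epsilon><..<\<epsilon>}. l \<noteq> 0 \<longrightarrow> V l < 1 / R) \<and>
    (\<lambda>l. V l - (1 / R - ((real k)\<^sup>2 * ((real k)\<^sup>2 - 1) / (2 * R ^ 3)) * l\<^sup>2))
      \<in> o[at 0](\<lambda>l. l\<^sup>2)"
proof -
  note R = assms(1)
  let ?L = "torus_length R"
  have L: "?L > 0" using R by simp
  obtain r b :: real and Om c V :: "complex \<Rightarrow> complex" and Y :: "3 \<Rightarrow> complex \<Rightarrow> complex \<Rightarrow> complex" where
    r: "r > 0" and b: "b > 0" and hol: "Om holomorphic_on ball 0 r" "c holomorphic_on ball 0 r" "V holomorphic_on ball 0 r"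
    and Yh: "\<And>i. holo2 (ball 0 r) (strip b) (Y i)"
    and Yper: "\<And>i x s. x \<in> ball 0 r \<Longrightarrow> s \<in> strip b \<Longrightarrow> Y i x (s + of_real ?L) = Y i x s"
    and screw: "\<And>l. \<bar>l\<bar> < r \<Longrightarrow> defines_axial_screw_motion ?L
       (Re (Om (of_real l)), (\<lambda>s. \<chi> i. Re (Y i (of_real l) (of_real s))), Re (c (of_real l)), Re (V (of_real l)))"
    and base: "Re (Om 0) = critical_velocity R k" "(\<lambda>s. \<chi> i. Re (Y i 0 (of_real s))) = circle_profile R"
      "Re (c 0) = - R * critical_velocity R k" "Re (V 0) = 1 / R"
    and limV: "((\<lambda>l. (1 / R - Re (V (of_real l))) / l\<^sup>2) \<longlongrightarrow> (real k)\<^sup>2 * ((real k)\<^sup>2 - 1) / (2 * R ^ 3)) (at 0)"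
    by (rule screw_family_exists[OF assms], rule that)
  define y where "y = (\<lambda>l s. (\<chi> i. Re (Y i (of_real l) (of_real s))) :: real^3)"
  let ?Om = "\<lambda>l. Re (Om (of_real l))" and ?c = "\<lambda>l. Re (c (of_real l))" and ?V = "\<lambda>l. Re (V (of_real l))"
  have yv: "y l = (\<lambda>s. vec3 (Re (Y 1 (of_real l) (of_real s))) (Re (Y 2 (of_real l) (of_real s))) (Re (Y 3 (of_real l) (of_real s))))" for l
    by (simp add: fun_eq_iff y_def vec_eq_iff forall_3 vec3_nth)
  define q where "q = (real k)\<^sup>2 * ((real k)\<^sup>2 - 1) / (2 * R ^ 3)"
  have q: "q > 0"
  proof -
    have "real k ^ 2 \<ge> 2 ^ 2" by (rule power_mono) (use assms in auto)
    then show ?thesis using R assms(2) unfolding q_def by (intro divide_pos_pos mult_pos_pos) auto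
  qed
  \<comment> \<open>radius on which the axial velocity is smaller than that of the circle\<close>
  have "eventually (\<lambda>l. (1 / R - ?V l) / l\<^sup>2 > 0) (at 0)"
    using order_tendstoD(1)[OF limV, of 0] q by (simp add: q_def)
  then obtain e1 where e1: "e1 > 0" "\<And>l. l \<noteq> 0 \<Longrightarrow> \<bar>l\<bar> < e1 \<Longrightarrow> (1 / R - ?V l) / l\<^sup>2 > 0"
    unfolding eventually_at by (auto simp: dist_norm)
  have Vless: "?V l < 1 / R" if "l \<noteq> 0" "\<bar>l\<bar> < e1" for l
    using e1(2)[OF that] that(1) by (simp add: zero_less_divide_iff)
  have lip: "\<exists>K d. K > 0 \<and> d > 0 \<and> (\<forall>h s. norm h \<le> d \<longrightarrow> s \<in> strip (b/2) \<longrightarrow> norm (Y i h s - Y i 0 s) \<le> K * norm h)" for i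
    using holo2_difference_quotient_bound[OF Yh open_ball b L _ Yper, of 0 i] r by (metis add_0 centre_in_ball)
  obtain K d where Kd: "\<And>i. K i > (0::real)" "\<And>i. d i > (0::real)"
    and Kb: "\<And>i h s. norm h \<le> d i \<Longrightarrow> s \<in> strip (b/2) \<Longrightarrow> norm (Y i h s - Y i 0 s) \<le> K i * norm h"
    using lip by metis
  define K0 where "K0 = Max (range K)"
  define d0 where "d0 = Min (range d)"
  have d0: "d0 > 0" "d0 \<le> d i" for i using Kd by (auto simp: d0_def)
  have K0: "K i \<le> K0" "0 < K0" for i
    using Kd by (auto simp: K0_def Max_gr_iff)
  define \<epsilon> where "\<epsilon> = min r (min e1 d0)"
  have eps: "\<epsilon> > 0" "\<epsilon> \<le> r" "\<epsilon> \<le> e1" "\<epsilon> \<le> d0" using r e1 d0 by (auto simp: \<epsilon>_def)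
  have smooth: "smooth_curve_on ?L {-\<epsilon><..<\<epsilon>} (\<lambda>l. (?Om l, y l, ?c l, ?V l))"
  proof -
    have sub: "ball 0 \<epsilon> \<subseteq> (ball 0 r :: complex set)" by (rule subset_ball[OF eps(2)])
    show ?thesis
      unfolding y_def
      by (rule smooth_curve_on_holo2[OF L b])
         (use hol Yh Yper sub in \<open>auto intro: holomorphic_on_subset holo2_subset simp del: mem_ball\<close>)
  qed
  have stab: "dist_H2 ?L (\<lambda>s. screw_motion (?Om l, y l, ?c l, ?V l) s t) (circle_orbit R)
      \<le> (4 * K0 * sobolev_const ?L 2 (b/2) + 1) * \<bar>l\<bar>" if l: "\<bar>l\<bar> < \<epsilon>" for l t
  proof -
    define \<tau> where "\<tau> = (?V l * t) *\<^sub>R (axis 3 1 :: real^3)"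
    \<comment> \<open>The competitor in the orbit is the circle carried along by the same screw motion.\<close>
    define \<alpha> where "\<alpha> = ?Om l * t + ?c l * t / R"
    define g where "g = (\<lambda>s. rot_z \<alpha> *v circle_profile R s + \<tau>)"
    have gin: "g \<in> circle_orbit R" unfolding circle_orbit_def g_def by blast
    have g_eq: "g s = screw_motion (?Om l, y 0, ?c l, ?V l) s t" for s
    proof -
      have cp: "circle_profile R u = vec3 (R * cos (u / R)) (R * sin (u / R)) 0" for u
        by (simp add: circle_profile_def vec3_eq)
      have y0: "y 0 = circle_profile R" using base(2) by (simp add: y_def)
      have ang: "\<alpha> + s / R = ?Om l * t + (s + ?c l * t) / R" using R by (simp add: \<alpha>_def field_simps)
      have "g s = vec3 (R * cos (\<alpha> + s / R)) (R * sin (\<alpha> + s / R)) 0 + \<tau>"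
        unfolding g_def cp rot_z_vec3 by (simp add: cos_add sin_add algebra_simps)
      also have "\<dots> = screw_motion (?Om l, y 0, ?c l, ?V l) s t"
        unfolding ang y0 screw_motion.simps cp rot_z_vec3 \<tau>_def by (simp add: cos_add sin_add algebra_simps)
      finally show ?thesis .
    qed
    let ?D = "\<lambda>s. screw_motion (?Om l, y l, ?c l, ?V l) s t - g s"
    define sh where "sh = ?c l * t"
    define E where "E = (\<lambda>i z. Y i (of_real l) (z + of_real sh) - Y i 0 (z + of_real sh))"
    define C S where "C = complex_of_real (cos (?Om l * t))" and "S = complex_of_real (sin (?Om l * t))"
    define G :: "3 \<Rightarrow> complex \<Rightarrow> complex" where
      "G = (\<lambda>i z. if i = 1 then C * E 1 z - S * E 2 z else if i = 2 then S * E 1 z + C * E 2 z else E 3 z)"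
    have CS: "norm C \<le> 1" "norm S \<le> 1" by (simp_all add: C_def S_def)
    have lr: "complex_of_real l \<in> ball 0 r" "(0::complex) \<in> ball 0 r" using l eps r by auto
    have sb: "strip (b/2) \<subseteq> strip b" using b by (simp add: strip_mono)
    have Ehol: "E i holomorphic_on strip (b/2)" for i
    proof -
      have "(\<lambda>z. Y i x (z + of_real sh)) holomorphic_on strip (b/2)" if "x \<in> ball 0 r" for x
        by (rule holomorphic_on_compose_gen[of "\<lambda>z. z + of_real sh" _ "Y i x" "strip b", unfolded o_def])
           (use sb strip_plus_of_real[of _ "b/2"] holo2D(2)[OF Yh that] in \<open>auto intro!: holomorphic_intros\<close>)
      then show ?thesis unfolding E_def using lr by (intro holomorphic_on_diff) auto
    qed
    have Eb: "norm (E i z) \<le> K0 * \<bar>l\<bar>" if z: "z \<in> strip (b/2)" for i z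
    proof -
      have "norm (E i z) \<le> K i * norm (complex_of_real l)"
        unfolding E_def by (rule Kb) (use l eps d0(2)[of i] strip_plus_of_real[OF z] in auto)
      also have "\<dots> \<le> K0 * \<bar>l\<bar>" using K0(1)[of i] by (simp add: mult_right_mono)
      finally show ?thesis .
    qed
    have Eper: "E i (z + of_real ?L) = E i z" if z: "z \<in> strip (b/2)" for i z
    proof -
      have "z + of_real sh \<in> strip b" using strip_plus_of_real[OF z] sb by blast
      moreover have "z + of_real ?L + of_real sh = (z + of_real sh) + of_real ?L" by simp
      ultimately show ?thesis unfolding E_def using Yper lr by metis
    qed
    have Gb: "norm (G i z) \<le> 2 * K0 * \<bar>l\<bar>" if z: "z \<in> strip (b/2)" for i z
    proof -
      have t: "norm (w * E j z) \<le> K0 * \<bar>l\<bar>" if "norm w \<le> 1" for w j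
        using mult_mono[OF that Eb[OF z, of j]] by (simp add: norm_mult)
      have "norm (C * E 1 z - S * E 2 z) \<le> K0 * \<bar>l\<bar> + K0 * \<bar>l\<bar>" "norm (S * E 1 z + C * E 2 z) \<le> K0 * \<bar>l\<bar> + K0 * \<bar>l\<bar>"
        by (intro order_trans[OF norm_triangle_ineq4] order_trans[OF norm_triangle_ineq] add_mono t CS)+
      moreover have "norm (E 3 z) \<le> K0 * \<bar>l\<bar> + K0 * \<bar>l\<bar>" using Eb[OF z, of 3] K0(2) by (intro add_increasing2) auto
      ultimately show ?thesis by (simp add: G_def)
    qed
    have "hnorm3 ?L 2 ?D \<le> 2 * ((2 * K0 * \<bar>l\<bar>) * sobolev_const ?L 2 (b/2))"
    proof (rule hnorm3_le)
      fix i :: 3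
      have "?D s $ i = Re (G i (of_real s))" for s
        using exhaust_3[of i] unfolding g_eq yv screw_motion_vec3
        by (auto simp: vec3_nth G_def E_def C_def S_def sh_def algebra_simps)
      moreover have "hnorm ?L 2 (\<lambda>s. Re (G i (of_real s))) \<le> (2 * K0 * \<bar>l\<bar>) * sobolev_const ?L 2 (b/2)"
      proof (rule hnorm_Re_le[OF L])
        show "G i holomorphic_on strip (b/2)"
          using exhaust_3[of i] Ehol by (auto simp: G_def intro!: holomorphic_intros)
        show "G i (s + of_real ?L) = G i s" if "s \<in> strip (b/2)" for s
          unfolding G_def Eper[OF that] ..
      qed (use b Gb in auto)
      ultimately show "hnorm ?L 2 (\<lambda>s. ?D s $ i) \<le> (2 * K0 * \<bar>l\<bar>) * sobolev_const ?L 2 (b/2)" by simp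
    qed
    then have "dist_H2 ?L (\<lambda>s. screw_motion (?Om l, y l, ?c l, ?V l) s t) (circle_orbit R) \<le> 4 * K0 * sobolev_const ?L 2 (b/2) * \<bar>l\<bar>"
      using dist_H2_le[OF gin, of ?L "\<lambda>s. screw_motion (?Om l, y l, ?c l, ?V l) s t"] by (simp add: algebra_simps)
    then show ?thesis by (simp add: algebra_simps)
  qed
  have Cpos: "4 * K0 * sobolev_const ?L 2 (b/2) + 1 > 0"
  proof -
    have "sobolev_const ?L 2 (b/2) \<ge> 0" unfolding sobolev_const_def using b R by (intro mult_nonneg_nonneg sum_nonneg real_sqrt_ge_zero) auto
    then show ?thesis using K0(2) by (simp add: add_nonneg_pos)
  qed
  have drift: "\<exists>\<gamma>>0. \<exists>t0>0. \<forall>s. \<forall>t\<ge>t0. norm (screw_motion (?Om l, y l, ?c l, ?V l) s t - circle_filament R s t) \<ge> \<gamma> * t"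
    if l: "\<bar>l\<bar> < \<epsilon>" "l \<noteq> 0" for l
  proof -
    have lr: "complex_of_real l \<in> ball 0 r" using l eps by auto
    obtain B where B: "B > 0" "\<And>s. s \<in> strip (b/2) \<Longrightarrow> norm (Y 3 (of_real l) s) \<le> B"
    proof (rule holo2_strip_bound[OF Yh[of 3], of "b/2" "{complex_of_real l}" ?L])
      show "0 < b/2" "b/2 < b" using b by simp_all
      show "{complex_of_real l} \<subseteq> ball 0 r" using lr by simp
      fix M :: real assume M: "M > 0" "\<And>x s. x \<in> {complex_of_real l} \<Longrightarrow> s \<in> strip (b/2) \<Longrightarrow> norm (Y 3 x s) \<le> M"
      show thesis by (rule that[OF M(1)]) (use M(2) in simp)
    qed (use L Yper in simp_all)
    have Bz: "\<bar>Re (Y 3 (of_real l) (of_real s))\<bar> \<le> B" for s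
      using abs_Re_le_cmod[of "Y 3 (of_real l) (of_real s)"] B(2)[OF of_real_in_strip[of "b/2" s]] b by linarith
    define \<gamma> where "\<gamma> = (1 / R - ?V l) / 2"
    have g: "\<gamma> > 0" using Vless[OF l(2)] l eps by (simp add: \<gamma>_def)
    show ?thesis
    proof (rule exI[of _ \<gamma>], rule conjI, rule g, rule exI[of _ "B / \<gamma>"], intro conjI allI impI)
      show "B / \<gamma> > 0" using g B by simp
      fix s t assume t: "t \<ge> B / \<gamma>"
      then have Bt: "B \<le> \<gamma> * t" using g by (simp add: field_simps)
      let ?x = "screw_motion (?Om l, y l, ?c l, ?V l) s t - circle_filament R s t"
      have "?x $ 3 = Re (Y 3 (of_real l) (of_real (s + ?c l * t))) + ?V l * t - t / R"
        unfolding yv screw_motion_vec3 by (simp add: vec3_nth circle_filament_def circle_profile_def axis_def)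
      moreover have "?V l * t - t / R = - 2 * (\<gamma> * t)" by (simp add: \<gamma>_def algebra_simps)
      ultimately have "\<bar>?x $ 3\<bar> \<ge> \<gamma> * t" using Bz[of "s + ?c l * t"] Bt by linarith
      then show "norm ?x \<ge> \<gamma> * t" using component_le_norm_cart[of ?x 3] by linarith
    qed
  qed
  have small: "(\<lambda>l. ?V l - (1 / R - q * l\<^sup>2)) \<in> o[at 0](\<lambda>l. l\<^sup>2)"
  proof (rule smalloI_tendsto)
    have "((\<lambda>l. q - (1 / R - ?V l) / l\<^sup>2) \<longlongrightarrow> q - q) (at 0)"
      by (rule tendsto_diff[OF tendsto_const limV[folded q_def]])
    moreover have "eventually (\<lambda>l. q - (1 / R - ?V l) / l\<^sup>2 = (?V l - (1 / R - q * l\<^sup>2)) / l\<^sup>2) (at 0)"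
      unfolding eventually_at_filter by (rule always_eventually) (simp add: field_simps)
    ultimately show "((\<lambda>l. (?V l - (1 / R - q * l\<^sup>2)) / l\<^sup>2) \<longlongrightarrow> 0) (at 0)"
      by (simp add: Lim_transform_eventually)
    show "eventually (\<lambda>l::real. l\<^sup>2 \<noteq> 0) (at 0)" by (simp add: eventually_at_filter)
  qed
  show ?thesis
  proof (rule exI[of _ \<epsilon>], rule conjI, rule eps(1), rule exI[of _ ?Om], rule exI[of _ y], rule exI[of _ ?c], rule exI[of _ ?V], intro conjI)
    show "smooth_curve_on ?L {-\<epsilon><..<\<epsilon>} (\<lambda>l. (?Om l, y l, ?c l, ?V l))" by (rule smooth)
    show "(?Om 0, y 0, ?c 0, ?V 0) = (critical_velocity R k, circle_profile R, - R * critical_velocity R k, 1 / R)"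
      using base by (simp add: y_def)
    show "\<forall>l\<in>{-\<epsilon><..<\<epsilon>}. defines_axial_screw_motion ?L (?Om l, y l, ?c l, ?V l)"
    proof
      fix l assume "l \<in> {-\<epsilon><..<\<epsilon>}"
      then have "\<bar>l\<bar> < r" using eps by auto
      then show "defines_axial_screw_motion ?L (?Om l, y l, ?c l, ?V l)" unfolding y_def by (rule screw)
    qed
    show "\<exists>C>0. \<forall>l\<in>{-\<epsilon><..<\<epsilon>}. \<forall>t\<ge>0. dist_H2 ?L (\<lambda>s. screw_motion (?Om l, y l, ?c l, ?V l) s t) (circle_orbit R) \<le> C * \<bar>l\<bar>"
    proof (rule exI[of _ "4 * K0 * sobolev_const ?L 2 (b/2) + 1"], intro conjI Cpos ballI allI impI stab)
      fix l assume "l \<in> {-\<epsilon><..<\<epsilon>}"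
      then show "\<bar>l\<bar> < \<epsilon>" by auto
    qed
    show "\<forall>l\<in>{-\<epsilon><..<\<epsilon>}. l \<noteq> 0 \<longrightarrow> (\<exists>\<gamma>>0. \<exists>t0>0. \<forall>s. \<forall>t\<ge>t0.
          norm (screw_motion (?Om l, y l, ?c l, ?V l) s t - circle_filament R s t) \<ge> \<gamma> * t)"
      by (intro ballI impI drift) auto
    show "\<forall>l\<in>{-\<epsilon><..<\<epsilon>}. l \<noteq> 0 \<longrightarrow> ?V l < 1 / R"
      by (intro ballI impI Vless) (use eps in auto)
    show "(\<lambda>l. ?V l - (1 / R - ((real k)\<^sup>2 * ((real k)\<^sup>2 - 1) / (2 * R ^ 3)) * l\<^sup>2)) \<in> o[at 0](\<lambda>l. l\<^sup>2)"
      using small unfolding q_def .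
  qed
qed

end
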